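(* Let $(M,g)$ be a flat Riemannian manifold of dimension $m$, $f:M\to ]0,+\infty[$ a smooth function, and let $TM$ carry the Sasaki metric $\widehat g$ and the Mus-Sasaki metric $\widetilde g$ (associated with $f$). Then the identity map $\widehat{Id}_{f}:(TM,\widehat g)\to(TM,\widetilde g)$ is proper biharmonic if and only if $$\frac{m}{4}\operatorname{grad}\big(\|\operatorname{grad}f\|^{2}\big)=\operatorname{Tr}_{g}\nabla^{2}(\operatorname{grad}f).$$
   Context: In induced local coordinates $(x^i,y^i)$ on $TM$, the vertical and horizontal lifts of $X=X^i\frac{\partial}{\partial x^i}$ are $X^V=X^i\frac{\partial}{\partial y^i}$ and $X^H=X^i\big(\frac{\partial}{\partial x^i}-y^j\Gamma_{ij}^k\frac{\partial}{\partial y^k}\big)$, where $\Gamma_{ij}^k$ are the Christoffel symbols of $g$. The Sasaki metric $\widehat g$ on $TM$ is given by $\widehat g(X^H,Y^H)_{(x,u)}=g_x(X,Y)$, $\widehat g(X^H,Y^V)_{(x,u)}=0$, $\widehat g(X^V,Y^V)_{(x,u)}=g_x(X,Y)$. The Mus-Sasaki metric $\widetilde g$ is given by $\widetilde g(X^H,Y^H)_{(x,u)}=g_x(X,Y)$, $\widetilde g(X^H,Y^V)_{(x,u)}=0$, $\widetilde g(X^V,Y^V)_{(x,u)}=f(x)g_x(X,Y)$. Gradient, norm and Levi-Civita connection $\nabla$ are those of $g$, and $\operatorname{Tr}_g\nabla^2Z=\sum_i\big(\nabla_{E_i}\nabla_{E_i}Z-\nabla_{\nabla_{E_i}E_i}Z\big)$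 for a local $g$-orthonormal frame $(E_i)$. For a smooth map $\varphi$ between Riemannian manifolds with local orthonormal frame $(e_i)$ of the source and target $N$, the tension field is $\tau(\varphi)=\sum_i\big(\nabla^{\varphi}_{e_i}d\varphi(e_i)-d\varphi(\nabla_{e_i}e_i)\big)$ and the bitension field is $\tau_2(\varphi)=-\sum_iR^{N}(\tau(\varphi),d\varphi(e_i))d\varphi(e_i)-\sum_i\big(\nabla^{\varphi}_{e_i}\nabla^{\varphi}_{e_i}\tau(\varphi)-\nabla^{\varphi}_{\nabla_{e_i}e_i}\tau(\varphi)\big)$; $\varphi$ is harmonic iff $\tau(\varphi)=0$, biharmonic iff $\tau_2(\varphi)=0$, and proper biharmonic iff it is biharmonic and not harmonic.
   Formalization: The formal theorem additionally assumes that f is not locally constant: for locally constant f the displayed equation holds trivially while the identity map is harmonic, hence not proper biharmonic, so the printed equivalence fails. *)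

theory Defs
  imports "HOL-Analysis.Analysis"
begin

text \<open>
  A manifold modelled on a Euclidean space is given by an indexed atlas. Vector fields, metrics
  and connections are given by their components in the charts: a tangent vector in the chart c
  is an element of the model space, and a metric is a family \<open>g c x X Y\<close> where \<open>x\<close> is a coordinate
  point of the chart \<open>c\<close> and \<open>X\<close>, \<open>Y\<close> are component vectors there.
\<close>

abbreviation D :: "('e::real_normed_vector \<Rightarrow> 'f::real_normed_vector) \<Rightarrow> 'e \<Rightarrow> 'e \<Rightarrow> 'f"
  where "D F x \<equiv> frechet_derivative F (at x)"

fun Ck_on :: "nat \<Rightarrow> ('e::real_normed_vector \<Rightarrow> 'f::real_normed_vector) \<Rightarrow> 'e set \<Rightarrow> bool" where
  "Ck_on 0 F S \<longleftrightarrow> continuous_on S F"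
| "Ck_on (Suc k) F S \<longleftrightarrow>
     (\<forall>x\<in>S. F differentiable (at x)) \<and> (\<forall>v. Ck_on k (\<lambda>x. D F x v) S)"

text \<open>Only used on open sets.\<close>
definition smooth_on :: "'e::real_normed_vector set \<Rightarrow> ('e \<Rightarrow> 'f::real_normed_vector) \<Rightarrow> bool" where
  "smooth_on S F \<longleftrightarrow> (\<forall>k. Ck_on k F S)"


section \<open>Smooth manifolds\<close>

record ('a, 'i, 'e) manifold =
  charts :: "'i set"
  chart_dom :: "'i \<Rightarrow> 'a set"
  coord :: "'i \<Rightarrow> 'a \<Rightarrow> 'e"

definition points :: "('a, 'i, 'e) manifold \<Rightarrow> 'a set" where
  "points M = (\<Union>c\<in>charts M. chart_dom M c)"

definition chart_image :: "('a, 'i, 'e) manifold \<Rightarrow> 'i \<Rightarrow> 'e set" where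
  "chart_image M c = coord M c ` chart_dom M c"

definition chart_inv :: "('a, 'i, 'e) manifold \<Rightarrow> 'i \<Rightarrow> 'e \<Rightarrow> 'a" where
  "chart_inv M c = inv_into (chart_dom M c) (coord M c)"

definition transition :: "('a, 'i, 'e) manifold \<Rightarrow> 'i \<Rightarrow> 'i \<Rightarrow> 'e \<Rightarrow> 'e" where
  "transition M c d = coord M d \<circ> chart_inv M c"

definition manifold_topology ::
    "('a, 'i, 'e::topological_space) manifold \<Rightarrow> 'a topology" where
  "manifold_topology M = topology (\<lambda>U. U \<subseteq> points M \<and>
     (\<forall>c\<in>charts M. open {x \<in> chart_image M c. chart_inv M c x \<in> U}))"

lemma openin_manifold_topology:
  "openin (manifold_topology M) U \<longleftrightarrow>
     U \<subseteq> points M \<and> (\<forall>c\<in>charts M. open {x \<in> chart_image M c. chart_inv M c x \<in> U})"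
proof -
  have "istopology (\<lambda>U. U \<subseteq> points M \<and>
     (\<forall>c\<in>charts M. open {x \<in> chart_image M c. chart_inv M c x \<in> U}))"
    unfolding istopology_def
  proof (intro conjI allI impI, goal_cases)
    case (1 S T) then show ?case by auto
  next
    case (2 S T)
    have "{x \<in> chart_image M c. chart_inv M c x \<in> S \<inter> T} =
        {x \<in> chart_image M c. chart_inv M c x \<in> S} \<inter> {x \<in> chart_image M c. chart_inv M c x \<in> T}"
      for c by auto
    with 2 show ?case by (simp add: open_Int)
  next
    case (3 K) then show ?case by auto
  next
    case (4 K)
    have "{x \<in> chart_image M c. chart_inv M c x \<in> \<Union> K} =
        (\<Union>U\<in>K. {x \<in> chart_image M c. chart_inv M c x \<in> U})" for c by auto
    with 4 show ?case by auto
  qed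
  then show ?thesis
    by (simp add: manifold_topology_def)
qed

definition smooth_manifold :: "('a, 'i, 'e::euclidean_space) manifold \<Rightarrow> bool" where
  "smooth_manifold M \<longleftrightarrow>
     (\<forall>c\<in>charts M. inj_on (coord M c) (chart_dom M c)) \<and>
     (\<forall>c\<in>charts M. \<forall>d\<in>charts M.
        open (coord M c ` (chart_dom M c \<inter> chart_dom M d)) \<and>
        smooth_on (coord M c ` (chart_dom M c \<inter> chart_dom M d)) (transition M c d)) \<and>
     Hausdorff_space (manifold_topology M) \<and>
     second_countable (manifold_topology M)"

definition smooth_function :: "('a, 'i, 'e::euclidean_space) manifold \<Rightarrow> ('a \<Rightarrow> real) \<Rightarrow> bool" where
  "smooth_function M f \<longleftrightarrow> (\<forall>c\<in>charts M. smooth_on (chart_image M c) (f \<circ> chart_inv M c))"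

definition locally_constant :: "('a, 'i, 'e::euclidean_space) manifold \<Rightarrow> ('a \<Rightarrow> real) \<Rightarrow> bool" where
  "locally_constant M f \<longleftrightarrow>
     (\<forall>p\<in>points M. \<exists>U. openin (manifold_topology M) U \<and> p \<in> U \<and> (\<forall>q\<in>U. f q = f p))"

text \<open>
  A tangent vector at \<open>p\<close> is the family of its components in all charts around \<open>p\<close>, related by
  the derivatives of the transition maps (and set to 0 at all other indices).
\<close>
definition tangent_space :: "('a, 'i, 'e::euclidean_space) manifold \<Rightarrow> 'a \<Rightarrow> ('i \<Rightarrow> 'e) set" where
  "tangent_space M p = {v.
     (\<forall>c\<in>charts M. \<forall>d\<in>charts M. p \<in> chart_dom M c \<longrightarrow> p \<in> chart_dom M d \<longrightarrow>
        v d = D (transition M c d) (coord M c p) (v c)) \<and>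
     (\<forall>c. \<not> (c \<in> charts M \<and> p \<in> chart_dom M c) \<longrightarrow> v c = 0)}"

text \<open>The tangent bundle, with the induced charts \<open>(p, v) \<mapsto> (x\<^sup>i, y\<^sup>i)\<close>.\<close>
definition tangent_bundle ::
    "('a, 'i, 'e::euclidean_space) manifold \<Rightarrow> ('a \<times> ('i \<Rightarrow> 'e), 'i, 'e \<times> 'e) manifold" where
  "tangent_bundle M =
     \<lparr>charts = charts M,
      chart_dom = (\<lambda>c. {(p, v). p \<in> chart_dom M c \<and> v \<in> tangent_space M p}),
      coord = (\<lambda>c (p, v). (coord M c p, v c))\<rparr>"


section \<open>Riemannian geometry in a chart\<close>

type_synonym 'e metric_field = "'e \<Rightarrow> 'e \<Rightarrow> 'e \<Rightarrow> real"

text \<open>\<open>christoffel g x X Y\<close> is the vector with components \<open>X\<^sup>i Y\<^sup>j \<Gamma>\<^sup>k\<^sub>i\<^sub>j\<close>; the index \<open>k\<close> is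
  raised by nondegeneracy of the metric.\<close>
definition christoffel :: "'e::euclidean_space metric_field \<Rightarrow> 'e \<Rightarrow> 'e \<Rightarrow> 'e \<Rightarrow> 'e" where
  "christoffel g x X Y = (THE W. \<forall>Z. g x W Z =
     (D (\<lambda>z. g z Y Z) x X + D (\<lambda>z. g z X Z) x Y - D (\<lambda>z. g z X Y) x Z) / 2)"

definition grad :: "'e::euclidean_space metric_field \<Rightarrow> ('e \<Rightarrow> real) \<Rightarrow> 'e \<Rightarrow> 'e" where
  "grad g F x = (THE W. \<forall>Z. g x W Z = D F x Z)"

definition norm_of :: "'e::euclidean_space metric_field \<Rightarrow> 'e \<Rightarrow> 'e \<Rightarrow> real" where
  "norm_of g x X = sqrt (g x X X)"

definition levi_civita ::
    "'e::euclidean_space metric_field \<Rightarrow> ('e \<Rightarrow> 'e) \<Rightarrow> ('e \<Rightarrow> 'e) \<Rightarrow> 'e \<Rightarrow> 'e" where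
  "levi_civita g X Y x = D Y x (X x) + christoffel g x (X x) (Y x)"

definition lie_bracket :: "('e::euclidean_space \<Rightarrow> 'e) \<Rightarrow> ('e \<Rightarrow> 'e) \<Rightarrow> 'e \<Rightarrow> 'e" where
  "lie_bracket X Y x = D Y x (X x) - D X x (Y x)"

definition curvature_field ::
    "'e::euclidean_space metric_field \<Rightarrow> ('e \<Rightarrow> 'e) \<Rightarrow> ('e \<Rightarrow> 'e) \<Rightarrow> ('e \<Rightarrow> 'e) \<Rightarrow> 'e \<Rightarrow> 'e" where
  "curvature_field g X Y Z x =
     levi_civita g X (levi_civita g Y Z) x - levi_civita g Y (levi_civita g X Z) x
     - levi_civita g (lie_bracket X Y) Z x"

text \<open>The value on vectors is computed by extending them with constant components.\<close>
definition curvature :: "'e::euclidean_space metric_field \<Rightarrow> 'e \<Rightarrow> 'e \<Rightarrow> 'e \<Rightarrow> 'e \<Rightarrow> 'e" where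
  "curvature g x X Y Z = curvature_field g (\<lambda>_. X) (\<lambda>_. Y) (\<lambda>_. Z) x"

definition orthonormal_frame ::
    "'e::euclidean_space metric_field \<Rightarrow> 'e set \<Rightarrow> (nat \<Rightarrow> 'e \<Rightarrow> 'e) \<Rightarrow> bool" where
  "orthonormal_frame g U E \<longleftrightarrow> open U \<and> (\<forall>i<DIM('e). smooth_on U (E i)) \<and>
     (\<forall>x\<in>U. \<forall>i<DIM('e). \<forall>j<DIM('e). g x (E i x) (E j x) = (if i = j then 1 else 0))"

text \<open>A smooth local orthonormal frame around \<open>x\<close>; the traces below do not depend on the choice.\<close>
definition frame_at :: "'e::euclidean_space metric_field \<Rightarrow> 'e \<Rightarrow> nat \<Rightarrow> 'e \<Rightarrow> 'e" where
  "frame_at g x = (SOME E. \<exists>U. x \<in> U \<and> orthonormal_frame g U E)"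

definition trace_nabla2 :: "'e::euclidean_space metric_field \<Rightarrow> ('e \<Rightarrow> 'e) \<Rightarrow> 'e \<Rightarrow> 'e" where
  "trace_nabla2 g Z x = (let E = frame_at g x in \<Sum>i<DIM('e).
     levi_civita g (E i) (levi_civita g (E i) Z) x
     - levi_civita g (levi_civita g (E i) (E i)) Z x)"


section \<open>Tension and bitension field\<close>

text \<open>Below \<open>\<phi>\<close> is the coordinate expression of a map, \<open>g\<close> and \<open>h\<close> are the components of the source
  and of the target metric, and \<open>V\<close> is a section along \<open>\<phi>\<close>.\<close>

definition pullback_connection :: "'f::euclidean_space metric_field \<Rightarrow> ('e::euclidean_space \<Rightarrow> 'f)
    \<Rightarrow> ('e \<Rightarrow> 'e) \<Rightarrow> ('e \<Rightarrow> 'f) \<Rightarrow> 'e \<Rightarrow> 'f" where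
  "pullback_connection h \<phi> X V x = D V x (X x) + christoffel h (\<phi> x) (D \<phi> x (X x)) (V x)"

definition tension :: "'e::euclidean_space metric_field \<Rightarrow> 'f::euclidean_space metric_field
    \<Rightarrow> ('e \<Rightarrow> 'f) \<Rightarrow> 'e \<Rightarrow> 'f" where
  "tension g h \<phi> x = (let E = frame_at g x in \<Sum>i<DIM('e).
     pullback_connection h \<phi> (E i) (\<lambda>z. D \<phi> z (E i z)) x
     - D \<phi> x (levi_civita g (E i) (E i) x))"

definition bitension :: "'e::euclidean_space metric_field \<Rightarrow> 'f::euclidean_space metric_field
    \<Rightarrow> ('e \<Rightarrow> 'f) \<Rightarrow> 'e \<Rightarrow> 'f" where
  "bitension g h \<phi> x = (let E = frame_at g x; \<tau> = tension g h \<phi> in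
     - (\<Sum>i<DIM('e). curvature h (\<phi> x) (\<tau> x) (D \<phi> x (E i x)) (D \<phi> x (E i x)))
     - (\<Sum>i<DIM('e).
          pullback_connection h \<phi> (E i) (pullback_connection h \<phi> (E i) \<tau>) x
          - pullback_connection h \<phi> (levi_civita g (E i) (E i)) \<tau> x))"


section \<open>Riemannian manifolds and biharmonic maps\<close>

type_synonym ('i, 'e) metric = "'i \<Rightarrow> 'e metric_field"

definition riemannian_metric ::
    "('a, 'i, 'e::euclidean_space) manifold \<Rightarrow> ('i, 'e) metric \<Rightarrow> bool" where
  "riemannian_metric M g \<longleftrightarrow>
     (\<forall>c\<in>charts M. \<forall>x\<in>chart_image M c.
        bilinear (g c x) \<and> (\<forall>X Y. g c x X Y = g c x Y X) \<and> (\<forall>X. X \<noteq> 0 \<longrightarrow> g c x X X > 0)) \<and>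
     (\<forall>c\<in>charts M. \<forall>X Y. smooth_on (chart_image M c) (\<lambda>x. g c x X Y)) \<and>
     (\<forall>c\<in>charts M. \<forall>d\<in>charts M. \<forall>p\<in>chart_dom M c \<inter> chart_dom M d. \<forall>X Y.
        g c (coord M c p) X Y =
        g d (coord M d p) (D (transition M c d) (coord M c p) X)
                          (D (transition M c d) (coord M c p) Y))"

definition flat :: "('a, 'i, 'e::euclidean_space) manifold \<Rightarrow> ('i, 'e) metric \<Rightarrow> bool" where
  "flat M g \<longleftrightarrow> (\<forall>c\<in>charts M. \<forall>x\<in>chart_image M c. \<forall>X Y Z. curvature (g c) x X Y Z = 0)"

definition local_expr :: "('a, 'i, 'e) manifold \<Rightarrow> ('b, 'j, 'f) manifold \<Rightarrow> ('a \<Rightarrow> 'b)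
    \<Rightarrow> 'i \<Rightarrow> 'j \<Rightarrow> 'e \<Rightarrow> 'f" where
  "local_expr M N \<phi> c d = coord N d \<circ> \<phi> \<circ> chart_inv M c"

definition local_dom :: "('a, 'i, 'e) manifold \<Rightarrow> ('b, 'j, 'f) manifold \<Rightarrow> ('a \<Rightarrow> 'b)
    \<Rightarrow> 'i \<Rightarrow> 'j \<Rightarrow> 'e set" where
  "local_dom M N \<phi> c d = coord M c ` {p \<in> chart_dom M c. \<phi> p \<in> chart_dom N d}"

definition harmonic :: "('a, 'i, 'e::euclidean_space) manifold \<Rightarrow> ('i, 'e) metric
    \<Rightarrow> ('b, 'j, 'f::euclidean_space) manifold \<Rightarrow> ('j, 'f) metric \<Rightarrow> ('a \<Rightarrow> 'b) \<Rightarrow> bool" where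
  "harmonic M g N h \<phi> \<longleftrightarrow> (\<forall>c\<in>charts M. \<forall>d\<in>charts N. \<forall>x\<in>local_dom M N \<phi> c d.
     tension (g c) (h d) (local_expr M N \<phi> c d) x = 0)"

definition biharmonic :: "('a, 'i, 'e::euclidean_space) manifold \<Rightarrow> ('i, 'e) metric
    \<Rightarrow> ('b, 'j, 'f::euclidean_space) manifold \<Rightarrow> ('j, 'f) metric \<Rightarrow> ('a \<Rightarrow> 'b) \<Rightarrow> bool" where
  "biharmonic M g N h \<phi> \<longleftrightarrow> (\<forall>c\<in>charts M. \<forall>d\<in>charts N. \<forall>x\<in>local_dom M N \<phi> c d.
     bitension (g c) (h d) (local_expr M N \<phi> c d) x = 0)"

definition proper_biharmonic :: "('a, 'i, 'e::euclidean_space) manifold \<Rightarrow> ('i, 'e) metric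
    \<Rightarrow> ('b, 'j, 'f::euclidean_space) manifold \<Rightarrow> ('j, 'f) metric \<Rightarrow> ('a \<Rightarrow> 'b) \<Rightarrow> bool" where
  "proper_biharmonic M g N h \<phi> \<longleftrightarrow> biharmonic M g N h \<phi> \<and> \<not> harmonic M g N h \<phi>"


section \<open>Lifts and the Mus-Sasaki metric\<close>

text \<open>Both lifts of \<open>X\<close> at the point of the tangent bundle with induced coordinates \<open>z = (x, y)\<close>.\<close>

definition vertical_lift :: "'e::euclidean_space \<Rightarrow> 'e \<times> 'e" where
  "vertical_lift X = (0, X)"

definition horizontal_lift :: "'e::euclidean_space metric_field \<Rightarrow> 'e \<times> 'e \<Rightarrow> 'e \<Rightarrow> 'e \<times> 'e" where
  "horizontal_lift g z X = (X, - christoffel g (fst z) X (snd z))"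

definition mus_sasaki_form :: "('a, 'i, 'e::euclidean_space) manifold \<Rightarrow> ('i, 'e) metric
    \<Rightarrow> ('a \<Rightarrow> real) \<Rightarrow> 'i \<Rightarrow> 'e \<times> 'e \<Rightarrow> ('e \<times> 'e \<Rightarrow> 'e \<times> 'e \<Rightarrow> real) \<Rightarrow> bool" where
  "mus_sasaki_form M g f c z B \<longleftrightarrow> bilinear B \<and> (\<forall>\<xi> \<eta>. B \<xi> \<eta> = B \<eta> \<xi>) \<and>
     (\<forall>X Y. B (horizontal_lift (g c) z X) (horizontal_lift (g c) z Y) = g c (fst z) X Y \<and>
            B (horizontal_lift (g c) z X) (vertical_lift Y) = 0 \<and>
            B (vertical_lift X) (vertical_lift Y) =
              f (chart_inv M c (fst z)) * g c (fst z) X Y)"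

text \<open>Existence and uniqueness of this form on the charts of the tangent bundle are shown below.\<close>
definition mus_sasaki :: "('a, 'i, 'e::euclidean_space) manifold \<Rightarrow> ('i, 'e) metric
    \<Rightarrow> ('a \<Rightarrow> real) \<Rightarrow> ('i, 'e \<times> 'e) metric" where
  "mus_sasaki M g f c z = (THE B. mus_sasaki_form M g f c z B)"

definition sasaki :: "('a, 'i, 'e::euclidean_space) manifold \<Rightarrow> ('i, 'e) metric
    \<Rightarrow> ('i, 'e \<times> 'e) metric" where
  "sasaki M g = mus_sasaki M g (\<lambda>_. 1)"

lemma riesz:
  fixes B :: "'e::euclidean_space \<Rightarrow> 'e \<Rightarrow> real"
  assumes B: "bilinear B" and pos: "\<And>X. X \<noteq> 0 \<Longrightarrow> B X X > 0" and l: "linear l"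
  shows "\<exists>!W. \<forall>Z. B W Z = l Z"
proof -
  have lin2: "linear (B w)" and lin1: "linear (\<lambda>w. B w z)" for w z
    using B by (auto simp: bilinear_def)
  have expand: "k Z = (\<Sum>b\<in>Basis. (Z \<bullet> b) * k b)" if "linear k" for k :: "'e \<Rightarrow> real" and Z
  proof -
    have "k Z = k (\<Sum>b\<in>Basis. (Z \<bullet> b) *\<^sub>R b)" by (simp add: euclidean_representation)
    also have "\<dots> = (\<Sum>b\<in>Basis. (Z \<bullet> b) * k b)"
      using that by (simp add: linear_sum linear_scale)
    finally show ?thesis .
  qed
  define T where "T w = (\<Sum>b\<in>Basis. B w b *\<^sub>R b)" for w
  have T: "linear T"
    unfolding T_def
    by (rule linearI)
      (simp_all add: linear_add[OF lin1] linear_scale[OF lin1] scaleR_add_left sum.distrib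
        scaleR_sum_right)
  have "w = 0" if "T w = 0" for w
  proof (rule ccontr)
    assume "w \<noteq> 0"
    have "B w b = 0" if "b \<in> Basis" for b
    proof -
      have "T w \<bullet> b = B w b"
        unfolding T_def using that by (simp add: inner_sum_left_Basis)
      then show ?thesis using \<open>T w = 0\<close> by simp
    qed
    then have "B w w = 0" using expand[OF lin2, of w w] by simp
    with pos[OF \<open>w \<noteq> 0\<close>] show False by simp
  qed
  then have "inj T" using T by (simp add: linear_injective_0)
  then have "surj T" using T by (simp add: linear_injective_imp_surjective)
  then obtain w where w: "T w = (\<Sum>b\<in>Basis. l b *\<^sub>R b)" by (metis surjD)
  have wb: "B w b = l b" if "b \<in> Basis" for b
  proof -
    have "T w \<bullet> b = B w b" unfolding T_def using that by (simp add: inner_sum_left_Basis)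
    moreover have "T w \<bullet> b = l b" unfolding w using that by (simp add: inner_sum_left_Basis)
    ultimately show ?thesis by simp
  qed
  have ex: "\<forall>Z. B w Z = l Z"
  proof
    fix Z
    have "(\<Sum>b\<in>Basis. (Z \<bullet> b) * B w b) = (\<Sum>b\<in>Basis. (Z \<bullet> b) * l b)"
      by (rule sum.cong) (simp_all add: wb)
    then show "B w Z = l Z"
      by (rule trans[OF trans[OF expand[OF lin2, of w Z]] expand[OF l, of Z, symmetric]])
  qed
  show ?thesis
  proof (rule ex1I[where a = w], rule ex)
    fix w' assume w': "\<forall>Z. B w' Z = l Z"
    have "B (w' - w) (w' - w) = 0"
      using linear_diff[OF lin1, of w' w "w' - w"] w' ex by simp
    then show "w' = w" using pos[of "w' - w"] by force
  qed
qed

context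
  fixes M :: "('a, 'i, 'e::euclidean_space) manifold" and g :: "('i, 'e) metric" and c x
  assumes M: "smooth_manifold M" and g: "riemannian_metric M g"
    and c: "c \<in> charts M" and x: "x \<in> chart_image M c"
begin

lemma open_chart_image: "open (chart_image M c)"
  using M c by (auto simp: smooth_manifold_def chart_image_def dest!: bspec)

lemma metric_bilinear: "z \<in> chart_image M c \<Longrightarrow> bilinear (g c z)"
  and metric_sym: "g c x X Y = g c x Y X"
  and metric_pos: "X \<noteq> 0 \<Longrightarrow> g c x X X > 0"
  using g c x by (auto simp: riemannian_metric_def)

lemma metric_linear:
  assumes "z \<in> chart_image M c"
  shows "linear (g c z X)" "linear (\<lambda>X. g c z X Y)"
  using metric_bilinear[OF assms] by (auto simp: bilinear_def)

lemma metric_differentiable: "(\<lambda>z. g c z X Y) differentiable (at x)"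
proof -
  have "Ck_on (Suc 0) (\<lambda>z. g c z X Y) (chart_image M c)"
    using g c unfolding riemannian_metric_def smooth_on_def by blast
  then show ?thesis using x by simp
qed

lemma metric_has_derivative: "((\<lambda>z. g c z X Y) has_derivative D (\<lambda>z. g c z X Y) x) (at x)"
  using metric_differentiable by (simp add: frechet_derivative_works)

lemma D_metric_linear: "linear (D (\<lambda>z. g c z X Y) x)"
  using metric_has_derivative by (rule has_derivative_linear)

lemma D_metric_eqI:
  assumes "(F has_derivative F') (at x)" "\<And>z. z \<in> chart_image M c \<Longrightarrow> F z = g c z X Y"
  shows "D (\<lambda>z. g c z X Y) x = F'"
  by (rule frechet_derivative_at[symmetric])
    (rule has_derivative_transform_within_open[OF assms(1) open_chart_image x assms(2)])

lemma D_metric_linear_left: "linear (\<lambda>X. D (\<lambda>z. g c z X Y) x Z)"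
proof (rule linearI)
  fix X X' :: 'e and r :: real
  have "D (\<lambda>z. g c z (X + X') Y) x = (\<lambda>Z. D (\<lambda>z. g c z X Y) x Z + D (\<lambda>z. g c z X' Y) x Z)"
    by (rule D_metric_eqI[OF has_derivative_add[OF metric_has_derivative metric_has_derivative]])
      (simp add: linear_add[OF metric_linear(2)])
  then show "D (\<lambda>z. g c z (X + X') Y) x Z = D (\<lambda>z. g c z X Y) x Z + D (\<lambda>z. g c z X' Y) x Z"
    by simp
  have "D (\<lambda>z. g c z (r *\<^sub>R X) Y) x = (\<lambda>Z. r *\<^sub>R D (\<lambda>z. g c z X Y) x Z)"
    by (rule D_metric_eqI[OF has_derivative_scaleR_right[OF metric_has_derivative]])
      (simp add: linear_scale[OF metric_linear(2)])
  then show "D (\<lambda>z. g c z (r *\<^sub>R X) Y) x Z = r *\<^sub>R D (\<lambda>z. g c z X Y) x Z"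
    by simp
qed

lemma D_metric_linear_right: "linear (\<lambda>Y. D (\<lambda>z. g c z X Y) x Z)"
proof (rule linearI)
  fix Y Y' :: 'e and r :: real
  have "D (\<lambda>z. g c z X (Y + Y')) x = (\<lambda>Z. D (\<lambda>z. g c z X Y) x Z + D (\<lambda>z. g c z X Y') x Z)"
    by (rule D_metric_eqI[OF has_derivative_add[OF metric_has_derivative metric_has_derivative]])
      (simp add: linear_add[OF metric_linear(1)])
  then show "D (\<lambda>z. g c z X (Y + Y')) x Z = D (\<lambda>z. g c z X Y) x Z + D (\<lambda>z. g c z X Y') x Z"
    by simp
  have "D (\<lambda>z. g c z X (r *\<^sub>R Y)) x = (\<lambda>Z. r *\<^sub>R D (\<lambda>z. g c z X Y) x Z)"
    by (rule D_metric_eqI[OF has_derivative_scaleR_right[OF metric_has_derivative]])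
      (simp add: linear_scale[OF metric_linear(1)])
  then show "D (\<lambda>z. g c z X (r *\<^sub>R Y)) x Z = r *\<^sub>R D (\<lambda>z. g c z X Y) x Z"
    by simp
qed

lemma christoffel_lowered:
  "g c x (christoffel (g c) x X Y) Z =
     (D (\<lambda>z. g c z Y Z) x X + D (\<lambda>z. g c z X Z) x Y - D (\<lambda>z. g c z X Y) x Z) / 2"
proof -
  let ?l = "\<lambda>Z. (D (\<lambda>z. g c z Y Z) x X + D (\<lambda>z. g c z X Z) x Y - D (\<lambda>z. g c z X Y) x Z) / 2"
  have "linear ?l"
    by (rule linearI)
      (simp_all add: linear_add[OF D_metric_linear] linear_scale[OF D_metric_linear]
        linear_add[OF D_metric_linear_right] linear_scale[OF D_metric_linear_right] field_simps)
  from theI'[OF riesz[OF metric_bilinear[OF x] metric_pos this]]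
  show ?thesis unfolding christoffel_def by (rule spec)
qed

lemma metric_eqI:
  assumes "\<And>Z. g c x W Z = g c x W' Z" shows "W = W'"
proof -
  have "g c x (W - W') (W - W') = 0"
    using assms linear_diff[OF metric_linear(2)[OF x], of W W' "W - W'"] by simp
  then show ?thesis using metric_pos[of "W - W'"] by force
qed

lemma linear_christoffel: "linear (\<lambda>X. christoffel (g c) x X Y)"
  by (rule linearI; rule metric_eqI)
    (simp_all add: christoffel_lowered linear_add[OF metric_linear(2)[OF x]]
      linear_scale[OF metric_linear(2)[OF x]]
      linear_add[OF D_metric_linear] linear_scale[OF D_metric_linear]
      linear_add[OF D_metric_linear_left] linear_scale[OF D_metric_linear_left] field_simps)

lemma mus_sasaki_form_iff:
  "mus_sasaki_form M g f c (x, y) B \<longleftrightarrow>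
     B = (\<lambda>\<xi> \<eta>. g c x (fst \<xi>) (fst \<eta>) + f (chart_inv M c x) *
            g c x (snd \<xi> + christoffel (g c) x (fst \<xi>) y) (snd \<eta> + christoffel (g c) x (fst \<eta>) y))"
    (is "_ \<longleftrightarrow> B = ?G")
proof
  define K where "K \<xi> = snd \<xi> + christoffel (g c) x (fst \<xi>) y" for \<xi> :: "'e \<times> 'e"
  have G: "?G = (\<lambda>\<xi> \<eta>. g c x (fst \<xi>) (fst \<eta>) + f (chart_inv M c x) * g c x (K \<xi>) (K \<eta>))"
    by (simp add: K_def)
  have K: "linear K"
    unfolding K_def
    by (rule linearI) (simp_all add: linear_add[OF linear_christoffel]
        linear_scale[OF linear_christoffel] scaleR_add_right)
  note lin = linear_add[OF metric_linear(1)[OF x]] linear_add[OF metric_linear(2)[OF x]]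
    linear_scale[OF metric_linear(1)[OF x]] linear_scale[OF metric_linear(2)[OF x]]
    linear_0[OF metric_linear(1)[OF x]] linear_0[OF metric_linear(2)[OF x]]
    linear_add[OF K] linear_scale[OF K]
  have K_lift: "K (horizontal_lift (g c) (x, y) X) = 0" "K (vertical_lift X) = X" for X
    using linear_0[OF linear_christoffel, of y]
    by (simp_all add: K_def horizontal_lift_def vertical_lift_def)
  have fst_lift: "fst (horizontal_lift (g c) (x, y) X) = X" "fst (vertical_lift X) = 0" for X :: 'e
    by (simp_all add: horizontal_lift_def vertical_lift_def)
  {
    assume "B = ?G"
    then have B: "B = (\<lambda>\<xi> \<eta>. g c x (fst \<xi>) (fst \<eta>) + f (chart_inv M c x) * g c x (K \<xi>) (K \<eta>))"
      by (simp only: G)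
    have "bilinear B"
      unfolding bilinear_def B
      by (intro conjI allI linearI) (simp_all add: lin algebra_simps)
    then show "mus_sasaki_form M g f c (x, y) B"
      unfolding mus_sasaki_form_def
      by (auto simp: B K_lift fst_lift lin metric_sym)
  }
  {
    assume B: "mus_sasaki_form M g f c (x, y) B"
    have split: "\<xi> = horizontal_lift (g c) (x, y) (fst \<xi>) + vertical_lift (K \<xi>)" for \<xi>
      by (cases \<xi>) (simp add: K_def horizontal_lift_def vertical_lift_def)
    show "B = ?G"
      unfolding G
    proof (intro ext)
      fix \<xi> \<eta> :: "'e \<times> 'e"
      let ?H = "horizontal_lift (g c) (x, y)"
      have bil: "bilinear B" and sym: "B \<alpha> \<beta> = B \<beta> \<alpha>" for \<alpha> \<beta>
        using B unfolding mus_sasaki_form_def by blast+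
      have HH: "B (?H X) (?H Y) = g c x X Y" and HV: "B (?H X) (vertical_lift Y) = 0"
        and VV: "B (vertical_lift X) (vertical_lift Y) = f (chart_inv M c x) * g c x X Y" for X Y
        using B unfolding mus_sasaki_form_def fst_conv by blast+
      have "B \<xi> \<eta> = B (?H (fst \<xi>) + vertical_lift (K \<xi>)) (?H (fst \<eta>) + vertical_lift (K \<eta>))"
        by (rule arg_cong2[where f = B, OF split split])
      also have "\<dots> = B (?H (fst \<xi>)) (?H (fst \<eta>)) + B (?H (fst \<xi>)) (vertical_lift (K \<eta>))
          + (B (?H (fst \<eta>)) (vertical_lift (K \<xi>)) + B (vertical_lift (K \<xi>)) (vertical_lift (K \<eta>)))"
        unfolding bilinear_ladd[OF bil] bilinear_radd[OF bil]
            sym[of "vertical_lift (K \<xi>)" "?H (fst \<eta>)"] by simp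
      also have "\<dots> = g c x (fst \<xi>) (fst \<eta>) + f (chart_inv M c x) * g c x (K \<xi>) (K \<eta>)"
        unfolding HH HV VV by simp
      finally show "B \<xi> \<eta> = g c x (fst \<xi>) (fst \<eta>) + f (chart_inv M c x) * g c x (K \<xi>) (K \<eta>)" .
    qed
  }
qed

lemma mus_sasaki_form_mus_sasaki: "mus_sasaki_form M g f c (x, y) (mus_sasaki M g f c (x, y))"
  by (simp add: mus_sasaki_def mus_sasaki_form_iff)

lemma mus_sasaki_eq:
  "mus_sasaki M g f c (x, y) \<xi> \<eta> = g c x (fst \<xi>) (fst \<eta>) + f (chart_inv M c x) *
     g c x (snd \<xi> + christoffel (g c) x (fst \<xi>) y) (snd \<eta> + christoffel (g c) x (fst \<eta>) y)"
  by (simp add: mus_sasaki_def mus_sasaki_form_iff)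

end

end

theory Submission
  imports Defs
begin

text \<open>
  Write \<open>F = grad f\<close> and let \<open>m\<close> be the dimension of the base. Where \<open>g\<close> is the Euclidean metric
  of a coordinate system, the Sasaki metric is Euclidean in the induced coordinates \<open>(x, y)\<close> and the
  Mus-Sasaki metric is \<open>dx\<^sup>2 + f(x) dy\<^sup>2\<close>, a warped product. Its connection gives the identity
  map the tension field \<open>- (m / 2) F\<^sup>H\<close>, which vanishes identically only if \<open>f\<close> is locally constant.
  In the bitension field the curvature contributes a multiple of \<open>\<nabla>\<^bsub>F\<^esub> F\<close> and one of
  \<open>|F|\<^sup>2 F / f\<close>, the vertical second derivatives of the tension contribute another multiple of
  \<open>|F|\<^sup>2 F / f\<close>, and the horizontal ones a multiple of
  \<open>Tr \<nabla>\<^sup>2 F\<close>. The terms in \<open>|F|\<^sup>2 F / f\<close> cancel and what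
  remains is \<open>(m / 2) (Tr \<nabla>\<^sup>2 F - (m / 2) \<nabla>\<^bsub>F\<^esub> F)\<^sup>H\<close>. Since the Hessian of \<open>f\<close> is symmetric,
  \<open>grad |F|\<^sup>2 = 2 \<nabla>\<^bsub>F\<^esub> F\<close>, and the equation of the theorem results.

  Flat coordinates come from integrating a differential system. The proof avoids this and carries the
  same computation out in an arbitrary chart. A tangent vector \<open>\<xi>\<close> of the tangent bundle at
  \<open>z = (x, y)\<close> is described by its horizontal part \<open>fst \<xi>\<close> and its vertical part
  \<open>K z \<xi> = snd \<xi> + \<Gamma>\<^bsub>x\<^esub>(fst \<xi>, y)\<close>. In these two components the covariant derivative of the
  Mus-Sasaki metric is the covariant derivative of the base, applied to each component, plus a tensor
  built from \<open>F\<close> (\<open>fst_cov_h\<close>, \<open>K_cov_h\<close>), exactly as in flat coordinates. Flatness enters as the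
  statement that covariant derivatives on the base commute, which is a pointwise identity between
  Christoffel symbols and their derivatives.

  The definition of a biharmonic map compares a chart \<open>c\<close> of the source with a chart \<open>d\<close> of the
  target, so the identity appears as the map \<open>(x, y) \<mapsto> (\<psi> x, D \<psi> x y)\<close> with a transition map
  \<open>\<psi>\<close> that is an isometry. The derivative of this map acts on both components through \<open>D \<psi>\<close>, and
  \<open>D \<psi>\<close> commutes with covariant derivatives, so that the computation is the same for all pairs of
  charts and its result is expressed in the chart \<open>d\<close>. The sums over the unspecified orthonormal
  frame are traces of bilinear maps and may be evaluated in a frame that is split into horizontal
  and vertical vectors (\<open>trace_product_components\<close>).
\<close>

section \<open>Calculus of smooth functions on open sets\<close>

lemma D_eqI: "(F has_derivative F') (at x) \<Longrightarrow> D F x = F'"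
  by (rule frechet_derivative_at[symmetric])

lemma differentiable_has_derivative_D: "F differentiable (at x) \<Longrightarrow> (F has_derivative D F x) (at x)"
  by (simp add: frechet_derivative_works)

lemma D_cong_open:
  assumes "open S" "x \<in> S" "\<And>y. y \<in> S \<Longrightarrow> F y = G y"
  shows "D F x = D G x"
proof -
  have "(F has_derivative F') (at x) \<longleftrightarrow> (G has_derivative F') (at x)" for F'
    using has_derivative_transform_within_open[OF _ assms(1,2)] assms(3) by metis
  then show ?thesis by (simp add: frechet_derivative_def)
qed

lemma differentiable_cong_open:
  assumes "open S" "x \<in> S" "\<And>y. y \<in> S \<Longrightarrow> F y = G y"
  shows "F differentiable (at x) \<longleftrightarrow> G differentiable (at x)"
  using has_derivative_transform_within_open[OF _ assms(1,2)] assms(3)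
  unfolding differentiable_def by metis

lemma linear_D: "F differentiable (at x) \<Longrightarrow> linear (D F x)"
  by (rule linear_frechet_derivative)

lemma Ck_on_cong:
  assumes "open S" "\<And>x. x \<in> S \<Longrightarrow> F x = G x"
  shows "Ck_on k F S \<longleftrightarrow> Ck_on k G S"
  using assms(2)
proof (induction k arbitrary: F G)
  case 0
  then show ?case by (simp cong: continuous_on_cong)
next
  case (Suc k)
  have "F differentiable (at x) \<longleftrightarrow> G differentiable (at x)" if "x \<in> S" for x
    using differentiable_cong_open[OF assms(1) that] Suc.prems by blast
  moreover have "Ck_on k (\<lambda>x. D F x v) S \<longleftrightarrow> Ck_on k (\<lambda>x. D G x v) S" for v
    by (rule Suc.IH) (metis D_cong_open[OF assms(1)] Suc.prems)
  ultimately show ?case by simp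
qed

lemma Ck_on_SucD: "Ck_on (Suc k) F S \<Longrightarrow> Ck_on k F S"
proof (induction k arbitrary: F)
  case 0
  then show ?case
    by (auto simp: continuous_on_eq_continuous_at
        intro!: continuous_at_imp_continuous_on differentiable_imp_continuous_within)
next
  case (Suc k)
  then show ?case by auto
qed

lemma Ck_on_subset: "Ck_on k F S \<Longrightarrow> T \<subseteq> S \<Longrightarrow> Ck_on k F T"
proof (induction k arbitrary: F)
  case 0
  then show ?case using continuous_on_subset by auto
next
  case (Suc k)
  then show ?case by auto
qed

lemma Ck_on_const: "Ck_on k (\<lambda>x. c) S"
  by (induction k arbitrary: c) (auto intro: continuous_on_const)

lemma Ck_on_bounded_linear:
  assumes "bounded_linear L" "Ck_on k F S" "open S"
  shows "Ck_on k (\<lambda>x. L (F x)) S"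
  using assms(2)
proof (induction k arbitrary: F)
  case 0
  then show ?case
    by (simp add: bounded_linear.continuous_on[OF assms(1)])
next
  case (Suc k)
  have d: "((\<lambda>x. L (F x)) has_derivative (\<lambda>v. L (D F x v))) (at x)" if "x \<in> S" for x
    using Suc.prems that
    by (auto intro!: bounded_linear.has_derivative[OF assms(1)] differentiable_has_derivative_D)
  have "Ck_on k (\<lambda>x. D (\<lambda>x. L (F x)) x v) S" for v
    by (subst Ck_on_cong[OF assms(3), where G = "\<lambda>x. L (D F x v)"])
      (use Suc D_eqI[OF d] in auto)
  then show ?case using d by (auto simp: differentiable_def)
qed

lemma Ck_on_add:
  assumes "Ck_on k F S" "Ck_on k G S" "open S"
  shows "Ck_on k (\<lambda>x. F x + G x) S"
  using assms(1,2)
proof (induction k arbitrary: F G)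
  case 0
  then show ?case by (auto intro: continuous_intros)
next
  case (Suc k)
  have d: "((\<lambda>x. F x + G x) has_derivative (\<lambda>v. D F x v + D G x v)) (at x)" if "x \<in> S" for x
    using Suc.prems that
    by (auto intro!: has_derivative_add differentiable_has_derivative_D)
  have "Ck_on k (\<lambda>x. D (\<lambda>x. F x + G x) x v) S" for v
    by (subst Ck_on_cong[OF assms(3), where G = "\<lambda>x. D F x v + D G x v"])
      (use Suc D_eqI[OF d] in auto)
  then show ?case using d by (auto simp: differentiable_def)
qed

lemma Ck_on_bounded_bilinear:
  assumes "bounded_bilinear B" "Ck_on k F S" "Ck_on k G S" "open S"
  shows "Ck_on k (\<lambda>x. B (F x) (G x)) S"
  using assms(2,3)
proof (induction k arbitrary: F G)
  case 0
  then show ?case by (auto intro: bounded_bilinear.continuous_on[OF assms(1)])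
next
  case (Suc k)
  have d: "((\<lambda>x. B (F x) (G x)) has_derivative (\<lambda>v. B (F x) (D G x v) + B (D F x v) (G x))) (at x)"
    if "x \<in> S" for x
    using Suc.prems that
    by (auto intro!: bounded_bilinear.FDERIV[OF assms(1)] differentiable_has_derivative_D)
  have "Ck_on k (\<lambda>x. D (\<lambda>x. B (F x) (G x)) x v) S" for v
    by (subst Ck_on_cong[OF assms(4), where G = "\<lambda>x. B (F x) (D G x v) + B (D F x v) (G x)"])
      (use Suc D_eqI[OF d] Suc.prems[THEN Ck_on_SucD] in \<open>auto intro!: Ck_on_add[OF _ _ assms(4)]\<close>)
  then show ?case using d by (auto simp: differentiable_def)
qed

lemma Ck_on_sum:
  assumes "\<And>i. i \<in> I \<Longrightarrow> Ck_on k (F i) S" "open S"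
  shows "Ck_on k (\<lambda>x. \<Sum>i\<in>I. F i x) S"
  using assms(1) by (induction I rule: infinite_finite_induct)
    (auto intro: Ck_on_const Ck_on_add[OF _ _ assms(2)])

lemma Ck_on_ident: "Ck_on k (\<lambda>x. x) S"
  by (cases k) (auto intro: Ck_on_const continuous_on_id)

lemma euclidean_sum: "linear L \<Longrightarrow> L (v::'a::euclidean_space) = (\<Sum>b\<in>Basis. (v \<bullet> b) *\<^sub>R L b)"
  by (metis (no_types, lifting) euclidean_representation linear_scale linear_sum sum.cong)

lemma Ck_on_compose:
  fixes G :: "'a::real_normed_vector \<Rightarrow> 'b::euclidean_space"
  assumes "Ck_on k F T" "Ck_on k G S" "open S" "open T" "\<And>x. x \<in> S \<Longrightarrow> G x \<in> T"
  shows "Ck_on k (\<lambda>x. F (G x)) S"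
  using assms(1,2)
proof (induction k arbitrary: F)
  case 0
  then show ?case using assms(5) by (auto intro: continuous_on_compose2)
next
  case (Suc k)
  have d: "((\<lambda>x. F (G x)) has_derivative (\<lambda>v. D F (G x) (D G x v))) (at x)" if "x \<in> S" for x
    using Suc.prems that assms(5)
    by (auto intro!: has_derivative_compose[of G _ _ _ F] differentiable_has_derivative_D)
  have "Ck_on k (\<lambda>x. D (\<lambda>x. F (G x)) x v) S" for v
  proof (subst Ck_on_cong[OF assms(3)])
    fix x assume "x \<in> S"
    then have "linear (D F (G x))" using Suc.prems assms(5) by (auto intro: linear_D)
    then show "D (\<lambda>x. F (G x)) x v = (\<Sum>b\<in>Basis. (D G x v \<bullet> b) *\<^sub>R D F (G x) b)"
      by (simp only: D_eqI[OF d[OF \<open>x \<in> S\<close>]] euclidean_sum[symmetric])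
  next
    show "Ck_on k (\<lambda>x. \<Sum>b\<in>Basis. (D G x v \<bullet> b) *\<^sub>R D F (G x) b) S"
      using Suc Suc.prems(2)[THEN Ck_on_SucD]
      by (intro Ck_on_sum Ck_on_bounded_bilinear[OF bounded_bilinear_scaleR] assms(3)
          Ck_on_bounded_linear[OF bounded_linear_inner_left]) auto
  qed
  then show ?case using d by (auto simp: differentiable_def)
qed

text \<open>The derivative of \<open>r = 1 / sqrt q\<close> is \<open>- r\<^sup>3 q' / 2\<close>, a product of functions that are
  one degree less smooth.\<close>
lemma Ck_on_inverse_sqrt:
  assumes "Ck_on k q S" "open S" "\<And>x. x \<in> S \<Longrightarrow> q x > 0"
  shows "Ck_on k (\<lambda>x. inverse (sqrt (q x))) S"
  using assms(1)
proof (induction k)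
  case 0
  then show ?case
    using assms(3) by (auto intro!: continuous_intros) fastforce
next
  case (Suc k)
  let ?r = "\<lambda>x. inverse (sqrt (q x))"
  let ?R = "\<lambda>x v. (- 1 / 2) * (?r x * (?r x * (?r x * D q x v)))"
  have d: "(?r has_derivative ?R x) (at x)" if "x \<in> S" for x
  proof -
    have [simp]: "q x > 0" "q x \<noteq> 0" using assms(3)[OF that] by auto
    have "(q has_derivative D q x) (at x)"
      using Suc.prems that by (auto intro: differentiable_has_derivative_D)
    then have "((\<lambda>x. sqrt (q x)) has_derivative (\<lambda>v. D q x v * (inverse (sqrt (q x)) / 2))) (at x)"
      by (auto intro!: derivative_eq_intros simp: divide_simps)
    from Deriv.has_derivative_inverse[OF _ this] show ?thesis
      by (auto elim!: has_derivative_eq_rhs simp: fun_eq_iff divide_simps)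
  qed
  have "Ck_on k (\<lambda>x. D ?r x v) S" for v
  proof (subst Ck_on_cong[OF assms(2)])
    show "D ?r x v = ?R x v" if "x \<in> S" for x using D_eqI[OF d[OF that]] by simp
    have "Ck_on k ?r S" "Ck_on k (\<lambda>x. D q x v) S"
      using Suc.IH Suc.prems Suc.prems[THEN Ck_on_SucD] by auto
    then show "Ck_on k (\<lambda>x. ?R x v) S"
      by (intro Ck_on_bounded_bilinear[OF bounded_bilinear_mult] Ck_on_const assms(2))
  qed
  then show ?case using d by (auto simp: differentiable_def)
qed

named_theorems smooth_intros

lemma smooth_on_cong:
  "open S \<Longrightarrow> (\<And>x. x \<in> S \<Longrightarrow> F x = G x) \<Longrightarrow> smooth_on S F \<longleftrightarrow> smooth_on S G"
  unfolding smooth_on_def using Ck_on_cong by metis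

lemma smooth_on_subset: "smooth_on S F \<Longrightarrow> T \<subseteq> S \<Longrightarrow> smooth_on T F"
  unfolding smooth_on_def using Ck_on_subset by metis

lemma smooth_on_const [smooth_intros]: "smooth_on S (\<lambda>x. c)"
  unfolding smooth_on_def using Ck_on_const by metis

lemma smooth_on_ident [smooth_intros]: "smooth_on S (\<lambda>x. x)"
  unfolding smooth_on_def using Ck_on_ident by metis

lemma smooth_on_bounded_linear:
  "bounded_linear L \<Longrightarrow> open S \<Longrightarrow> smooth_on S F \<Longrightarrow> smooth_on S (\<lambda>x. L (F x))"
  unfolding smooth_on_def using Ck_on_bounded_linear by metis

lemma smooth_on_add [smooth_intros]:
  "open S \<Longrightarrow> smooth_on S F \<Longrightarrow> smooth_on S G \<Longrightarrow> smooth_on S (\<lambda>x. F x + G x)"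
  unfolding smooth_on_def using Ck_on_add by metis

lemma smooth_on_sum [smooth_intros]:
  "open S \<Longrightarrow> (\<And>i. i \<in> I \<Longrightarrow> smooth_on S (F i)) \<Longrightarrow> smooth_on S (\<lambda>x. \<Sum>i\<in>I. F i x)"
  unfolding smooth_on_def using Ck_on_sum by metis

lemma smooth_on_bounded_bilinear:
  "bounded_bilinear B \<Longrightarrow> open S \<Longrightarrow> smooth_on S F \<Longrightarrow> smooth_on S G \<Longrightarrow> smooth_on S (\<lambda>x. B (F x) (G x))"
  unfolding smooth_on_def using Ck_on_bounded_bilinear by metis

lemmas smooth_on_scaleR [smooth_intros] = smooth_on_bounded_bilinear[OF bounded_bilinear_scaleR]
lemmas smooth_on_mult [smooth_intros] =
  smooth_on_bounded_bilinear[OF bounded_bilinear_mult[where 'a = real]]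
lemmas smooth_on_fst [smooth_intros] = smooth_on_bounded_linear[OF bounded_linear_fst]
lemmas smooth_on_snd [smooth_intros] = smooth_on_bounded_linear[OF bounded_linear_snd]
lemmas smooth_on_inner_left [smooth_intros] = smooth_on_bounded_linear[OF bounded_linear_inner_left]

lemma smooth_on_minus [smooth_intros]: "open S \<Longrightarrow> smooth_on S F \<Longrightarrow> smooth_on S (\<lambda>x. - F x)"
  using smooth_on_bounded_linear[OF bounded_linear_minus[OF bounded_linear_ident]] .

lemma smooth_on_diff [smooth_intros]:
  "open S \<Longrightarrow> smooth_on S F \<Longrightarrow> smooth_on S G \<Longrightarrow> smooth_on S (\<lambda>x. F x - G x)"
  using smooth_on_add[OF _ _ smooth_on_minus, of S F G] by simp

lemma smooth_on_Pair [smooth_intros]: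
  assumes "open S" "smooth_on S F" "smooth_on S G"
  shows "smooth_on S (\<lambda>x. (F x, G x))"
proof -
  have "bounded_linear (\<lambda>x. (x, 0::'c))" "bounded_linear (\<lambda>x. (0::'b, x))"
    by (intro bounded_linear_Pair bounded_linear_ident bounded_linear_zero)+
  from smooth_on_add[OF assms(1) smooth_on_bounded_linear[OF this(1) assms(1,2)]
      smooth_on_bounded_linear[OF this(2) assms(1,3)]]
  show ?thesis by simp
qed

lemma smooth_on_compose:
  fixes G :: "'a::real_normed_vector \<Rightarrow> 'b::euclidean_space"
  shows "open S \<Longrightarrow> open T \<Longrightarrow> smooth_on T F \<Longrightarrow> smooth_on S G \<Longrightarrow> (\<And>x. x \<in> S \<Longrightarrow> G x \<in> T)
    \<Longrightarrow> smooth_on S (\<lambda>x. F (G x))"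
  unfolding smooth_on_def using Ck_on_compose by metis

lemma smooth_on_inverse_sqrt:
  "open S \<Longrightarrow> smooth_on S q \<Longrightarrow> (\<And>x. x \<in> S \<Longrightarrow> q x > 0) \<Longrightarrow> smooth_on S (\<lambda>x. inverse (sqrt (q x)))"
  unfolding smooth_on_def using Ck_on_inverse_sqrt by metis

lemma smooth_on_inverse:
  assumes "open S" "smooth_on S q" "\<And>x. x \<in> S \<Longrightarrow> q x > (0::real)"
  shows "smooth_on S (\<lambda>x. inverse (q x))"
proof -
  have "inverse (q x) = inverse (sqrt (q x)) * inverse (sqrt (q x))" if "x \<in> S" for x
    using assms(3)[OF that] by (simp flip: inverse_mult_distrib)
  then show ?thesis
    by (subst smooth_on_cong[OF assms(1)], assumption)
      (rule smooth_on_mult[OF assms(1) smooth_on_inverse_sqrt[OF assms] smooth_on_inverse_sqrt[OF assms]])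
qed

lemma smooth_on_differentiable: "smooth_on S F \<Longrightarrow> x \<in> S \<Longrightarrow> F differentiable (at x)"
  unfolding smooth_on_def by (metis Ck_on.simps(2))

lemma smooth_on_has_derivative: "smooth_on S F \<Longrightarrow> x \<in> S \<Longrightarrow> (F has_derivative D F x) (at x)"
  using smooth_on_differentiable differentiable_has_derivative_D by blast

lemma smooth_on_D [smooth_intros]: "smooth_on S F \<Longrightarrow> smooth_on S (\<lambda>x. D F x v)"
  unfolding smooth_on_def by (metis Ck_on.simps(2))

lemma smooth_on_continuous: "smooth_on S F \<Longrightarrow> continuous_on S F"
  unfolding smooth_on_def by (metis Ck_on.simps(1))

text \<open>By the mean value theorem, applied twice, the second difference of \<open>F\<close> on a small
  parallelogram is \<open>h\<^sup>2\<close> times a value of either mixed derivative near \<open>x\<close>. If the mixed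
  derivatives differed at \<open>x\<close>, continuity would separate these two values.\<close>
lemma symmetric_second_derivative_real:
  fixes F :: "'a::real_normed_vector \<Rightarrow> real"
  assumes S: "open S" "x \<in> S" and F: "smooth_on S F"
  shows "D (\<lambda>y. D F y u) x v = D (\<lambda>y. D F y v) x u"
proof (rule ccontr)
  assume ne: "D (\<lambda>y. D F y u) x v \<noteq> D (\<lambda>y. D F y v) x u"
  define A where "A u v y = D (\<lambda>y. D F y u) y v" for u v y
  define e where "e = \<bar>A u v x - A v u x\<bar> / 2"
  have "e > 0" using ne by (simp add: e_def A_def)
  have cont: "continuous (at x) (A u v)" for u v
    using smooth_on_continuous[OF smooth_on_D[OF smooth_on_D[OF F]], of u v] S
      continuous_on_eq_continuous_at[OF S(1)]
    unfolding A_def by blast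
  obtain d1 where d1: "d1 > 0" "\<And>y. dist y x < d1 \<Longrightarrow> dist (A u v y) (A u v x) < e"
    using cont[of u v] \<open>e > 0\<close> unfolding continuous_at_eps_delta by metis
  obtain d2 where d2: "d2 > 0" "\<And>y. dist y x < d2 \<Longrightarrow> dist (A v u y) (A v u x) < e"
    using cont[of v u] \<open>e > 0\<close> unfolding continuous_at_eps_delta by metis
  obtain d3 where d3: "d3 > 0" "ball x d3 \<subseteq> S" using S openE by blast
  define d where "d = min d1 (min d2 d3)"
  have d: "d > 0" using d1 d2 d3 by (simp add: d_def)
  define h where "h = d / (2 * (norm u + norm v + 1))"
  have h0: "h > 0" using d by (simp add: h_def add_nonneg_pos)
  have small: "dist (x + s *\<^sub>R u + t *\<^sub>R v) x < d" if "0 \<le> s" "s \<le> h" "0 \<le> t" "t \<le> h" for s t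
  proof -
    have "dist (x + s *\<^sub>R u + t *\<^sub>R v) x \<le> s * norm u + t * norm v"
      using norm_triangle_ineq[of "s *\<^sub>R u" "t *\<^sub>R v"] that by (simp add: dist_norm add.assoc)
    also have "\<dots> \<le> h * norm u + h * norm v"
      using that by (intro add_mono mult_right_mono) auto
    also have "\<dots> \<le> h * (norm u + norm v + 1)" using h0 by (simp add: algebra_simps)
    also have "\<dots> = d / 2"
      using add_nonneg_pos[of "norm u + norm v" 1] by (simp add: h_def field_simps)
    also have "\<dots> < d" using d by simp
    finally show ?thesis .
  qed
  have mvt: "\<exists>s t. 0 \<le> s \<and> s \<le> h \<and> 0 \<le> t \<and> t \<le> h \<and>
      F (x + h *\<^sub>R u + h *\<^sub>R v) - F (x + h *\<^sub>R u) - F (x + h *\<^sub>R v) + F x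
        = h * h * A u v (x + s *\<^sub>R u + t *\<^sub>R v)"
    if small: "\<And>s t. 0 \<le> s \<Longrightarrow> s \<le> h \<Longrightarrow> 0 \<le> t \<Longrightarrow> t \<le> h \<Longrightarrow> x + s *\<^sub>R u + t *\<^sub>R v \<in> S" for u v
  proof -
    have der: "((\<lambda>s. F (x + s *\<^sub>R u + t *\<^sub>R v)) has_real_derivative D F (x + s *\<^sub>R u + t *\<^sub>R v) u) (at s)"
      if "0 \<le> s" "s \<le> h" "0 \<le> t" "t \<le> h" for s t
    proof -
      have "((\<lambda>s. x + s *\<^sub>R u + t *\<^sub>R v) has_derivative (\<lambda>r. r *\<^sub>R u)) (at s)"
        by (auto intro!: derivative_eq_intros)
      from has_derivative_compose[OF this smooth_on_has_derivative[OF F small[OF that]]]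
      have "((\<lambda>s. F (x + s *\<^sub>R u + t *\<^sub>R v)) has_derivative
          (\<lambda>r. D F (x + s *\<^sub>R u + t *\<^sub>R v) (r *\<^sub>R u))) (at s)" .
      then show ?thesis
        unfolding has_field_derivative_def
        by (rule has_derivative_eq_rhs)
          (simp add: fun_eq_iff mult.commute
            linear_scale[OF linear_D[OF smooth_on_differentiable[OF F small[OF that]]]])
    qed
    have der2: "((\<lambda>t. D F (x + s *\<^sub>R u + t *\<^sub>R v) u) has_real_derivative A u v (x + s *\<^sub>R u + t *\<^sub>R v)) (at t)"
      if "0 \<le> s" "s \<le> h" "0 \<le> t" "t \<le> h" for s t
    proof -
      note Fu = smooth_on_D[OF F, of u]
      have "((\<lambda>t. x + s *\<^sub>R u + t *\<^sub>R v) has_derivative (\<lambda>r. r *\<^sub>R v)) (at t)"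
        by (auto intro!: derivative_eq_intros)
      from has_derivative_compose[OF this smooth_on_has_derivative[OF Fu small[OF that]]]
      have "((\<lambda>t. D F (x + s *\<^sub>R u + t *\<^sub>R v) u) has_derivative
          (\<lambda>r. D (\<lambda>y. D F y u) (x + s *\<^sub>R u + t *\<^sub>R v) (r *\<^sub>R v))) (at t)" .
      then show ?thesis
        unfolding has_field_derivative_def
        by (rule has_derivative_eq_rhs)
          (simp add: fun_eq_iff mult.commute A_def
            linear_scale[OF linear_D[OF smooth_on_differentiable[OF Fu small[OF that]]]])
    qed
    have "\<exists>s. 0 < s \<and> s < h \<and> (F (x + h *\<^sub>R u + h *\<^sub>R v) - F (x + h *\<^sub>R u + 0 *\<^sub>R v))
        - (F (x + 0 *\<^sub>R u + h *\<^sub>R v) - F (x + 0 *\<^sub>R u + 0 *\<^sub>R v))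
        = (h - 0) * (D F (x + s *\<^sub>R u + h *\<^sub>R v) u - D F (x + s *\<^sub>R u + 0 *\<^sub>R v) u)"
      by (rule MVT2[OF h0], rule DERIV_diff; rule der) (use h0 in auto)
    then obtain s where s: "0 < s" "s < h"
      "F (x + h *\<^sub>R u + h *\<^sub>R v) - F (x + h *\<^sub>R u) - F (x + h *\<^sub>R v) + F x
        = h * (D F (x + s *\<^sub>R u + h *\<^sub>R v) u - D F (x + s *\<^sub>R u + 0 *\<^sub>R v) u)"
      by auto
    have "\<exists>t. 0 < t \<and> t < h \<and> D F (x + s *\<^sub>R u + h *\<^sub>R v) u - D F (x + s *\<^sub>R u + 0 *\<^sub>R v) u
        = (h - 0) * A u v (x + s *\<^sub>R u + t *\<^sub>R v)"
      by (rule MVT2[OF h0]) (use h0 s der2 in auto)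
    then obtain t where "0 < t" "t < h"
      "D F (x + s *\<^sub>R u + h *\<^sub>R v) u - D F (x + s *\<^sub>R u + 0 *\<^sub>R v) u = h * A u v (x + s *\<^sub>R u + t *\<^sub>R v)"
      by auto
    with s show ?thesis by (intro exI[of _ s] exI[of _ t]) auto
  qed
  have inS: "x + s *\<^sub>R u + t *\<^sub>R v \<in> S" if "0 \<le> s" "s \<le> h" "0 \<le> t" "t \<le> h" for s t
    using small[OF that] d3 by (auto simp: d_def dist_commute subset_iff)
  obtain s t where st: "0 \<le> s" "s \<le> h" "0 \<le> t" "t \<le> h"
    "F (x + h *\<^sub>R u + h *\<^sub>R v) - F (x + h *\<^sub>R u) - F (x + h *\<^sub>R v) + F x
        = h * h * A u v (x + s *\<^sub>R u + t *\<^sub>R v)"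
    using mvt[of u v, OF inS] by blast
  obtain s' t' where st': "0 \<le> s'" "s' \<le> h" "0 \<le> t'" "t' \<le> h"
    "F (x + h *\<^sub>R v + h *\<^sub>R u) - F (x + h *\<^sub>R v) - F (x + h *\<^sub>R u) + F x
        = h * h * A v u (x + s' *\<^sub>R v + t' *\<^sub>R u)"
    using mvt[of v u] inS by (metis add.commute add.left_commute)
  have "A u v (x + s *\<^sub>R u + t *\<^sub>R v) = A v u (x + s' *\<^sub>R v + t' *\<^sub>R u)"
  proof -
    have "h * h * A u v (x + s *\<^sub>R u + t *\<^sub>R v) = h * h * A v u (x + s' *\<^sub>R v + t' *\<^sub>R u)"
      using st(5) st'(5) by (simp add: algebra_simps)
    then show ?thesis using h0 by simp
  qed
  moreover have "dist (A u v (x + s *\<^sub>R u + t *\<^sub>R v)) (A u v x) < e"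
    by (rule d1) (use small[OF st(1-4)] in \<open>simp add: d_def\<close>)
  moreover have "dist (A v u (x + s' *\<^sub>R v + t' *\<^sub>R u)) (A v u x) < e"
    by (rule d2) (use small[OF st'(3,4,1,2)] in \<open>simp add: d_def add_ac\<close>)
  ultimately have "\<bar>A u v x - A v u x\<bar> < 2 * e"
    by (simp add: dist_real_def)
  then show False by (simp add: e_def)
qed

lemma symmetric_second_derivative:
  fixes F :: "'a::real_normed_vector \<Rightarrow> 'b::euclidean_space"
  assumes S: "open S" "x \<in> S" and F: "smooth_on S F"
  shows "D (\<lambda>y. D F y u) x v = D (\<lambda>y. D F y v) x u"
proof (rule euclidean_eqI)
  fix b :: 'b assume "b \<in> Basis"
  have Fb: "smooth_on S (\<lambda>y. F y \<bullet> b)" using S F by (intro smooth_intros)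
  have *: "D (\<lambda>y. G y \<bullet> b) y u = D G y u \<bullet> b" if "smooth_on S G" "y \<in> S" for y u and G :: "'a \<Rightarrow> 'b"
    by (subst D_eqI[OF has_derivative_inner_left[OF smooth_on_has_derivative[OF that]]]) simp
  have **: "D (\<lambda>y. D (\<lambda>y. F y \<bullet> b) y u) x v = D (\<lambda>y. D F y u) x v \<bullet> b" for u v
    by (subst D_cong_open[OF S, where G = "\<lambda>y. D F y u \<bullet> b"])
      (simp_all add: * F S smooth_on_D)
  show "D (\<lambda>y. D F y u) x v \<bullet> b = D (\<lambda>y. D F y v) x u \<bullet> b"
    using symmetric_second_derivative_real[OF S Fb, of u v] by (simp only: **)
qed

subsection \<open>Fields of linear and bilinear maps\<close>

text \<open>Metrics and Christoffel symbols are fields of bilinear maps whose smoothness is known for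
  constant arguments only. Expansion in the standard basis extends this to arguments that vary, and
  yields the product rule along a map \<open>p\<close> into the base.\<close>

lemma bilinear_sum_Basis:
  fixes B :: "'a::euclidean_space \<Rightarrow> 'b::euclidean_space \<Rightarrow> 'c::real_vector"
  assumes "bilinear B"
  shows "B u v = (\<Sum>i\<in>Basis. \<Sum>j\<in>Basis. ((u \<bullet> i) * (v \<bullet> j)) *\<^sub>R B i j)"
proof -
  have "linear (\<lambda>u. B u v)" and lin: "linear (B i)" for i using assms by (auto simp: bilinear_def)
  have "B u v = (\<Sum>i\<in>Basis. (u \<bullet> i) *\<^sub>R B i v)" by (rule euclidean_sum) fact
  also have "\<dots> = (\<Sum>i\<in>Basis. (u \<bullet> i) *\<^sub>R (\<Sum>j\<in>Basis. (v \<bullet> j) *\<^sub>R B i j))"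
    by (intro sum.cong refl arg_cong2[where f = scaleR] euclidean_sum lin)
  finally show ?thesis by (simp add: scaleR_sum_right)
qed

lemma smooth_on_bilinear_field:
  fixes B :: "'a::real_normed_vector \<Rightarrow> 'b::euclidean_space \<Rightarrow> 'c::euclidean_space \<Rightarrow> 'd::real_normed_vector"
  assumes "open S" "\<And>x. x \<in> S \<Longrightarrow> bilinear (B x)" "\<And>u v. smooth_on S (\<lambda>x. B x u v)"
    and "smooth_on S u" "smooth_on S v"
  shows "smooth_on S (\<lambda>x. B x (u x) (v x))"
proof (subst smooth_on_cong[OF assms(1)])
  show "B x (u x) (v x) = (\<Sum>i\<in>Basis. \<Sum>j\<in>Basis. ((u x \<bullet> i) * (v x \<bullet> j)) *\<^sub>R B x i j)"
    if "x \<in> S" for x by (rule bilinear_sum_Basis[OF assms(2)[OF that]])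
  show "smooth_on S (\<lambda>x. \<Sum>i\<in>Basis. \<Sum>j\<in>Basis. ((u x \<bullet> i) * (v x \<bullet> j)) *\<^sub>R B x i j)"
    using assms by (intro smooth_intros)
qed

lemma has_derivative_bilinear_field:
  fixes B :: "'a::real_normed_vector \<Rightarrow> 'b::euclidean_space \<Rightarrow> 'c::euclidean_space \<Rightarrow> 'd::real_normed_vector"
    and p :: "'z::real_normed_vector \<Rightarrow> 'a"
  assumes "open S" "p z \<in> S" and B: "\<And>x. x \<in> S \<Longrightarrow> bilinear (B x)"
    and dB: "\<And>u v. (\<lambda>x. B x u v) differentiable (at (p z))"
    and p: "(p has_derivative p') (at z)"
    and u: "(u has_derivative u') (at z)" and v: "(v has_derivative v') (at z)"
  shows "((\<lambda>z. B (p z) (u z) (v z)) has_derivative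
    (\<lambda>X. D (\<lambda>x. B x (u z) (v z)) (p z) (p' X) + B (p z) (u' X) (v z) + B (p z) (u z) (v' X))) (at z)"
proof -
  let ?S = "\<lambda>B u v. \<Sum>i\<in>Basis. \<Sum>j\<in>Basis. ((u \<bullet> i) * (v \<bullet> j)) *\<^sub>R B i j"
  have c: "isCont p z" using p has_derivative_continuous by blast
  have ev: "eventually (\<lambda>w. p w \<in> S) (at z)"
    using c assms(1,2) by (metis isCont_def topological_tendstoD)
  have cong: "((\<lambda>z. ?S (B (p z)) (u z) (v z)) has_derivative X) (at z) \<Longrightarrow>
      ((\<lambda>z. B (p z) (u z) (v z)) has_derivative X) (at z)" for X
    by (erule has_derivative_transform_eventually)
      (use eventually_mono[OF ev] bilinear_sum_Basis[OF B] assms(2) in auto)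
  have d: "((\<lambda>z. B (p z) i j) has_derivative (\<lambda>X. D (\<lambda>x. B x i j) (p z) (p' X))) (at z)" for i j
    by (rule has_derivative_compose[OF p differentiable_has_derivative_D[OF dB]])
  have e1: "D (\<lambda>x. B x (u z) (v z)) (p z) X = ?S (\<lambda>i j. D (\<lambda>x. B x i j) (p z) X) (u z) (v z)" for X
  proof -
    have "D (\<lambda>x. B x (u z) (v z)) (p z) = D (\<lambda>x. ?S (B x) (u z) (v z)) (p z)"
      by (rule D_cong_open[OF assms(1,2)]) (rule bilinear_sum_Basis[OF B])
    also have "\<dots> = (\<lambda>X. ?S (\<lambda>i j. D (\<lambda>x. B x i j) (p z) X) (u z) (v z))"
      by (intro D_eqI has_derivative_sum has_derivative_scaleR_right differentiable_has_derivative_D dB)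
    finally show ?thesis by simp
  qed
  have e2: "B (p z) (u' X) (v z) = ?S (B (p z)) (u' X) (v z)"
    and e3: "B (p z) (u z) (v' X) = ?S (B (p z)) (u z) (v' X)" for X
    by (rule bilinear_sum_Basis[OF B[OF assms(2)]])+
  show ?thesis
    unfolding e1 e2 e3
    by (rule cong, rule has_derivative_eq_rhs,
        (rule has_derivative_sum has_derivative_scaleR has_derivative_mult
          has_derivative_inner_left u v d)+)
      (simp add: fun_eq_iff sum.distrib[symmetric] scaleR_add_left add_ac)
qed

lemma D_bilinear_field:
  fixes B :: "'a::real_normed_vector \<Rightarrow> 'b::euclidean_space \<Rightarrow> 'c::euclidean_space \<Rightarrow> 'd::real_normed_vector"
    and p :: "'z::real_normed_vector \<Rightarrow> 'a"
  assumes "open S" "p z \<in> S" "\<And>x. x \<in> S \<Longrightarrow> bilinear (B x)" "\<And>u v. smooth_on S (\<lambda>x. B x u v)"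
    and "p differentiable (at z)" "u differentiable (at z)" "v differentiable (at z)"
  shows "D (\<lambda>z. B (p z) (u z) (v z)) z X =
    D (\<lambda>x. B x (u z) (v z)) (p z) (D p z X) + B (p z) (D u z X) (v z) + B (p z) (u z) (D v z X)"
  by (subst D_eqI[OF has_derivative_bilinear_field[OF assms(1-3)
     smooth_on_differentiable[OF assms(4) assms(2)] assms(5-7)[THEN differentiable_has_derivative_D]]])
    simp_all

lemma bilinear_D_field:
  fixes B :: "'a::real_normed_vector \<Rightarrow> 'b::real_vector \<Rightarrow> 'c::real_vector \<Rightarrow> 'd::real_normed_vector"
  assumes S: "open S" "x \<in> S" and B: "\<And>x. x \<in> S \<Longrightarrow> bilinear (B x)" "\<And>u v. smooth_on S (\<lambda>x. B x u v)"
  shows "bilinear (\<lambda>u v. D (\<lambda>y. B y u v) x w)"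
proof -
  note d = smooth_on_has_derivative[OF B(2) S(2)]
  have "D (\<lambda>y. B y (u + u') v) x = (\<lambda>w. D (\<lambda>y. B y u v) x w + D (\<lambda>y. B y u' v) x w)" for u u' v
    by (rule trans[OF D_cong_open[OF S, where G = "\<lambda>y. B y u v + B y u' v"] D_eqI])
      (auto intro!: has_derivative_add d simp: bilinear_ladd[OF B(1)])
  moreover have "D (\<lambda>y. B y (r *\<^sub>R u) v) x = (\<lambda>w. r *\<^sub>R D (\<lambda>y. B y u v) x w)" for r u v
    by (rule trans[OF D_cong_open[OF S, where G = "\<lambda>y. r *\<^sub>R B y u v"] D_eqI])
      (auto intro!: has_derivative_scaleR_right d simp: bilinear_lmul[OF B(1)])
  moreover have "D (\<lambda>y. B y u (v + v')) x = (\<lambda>w. D (\<lambda>y. B y u v) x w + D (\<lambda>y. B y u v') x w)" for u v v'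
    by (rule trans[OF D_cong_open[OF S, where G = "\<lambda>y. B y u v + B y u v'"] D_eqI])
      (auto intro!: has_derivative_add d simp: bilinear_radd[OF B(1)])
  moreover have "D (\<lambda>y. B y u (r *\<^sub>R v)) x = (\<lambda>w. r *\<^sub>R D (\<lambda>y. B y u v) x w)" for r u v
    by (rule trans[OF D_cong_open[OF S, where G = "\<lambda>y. r *\<^sub>R B y u v"] D_eqI])
      (auto intro!: has_derivative_scaleR_right d simp: bilinear_rmul[OF B(1)])
  ultimately show ?thesis unfolding bilinear_def by (auto intro!: linearI)
qed

lemma smooth_on_linear_field:
  fixes L :: "'a::euclidean_space \<Rightarrow> 'b::euclidean_space \<Rightarrow> 'c::real_normed_vector"
    and p :: "'z::real_normed_vector \<Rightarrow> 'a"
  assumes "open T" "open S" and L: "\<And>x. x \<in> S \<Longrightarrow> linear (L x)" "\<And>u. smooth_on S (\<lambda>x. L x u)"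
    and p: "smooth_on T p" "\<And>z. z \<in> T \<Longrightarrow> p z \<in> S" and u: "smooth_on T u"
  shows "smooth_on T (\<lambda>z. L (p z) (u z))"
proof (subst smooth_on_cong[OF assms(1)])
  show "L (p z) (u z) = (\<Sum>b\<in>Basis. (u z \<bullet> b) *\<^sub>R L (p z) b)" if "z \<in> T" for z
    by (rule euclidean_sum[OF L(1)[OF p(2)[OF that]]])
  show "smooth_on T (\<lambda>z. \<Sum>b\<in>Basis. (u z \<bullet> b) *\<^sub>R L (p z) b)"
    by (intro smooth_intros assms smooth_on_compose[OF assms(1,2) L(2) p])
qed

lemma smooth_on_D_field:
  fixes u :: "'a::euclidean_space \<Rightarrow> 'a"
  assumes "open T" "smooth_on T s" "smooth_on T u"
  shows "smooth_on T (\<lambda>z. D s z (u z))"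
  by (rule smooth_on_linear_field[OF assms(1,1) linear_D[OF smooth_on_differentiable[OF assms(2)]]
        smooth_on_D[OF assms(2)] smooth_on_ident _ assms(3)])

lemma D_linear_field:
  fixes L :: "'a::real_normed_vector \<Rightarrow> 'b::euclidean_space \<Rightarrow> 'c::real_normed_vector"
  assumes "open S" "p z \<in> S" "\<And>x. x \<in> S \<Longrightarrow> linear (L x)" "\<And>u. smooth_on S (\<lambda>x. L x u)"
    and "p differentiable (at z)" "u differentiable (at z)"
  shows "D (\<lambda>z. L (p z) (u z)) z X = D (\<lambda>x. L x (u z)) (p z) (D p z X) + L (p z) (D u z X)"
proof -
  have "bilinear (\<lambda>u (r::real). r *\<^sub>R L x u)" if "x \<in> S" for x
    unfolding bilinear_def using assms(3)[OF that]
    by (auto intro!: linearI simp: linear_add linear_scale scaleR_add_right scaleR_add_left mult.commute)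
  then have "D (\<lambda>z. (1::real) *\<^sub>R L (p z) (u z)) z X =
      D (\<lambda>x. (1::real) *\<^sub>R L x (u z)) (p z) (D p z X) + 1 *\<^sub>R L (p z) (D u z X)
      + D (\<lambda>_. 1::real) z X *\<^sub>R L (p z) (u z)"
    using assms by (intro D_bilinear_field[where v = "\<lambda>_. 1::real" and S = S] smooth_intros) auto
  then show ?thesis by simp
qed

lemma D_bounded_linear:
  assumes "bounded_linear L" "s differentiable (at z)"
  shows "D (\<lambda>z. L (s z)) z X = L (D s z X)"
  by (subst D_eqI[OF bounded_linear.has_derivative[OF assms(1) differentiable_has_derivative_D[OF assms(2)]]]) simp

lemma D_compose:
  assumes "p differentiable (at z)" "F differentiable (at (p z))"
  shows "D (\<lambda>z. F (p z)) z X = D F (p z) (D p z X)"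
  by (subst D_eqI[OF has_derivative_compose[OF assms[THEN differentiable_has_derivative_D]]]) simp

lemma D_add:
  "F differentiable (at z) \<Longrightarrow> G differentiable (at z) \<Longrightarrow> D (\<lambda>z. F z + G z) z X = D F z X + D G z X"
  by (subst D_eqI[OF has_derivative_add[OF differentiable_has_derivative_D differentiable_has_derivative_D]]) auto

lemma D_scaleR:
  "r differentiable (at z) \<Longrightarrow> F differentiable (at z) \<Longrightarrow>
    D (\<lambda>z. r z *\<^sub>R F z) z X = D r z X *\<^sub>R F z + r z *\<^sub>R D F z X"
  by (subst D_eqI[OF has_derivative_scaleR[OF differentiable_has_derivative_D differentiable_has_derivative_D]])
    auto

lemma D_fst: "D fst z X = fst X"
  by (subst D_eqI[OF bounded_linear_imp_has_derivative[OF bounded_linear_fst]]) simp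

lemma D_snd: "D snd z X = snd X"
  by (subst D_eqI[OF bounded_linear_imp_has_derivative[OF bounded_linear_snd]]) simp

lemma smooth_on_fst_map: "open T \<Longrightarrow> smooth_on T fst"
  by (rule smooth_on_fst[OF _ smooth_on_ident])

lemma smooth_on_snd_map: "open T \<Longrightarrow> smooth_on T snd"
  by (rule smooth_on_snd[OF _ smooth_on_ident])

section \<open>Traces over orthonormal bases\<close>

definition orthonormal_wrt :: "('e::euclidean_space \<Rightarrow> 'e \<Rightarrow> real) \<Rightarrow> (nat \<Rightarrow> 'e) \<Rightarrow> bool" where
  "orthonormal_wrt B e \<longleftrightarrow> (\<forall>i<DIM('e). \<forall>j<DIM('e). B (e i) (e j) = (if i = j then 1 else 0))"

text \<open>An orthonormal family of full length is independent, hence spans, and pairing with \<open>e i\<close>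
  identifies the coefficients.\<close>
lemma orthonormal_expansion:
  fixes B :: "'e::euclidean_space \<Rightarrow> 'e \<Rightarrow> real"
  assumes B: "bilinear B" and e: "orthonormal_wrt B e"
  shows "W = (\<Sum>i<DIM('e). B W (e i) *\<^sub>R e i)"
proof -
  let ?n = "DIM('e)"
  have lin: "linear (\<lambda>W. B W Z)" for Z using B by (simp add: bilinear_def)
  have coeff: "B (\<Sum>i<?n. u i *\<^sub>R e i) (e j) = u j" if "j < ?n" for u j
  proof -
    have "B (\<Sum>i<?n. u i *\<^sub>R e i) (e j) = (\<Sum>i<?n. u i * B (e i) (e j))"
      by (simp add: linear_sum[OF lin] linear_scale[OF lin])
    also have "\<dots> = (\<Sum>i<?n. u i * (if i = j then 1 else 0))"
      using e that by (intro sum.cong) (auto simp: orthonormal_wrt_def)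
    also have "\<dots> = (\<Sum>i<?n. if i = j then u i else 0)" by (intro sum.cong) auto
    also have "\<dots> = u j" using that by simp
    finally show ?thesis .
  qed
  have inj: "inj_on e {..<?n}"
  proof (rule inj_onI, rule ccontr)
    fix i j assume ij: "i \<in> {..<?n}" "j \<in> {..<?n}" "e i = e j" "i \<noteq> j"
    then have "B (e i) (e j) = 0" "B (e i) (e i) = 1"
      using e unfolding orthonormal_wrt_def by (metis lessThan_iff)+
    with ij(3) show False by simp
  qed
  have "independent (e ` {..<?n})"
  proof (rule independent_if_scalars_zero)
    fix u x assume u: "(\<Sum>x\<in>e ` {..<?n}. u x *\<^sub>R x) = 0" and x: "x \<in> e ` {..<?n}"
    then obtain j where j: "j < ?n" "x = e j" by auto
    have "(\<Sum>i<?n. u (e i) *\<^sub>R e i) = 0" using u by (simp add: sum.reindex[OF inj])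
    then show "u x = 0" using coeff[OF j(1), of "\<lambda>i. u (e i)"] j linear_0[OF lin] by simp
  qed simp
  then have "UNIV \<subseteq> span (e ` {..<?n})"
    by (intro card_ge_dim_independent) (auto simp: card_image[OF inj])
  then have "W \<in> span (e ` {..<?n})" by auto
  then obtain u where "W = (\<Sum>x\<in>e ` {..<?n}. u x *\<^sub>R x)"
    by (auto simp: span_finite)
  then have W: "W = (\<Sum>i<?n. u (e i) *\<^sub>R e i)" by (simp add: sum.reindex[OF inj])
  have "B W (e i) = u (e i)" if "i < ?n" for i
    unfolding W using coeff[OF that, of "\<lambda>i. u (e i)"] .
  then show ?thesis using W by simp
qed

text \<open>Expanding \<open>e\<close> in \<open>e'\<close> produces the Gram matrix of \<open>e'\<close> computed in the basis \<open>e\<close>, which is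
  the identity matrix.\<close>
lemma trace_orthonormal:
  fixes B :: "'e::euclidean_space \<Rightarrow> 'e \<Rightarrow> real" and Q :: "'e \<Rightarrow> 'e \<Rightarrow> 'c::real_vector"
  assumes B: "bilinear B" "\<And>X Y. B X Y = B Y X" and Q: "bilinear Q"
    and e: "orthonormal_wrt B e" and e': "orthonormal_wrt B e'"
  shows "(\<Sum>i<DIM('e). Q (e i) (e i)) = (\<Sum>i<DIM('e). Q (e' i) (e' i))"
proof -
  let ?n = "DIM('e)"
  have lin: "linear (\<lambda>W. B W Z)" "linear (\<lambda>W. Q W Z)" "linear (Q Z)" for Z
    using B(1) Q by (auto simp: bilinear_def)
  have Qe: "Q (e i) (e i) = (\<Sum>j<?n. \<Sum>k<?n. (B (e i) (e' j) * B (e i) (e' k)) *\<^sub>R Q (e' j) (e' k))" for i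
  proof -
    have "Q (e i) (e i) = Q (\<Sum>j<?n. B (e i) (e' j) *\<^sub>R e' j) (\<Sum>k<?n. B (e i) (e' k) *\<^sub>R e' k)"
      using orthonormal_expansion[OF B(1) e', of "e i"] by simp
    also have "\<dots> = (\<Sum>j<?n. \<Sum>k<?n. (B (e i) (e' j) * B (e i) (e' k)) *\<^sub>R Q (e' j) (e' k))"
      by (simp add: linear_sum[OF lin(2)] linear_sum[OF lin(3)] linear_scale[OF lin(2)]
          linear_scale[OF lin(3)] scaleR_sum_right) (subst sum.swap, simp add: mult.commute)
    finally show ?thesis .
  qed
  have delta: "(\<Sum>i<?n. B (e i) (e' j) * B (e i) (e' k)) = (if j = k then 1 else 0)"
    if "j < ?n" "k < ?n" for j k
  proof -
    have "B (e' j) (e' k) = B (\<Sum>i<?n. B (e' j) (e i) *\<^sub>R e i) (e' k)"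
      using orthonormal_expansion[OF B(1) e, of "e' j"] by simp
    also have "\<dots> = (\<Sum>i<?n. B (e i) (e' j) * B (e i) (e' k))"
      by (simp add: linear_sum[OF lin(1)] linear_scale[OF lin(1)] B(2)[of "e' j"])
    finally show ?thesis using e' that by (simp add: orthonormal_wrt_def)
  qed
  have "(\<Sum>i<?n. Q (e i) (e i)) =
      (\<Sum>j<?n. \<Sum>k<?n. (\<Sum>i<?n. B (e i) (e' j) * B (e i) (e' k)) *\<^sub>R Q (e' j) (e' k))"
    unfolding Qe scaleR_sum_left
    by (subst sum.swap, rule sum.cong, rule refl, rule sum.swap)
  also have "\<dots> = (\<Sum>j<?n. \<Sum>k<?n. (if j = k then 1 else 0) *\<^sub>R Q (e' j) (e' k))"
    by (intro sum.cong refl arg_cong2[where f = scaleR] delta) auto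
  also have "\<dots> = (\<Sum>j<?n. \<Sum>k<?n. if j = k then Q (e' j) (e' k) else 0)"
    by (intro sum.cong refl) auto
  also have "\<dots> = (\<Sum>j<?n. Q (e' j) (e' j))" by simp
  finally show ?thesis .
qed

text \<open>The frame on the right consists of vectors in one of the two factors, like a frame of
  horizontal and vertical lifts.\<close>
lemma trace_orthonormal_product:
  fixes B :: "'e::euclidean_space \<Rightarrow> 'e \<Rightarrow> real" and Q :: "'e \<times> 'e \<Rightarrow> 'e \<times> 'e \<Rightarrow> 'c::real_vector"
  assumes B: "bilinear B" "\<And>X Y. B X Y = B Y X" and Q: "bilinear Q" and e: "orthonormal_wrt B e"
    and ab: "orthonormal_wrt (\<lambda>\<xi> \<eta>. B (fst \<xi>) (fst \<eta>) + B (snd \<xi>) (snd \<eta>)) ab"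
  shows "(\<Sum>i<DIM('e \<times> 'e). Q (ab i) (ab i)) =
    (\<Sum>i<DIM('e). Q (e i, 0) (e i, 0)) + (\<Sum>i<DIM('e). Q (0, e i) (0, e i))"
proof -
  let ?n = "DIM('e)"
  let ?B = "\<lambda>\<xi> \<eta>. B (fst \<xi>) (fst \<eta>) + B (snd \<xi>) (snd \<eta>)"
  define e2 where "e2 i = (if i < ?n then (e i, 0) else (0, e (i - ?n)))" for i
  note bil = bilinear_lzero[OF B(1)] bilinear_rzero[OF B(1)] bilinear_ladd[OF B(1)] bilinear_radd[OF B(1)]
    bilinear_lmul[OF B(1)] bilinear_rmul[OF B(1)]
  have split: "{..<DIM('e \<times> 'e)} = {..<?n} \<union> (\<lambda>i. i + ?n) ` {..<?n}"
  proof (intro equalityI subsetI)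
    fix i assume "i \<in> {..<DIM('e \<times> 'e)}"
    then show "i \<in> {..<?n} \<union> (\<lambda>i. i + ?n) ` {..<?n}"
      by (cases "i < ?n") (auto intro!: image_eqI[of _ _ "i - ?n"])
  qed auto
  have "bilinear ?B"
    unfolding bilinear_def by (auto intro!: linearI simp: bil algebra_simps)
  moreover have "orthonormal_wrt ?B e2"
    using e unfolding orthonormal_wrt_def e2_def by (auto simp: bil)
  ultimately have "(\<Sum>i<DIM('e \<times> 'e). Q (ab i) (ab i)) = (\<Sum>i<DIM('e \<times> 'e). Q (e2 i) (e2 i))"
    by (intro trace_orthonormal[where B = ?B] Q ab) (simp_all add: B(2))
  also have "(\<Sum>i<DIM('e \<times> 'e). Q (e2 i) (e2 i)) = (\<Sum>i<?n. Q (e2 i) (e2 i)) + (\<Sum>i\<in>(\<lambda>i. i + ?n) ` {..<?n}. Q (e2 i) (e2 i))"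
    unfolding split by (rule sum.union_disjoint) auto
  also have "(\<Sum>i\<in>(\<lambda>i. i + ?n) ` {..<?n}. Q (e2 i) (e2 i)) = (\<Sum>i<?n. Q (0, e i) (0, e i))"
    by (subst sum.reindex) (auto simp: e2_def inj_on_def)
  also have "(\<Sum>i<?n. Q (e2 i) (e2 i)) = (\<Sum>i<?n. Q (e i, 0) (e i, 0))"
    by (intro sum.cong) (auto simp: e2_def)
  finally show ?thesis .
qed

lemma bilinear_comp_linear:
  "bilinear Q \<Longrightarrow> linear L \<Longrightarrow> linear L' \<Longrightarrow> bilinear (\<lambda>u v. Q (L u) (L' v))"
  unfolding bilinear_def
  using linear_compose[of L] linear_compose[of L'] by (auto simp: o_def)

lemma trace_product_components:
  fixes B :: "'e::euclidean_space \<Rightarrow> 'e \<Rightarrow> real" and Q :: "'e \<Rightarrow> 'e \<Rightarrow> 'c::real_vector"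
  assumes B: "bilinear B" "\<And>X Y. B X Y = B Y X" and Q: "bilinear Q" and e: "orthonormal_wrt B e"
    and ab: "orthonormal_wrt (\<lambda>\<xi> \<eta>. B (fst \<xi>) (fst \<eta>) + B (snd \<xi>) (snd \<eta>)) ab"
  shows "(\<Sum>i<DIM('e \<times> 'e). Q (fst (ab i)) (fst (ab i))) = (\<Sum>i<DIM('e). Q (e i) (e i))"
    and "(\<Sum>i<DIM('e \<times> 'e). Q (snd (ab i)) (snd (ab i))) = (\<Sum>i<DIM('e). Q (e i) (e i))"
    and "(\<Sum>i<DIM('e \<times> 'e). Q (fst (ab i)) (snd (ab i))) = 0"
  using trace_orthonormal_product[OF B bilinear_comp_linear[OF Q linear_fst linear_fst] e ab]
    trace_orthonormal_product[OF B bilinear_comp_linear[OF Q linear_snd linear_snd] e ab]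
    trace_orthonormal_product[OF B bilinear_comp_linear[OF Q linear_fst linear_snd] e ab]
  by (simp_all add: bilinear_lzero[OF Q] bilinear_rzero[OF Q])

section \<open>Riemannian metrics on open sets\<close>

lemma nondegenerateD:
  fixes B :: "'e::real_vector \<Rightarrow> 'e \<Rightarrow> real"
  assumes "bilinear B" "\<And>X. X \<noteq> 0 \<Longrightarrow> B X X > 0" "\<And>Z. B W Z = B W' Z"
  shows "W = W'"
proof -
  have "B (W - W') (W - W') = 0" using assms(3) by (simp add: bilinear_lsub[OF assms(1)])
  then show ?thesis using assms(2)[of "W - W'"] by force
qed

text \<open>Koszul's argument: inserting compatibility three times into the defining formula, all terms
  but one cancel by symmetry. This is how Christoffel symbols are computed below: a candidate is
  guessed and only symmetry and compatibility are checked.\<close>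
lemma christoffel_eqI:
  fixes h :: "'e::euclidean_space metric_field"
  assumes h: "bilinear (h x)" "\<And>X Y. h x X Y = h x Y X" "\<And>X. X \<noteq> 0 \<Longrightarrow> h x X X > 0"
    and C: "\<And>X Y. C X Y = C Y X"
    and compat: "\<And>X Y Z. D (\<lambda>z. h z X Y) x Z = h x (C Z X) Y + h x X (C Z Y)"
  shows "christoffel h x X Y = C X Y"
  unfolding christoffel_def
proof (rule the_equality)
  show lower: "\<forall>Z. h x (C X Y) Z =
      (D (\<lambda>z. h z Y Z) x X + D (\<lambda>z. h z X Z) x Y - D (\<lambda>z. h z X Y) x Z) / 2"
  proof
    fix Z
    have "C Y X = C X Y" "C Z X = C X Z" "C Z Y = C Y Z" "h x Y (C X Z) = h x (C X Z) Y"
      by (rule C h(2))+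
    then show "h x (C X Y) Z =
      (D (\<lambda>z. h z Y Z) x X + D (\<lambda>z. h z X Z) x Y - D (\<lambda>z. h z X Y) x Z) / 2"
      unfolding compat by simp
  qed
  fix W assume "\<forall>Z. h x W Z =
      (D (\<lambda>z. h z Y Z) x X + D (\<lambda>z. h z X Z) x Y - D (\<lambda>z. h z X Y) x Z) / 2"
  with lower have "h x W Z = h x (C X Y) Z" for Z by metis
  then show "W = C X Y" by (intro nondegenerateD[OF h(1,3)])
qed

locale riemannian_domain =
  fixes S :: "'e::euclidean_space set" and g :: "'e metric_field"
  assumes open_S: "open S"
    and bilinear_g: "x \<in> S \<Longrightarrow> bilinear (g x)"
    and g_sym: "x \<in> S \<Longrightarrow> g x X Y = g x Y X"
    and g_pos: "x \<in> S \<Longrightarrow> X \<noteq> 0 \<Longrightarrow> g x X X > 0"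
    and smooth_g: "smooth_on S (\<lambda>x. g x X Y)"
begin

lemmas g_ladd = bilinear_ladd[OF bilinear_g] and g_radd = bilinear_radd[OF bilinear_g]
  and g_lmul = bilinear_lmul[OF bilinear_g] and g_rmul = bilinear_rmul[OF bilinear_g]
  and g_lsub = bilinear_lsub[OF bilinear_g] and g_rsub = bilinear_rsub[OF bilinear_g]
  and g_lneg = bilinear_lneg[OF bilinear_g] and g_rneg = bilinear_rneg[OF bilinear_g]
  and g_lzero = bilinear_lzero[OF bilinear_g] and g_rzero = bilinear_rzero[OF bilinear_g]

lemmas g_bilinear_simps = g_ladd g_radd g_lmul g_rmul g_lsub g_rsub g_lneg g_rneg g_lzero g_rzero

lemma g_eqI: "x \<in> S \<Longrightarrow> (\<And>Z. g x W Z = g x W' Z) \<Longrightarrow> W = W'"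
  using nondegenerateD[OF bilinear_g g_pos] by blast

lemma smooth_g_fields: "smooth_on S u \<Longrightarrow> smooth_on S v \<Longrightarrow> smooth_on S (\<lambda>x. g x (u x) (v x))"
  by (rule smooth_on_bilinear_field[OF open_S bilinear_g smooth_g])

text \<open>The Gram-Schmidt process, performed at all points of the domain at once. The span condition
  ensures that the vector to be normalised never vanishes.\<close>
lemma gram_schmidt_frame:
  assumes "n \<le> DIM('e)" and \<beta>: "bij_betw \<beta> {..<DIM('e)} (Basis :: 'e set)"
  shows "\<exists>E. (\<forall>i<n. smooth_on S (E i)) \<and>
    (\<forall>x\<in>S. (\<forall>i<n. E i x \<in> span (\<beta> ` {..i})) \<and>
      (\<forall>i<n. \<forall>j<n. g x (E i x) (E j x) = (if i = j then 1 else 0)))"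
  using assms(1)
proof (induction n)
  case 0
  then show ?case by simp
next
  case (Suc n)
  then obtain E where smE: "\<And>i. i < n \<Longrightarrow> smooth_on S (E i)"
    and spE: "\<And>x i. x \<in> S \<Longrightarrow> i < n \<Longrightarrow> E i x \<in> span (\<beta> ` {..i})"
    and onE: "\<And>x i j. x \<in> S \<Longrightarrow> i < n \<Longrightarrow> j < n \<Longrightarrow> g x (E i x) (E j x) = (if i = j then 1 else 0)"
    by fastforce
  define w where "w x = \<beta> n - (\<Sum>j<n. g x (\<beta> n) (E j x) *\<^sub>R E j x)" for x
  define q where "q x = g x (w x) (w x)" for x
  define En where "En x = inverse (sqrt (q x)) *\<^sub>R w x" for x
  have smw: "smooth_on S w"
    unfolding w_def using smE open_S by (intro smooth_intros smooth_g_fields) auto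
  have spw: "w x \<in> span (\<beta> ` {..n})" if "x \<in> S" for x
    unfolding w_def
  proof (intro span_diff span_sum span_scale)
    fix j assume "j \<in> {..<n}"
    then show "E j x \<in> span (\<beta> ` {..n})"
      using spE[OF that] span_mono[of "\<beta> ` {..j}" "\<beta> ` {..n}"] by fastforce
  qed (auto intro: span_base)
  have w0: "w x \<noteq> 0" if "x \<in> S" for x
  proof
    assume "w x = 0"
    then have "\<beta> n = (\<Sum>j<n. g x (\<beta> n) (E j x) *\<^sub>R E j x)" by (simp add: w_def)
    also have "\<dots> \<in> span (\<beta> ` {..<n})"
    proof (intro span_sum span_scale)
      fix j assume "j \<in> {..<n}"
      then show "E j x \<in> span (\<beta> ` {..<n})"
        using spE[OF that] span_mono[of "\<beta> ` {..j}" "\<beta> ` {..<n}"] by fastforce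
    qed
    finally have "\<beta> n \<in> span (\<beta> ` {..<n})" .
    moreover have "\<beta> ` {..<n} \<subseteq> Basis - {\<beta> n}"
    proof (intro subsetI DiffI)
      fix y assume "y \<in> \<beta> ` {..<n}"
      then obtain i where i: "i < n" "y = \<beta> i" by auto
      then show "y \<in> Basis" using \<beta> Suc.prems by (auto simp: bij_betw_def)
      show "y \<notin> {\<beta> n}"
        using inj_onD[OF bij_betw_imp_inj_on[OF \<beta>], of i n] i Suc.prems by auto
    qed
    ultimately have "\<beta> n \<in> span (Basis - {\<beta> n})" using span_mono by blast
    moreover have "\<beta> n \<in> Basis" using \<beta> Suc.prems by (auto simp: bij_betw_def)
    ultimately show False using independent_Basis by (auto simp: dependent_def)
  qed
  have q0: "q x > 0" if "x \<in> S" for x using w0[OF that] g_pos[OF that] by (simp add: q_def)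
  have "smooth_on S En"
    unfolding En_def using smw q0 open_S
    by (auto intro!: smooth_intros smooth_on_inverse_sqrt smooth_g_fields simp: q_def)
  moreover have "En x \<in> span (\<beta> ` {..n})" if "x \<in> S" for x
    unfolding En_def by (intro span_scale spw that)
  moreover have "g x (En x) (En x) = 1" if "x \<in> S" for x
  proof -
    have "g x (En x) (En x) = inverse (sqrt (q x) * sqrt (q x)) * q x"
      by (simp add: En_def g_bilinear_simps[OF that] del: real_sqrt_mult_self flip: q_def)
    also have "sqrt (q x) * sqrt (q x) = q x" using q0[OF that] by simp
    finally show ?thesis using q0[OF that] by simp
  qed
  moreover have "g x (En x) (E j x) = 0" "g x (E j x) (En x) = 0" if "x \<in> S" "j < n" for x j
  proof -
    have "g x (\<Sum>k<n. g x (\<beta> n) (E k x) *\<^sub>R E k x) (E j x) = (\<Sum>k<n. g x (\<beta> n) (E k x) * g x (E k x) (E j x))"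
    proof -
      have "linear (\<lambda>W. g x W (E j x))" using bilinear_g[OF that(1)] by (simp add: bilinear_def)
      note lin = this
      show ?thesis by (simp add: linear_sum[OF lin] linear_scale[OF lin])
    qed
    also have "\<dots> = (\<Sum>k<n. g x (\<beta> n) (E k x) * (if k = j then 1 else 0))"
      using that by (intro sum.cong) (auto simp: onE)
    also have "\<dots> = (\<Sum>k<n. if k = j then g x (\<beta> n) (E k x) else 0)" by (intro sum.cong) auto
    also have "\<dots> = g x (\<beta> n) (E j x)" using that by simp
    finally have "g x (w x) (E j x) = 0" by (simp add: w_def g_bilinear_simps[OF that(1)])
    then show "g x (En x) (E j x) = 0" by (simp add: En_def g_bilinear_simps[OF that(1)])
    then show "g x (E j x) (En x) = 0" using g_sym[OF that(1)] by simp
  qed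
  ultimately show ?case
    using smE spE onE by (intro exI[of _ "E(n := En)"]) (auto simp: less_Suc_eq)
qed

lemma orthonormal_frame_exists: "\<exists>E. orthonormal_frame g S E"
proof -
  obtain \<beta> :: "nat \<Rightarrow> 'e" where "bij_betw \<beta> {0..<DIM('e)} Basis"
    using ex_bij_betw_nat_finite[OF finite_Basis] by blast
  then have "bij_betw \<beta> {..<DIM('e)} Basis" by (simp add: atLeast0LessThan)
  from gram_schmidt_frame[OF order_refl this] open_S show ?thesis
    unfolding orthonormal_frame_def by blast
qed

lemma frame_at:
  assumes "x \<in> S"
  obtains U where "x \<in> U" "orthonormal_frame g U (frame_at g x)"
proof -
  have "\<exists>E U. x \<in> U \<and> orthonormal_frame g U E"
    using orthonormal_frame_exists assms by blast
  from someI_ex[OF this] that show ?thesis unfolding frame_at_def by blast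
qed

text \<open>Raising an index preserves smoothness: with respect to a smooth orthonormal frame the
  components of \<open>W\<close> are the values of \<open>l\<close> on the frame. This replaces the inverse metric matrix.\<close>
lemma smooth_raise:
  assumes W: "\<And>x Z. x \<in> S \<Longrightarrow> g x (W x) Z = l x Z" and l: "\<And>Z. smooth_on S (\<lambda>x. l x Z)"
  shows "smooth_on S W"
proof -
  obtain E where E: "orthonormal_frame g S E" using orthonormal_frame_exists by blast
  have "W x = (\<Sum>i<DIM('e). (\<Sum>b\<in>Basis. (E i x \<bullet> b) * l x b) *\<^sub>R E i x)" if "x \<in> S" for x
  proof -
    have "orthonormal_wrt (g x) (\<lambda>i. E i x)"
      using E that by (auto simp: orthonormal_frame_def orthonormal_wrt_def)
    from orthonormal_expansion[OF bilinear_g[OF that] this, of "W x"]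
    have "W x = (\<Sum>i<DIM('e). g x (W x) (E i x) *\<^sub>R E i x)" .
    also have "\<dots> = (\<Sum>i<DIM('e). (\<Sum>b\<in>Basis. (E i x \<bullet> b) * l x b) *\<^sub>R E i x)"
    proof (intro sum.cong refl arg_cong2[where f = scaleR])
      have "linear (g x (W x))" using bilinear_g[OF that] by (simp add: bilinear_def)
      from euclidean_sum[OF this]
      show "g x (W x) (E i x) = (\<Sum>b\<in>Basis. (E i x \<bullet> b) * l x b)" for i
        unfolding real_scaleR_def W[OF that] .
    qed
    finally show ?thesis .
  qed
  moreover have "smooth_on S (\<lambda>x. \<Sum>i<DIM('e). (\<Sum>b\<in>Basis. (E i x \<bullet> b) * l x b) *\<^sub>R E i x)"
    using E l open_S by (intro smooth_intros) (auto simp: orthonormal_frame_def)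
  ultimately show ?thesis using smooth_on_cong[OF open_S, of W] by simp
qed

lemma bilinear_D_g: "x \<in> S \<Longrightarrow> bilinear (\<lambda>X Y. D (\<lambda>z. g z X Y) x Z)"
  by (rule bilinear_D_field[OF open_S _ bilinear_g smooth_g])

lemma linear_D_g: "x \<in> S \<Longrightarrow> linear (D (\<lambda>z. g z X Y) x)"
  by (intro linear_D smooth_on_differentiable[OF smooth_g])

lemma D_g_sym: "x \<in> S \<Longrightarrow> D (\<lambda>z. g z X Y) x = D (\<lambda>z. g z Y X) x"
  by (rule D_cong_open[OF open_S]) (auto simp: g_sym)

lemma christoffel_lowered:
  assumes x: "x \<in> S"
  shows "g x (christoffel g x X Y) Z =
     (D (\<lambda>z. g z Y Z) x X + D (\<lambda>z. g z X Z) x Y - D (\<lambda>z. g z X Y) x Z) / 2"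
proof -
  let ?l = "\<lambda>Z. (D (\<lambda>z. g z Y Z) x X + D (\<lambda>z. g z X Z) x Y - D (\<lambda>z. g z X Y) x Z) / 2"
  have "linear ?l"
    by (rule linearI)
      (simp_all add: linear_add[OF linear_D_g[OF x]] linear_scale[OF linear_D_g[OF x]]
        bilinear_radd[OF bilinear_D_g[OF x]] bilinear_rmul[OF bilinear_D_g[OF x]] field_simps)
  from theI'[OF riesz[OF bilinear_g[OF x] g_pos[OF x] this]]
  show ?thesis unfolding christoffel_def by (rule spec)
qed

lemma christoffel_sym: "x \<in> S \<Longrightarrow> christoffel g x X Y = christoffel g x Y X"
  by (rule g_eqI, assumption) (simp only: christoffel_lowered D_g_sym[of x X Y] add.commute)

lemma bilinear_christoffel:
  assumes x: "x \<in> S"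
  shows "bilinear (christoffel g x)"
proof -
  have "linear (\<lambda>X. christoffel g x X Y)" for Y
    by (rule linearI; rule g_eqI[OF x])
      (simp_all add: christoffel_lowered[OF x] g_bilinear_simps[OF x]
        linear_add[OF linear_D_g[OF x]] linear_scale[OF linear_D_g[OF x]]
        bilinear_ladd[OF bilinear_D_g[OF x]] bilinear_lmul[OF bilinear_D_g[OF x]] field_simps)
  moreover have "christoffel g x X = (\<lambda>Y. christoffel g x Y X)" for X
    using christoffel_sym[OF x] by auto
  ultimately show ?thesis unfolding bilinear_def by metis
qed

lemma D_g_christoffel:
  assumes x: "x \<in> S"
  shows "D (\<lambda>z. g z X Y) x Z = g x (christoffel g x Z X) Y + g x X (christoffel g x Z Y)"
proof -
  have "g x X (christoffel g x Z Y) = g x (christoffel g x Z Y) X" by (rule g_sym[OF x])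
  moreover have "D (\<lambda>z. g z Y X) x = D (\<lambda>z. g z X Y) x" by (rule D_g_sym[OF x])
  ultimately show ?thesis by (simp add: christoffel_lowered[OF x] field_simps)
qed

lemma smooth_christoffel: "smooth_on S (\<lambda>x. christoffel g x X Y)"
proof (rule smooth_raise)
  show "smooth_on S (\<lambda>x. (D (\<lambda>z. g z Y Z) x X + D (\<lambda>z. g z X Z) x Y - D (\<lambda>z. g z X Y) x Z) / 2)" for Z
    by (intro smooth_on_bounded_linear[OF bounded_linear_divide open_S] smooth_intros
        open_S smooth_g)
  show "g x (christoffel g x X Y) Z =
      (D (\<lambda>z. g z Y Z) x X + D (\<lambda>z. g z X Z) x Y - D (\<lambda>z. g z X Y) x Z) / 2" if "x \<in> S" for x Z
    by (rule christoffel_lowered[OF that])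
qed

lemmas christoffel_bilinear_simps =
  bilinear_ladd[OF bilinear_christoffel] bilinear_radd[OF bilinear_christoffel]
  bilinear_lmul[OF bilinear_christoffel] bilinear_rmul[OF bilinear_christoffel]
  bilinear_lsub[OF bilinear_christoffel] bilinear_rsub[OF bilinear_christoffel]
  bilinear_lneg[OF bilinear_christoffel] bilinear_rneg[OF bilinear_christoffel]
  bilinear_lzero[OF bilinear_christoffel] bilinear_rzero[OF bilinear_christoffel]

lemma g_grad:
  assumes x: "x \<in> S" and F: "F differentiable (at x)"
  shows "g x (grad g F x) Z = D F x Z"
  using theI'[OF riesz[OF bilinear_g[OF x] g_pos[OF x] linear_D[OF F]]]
  unfolding grad_def by blast

lemma smooth_grad: "smooth_on S F \<Longrightarrow> smooth_on S (grad g F)"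
  by (rule smooth_raise[where l = "\<lambda>x Z. D F x Z"])
    (auto intro: g_grad smooth_on_differentiable smooth_on_D)

end

section \<open>Covariant derivatives along maps\<close>

text \<open>The covariant derivative along the map \<open>p\<close> of the section \<open>s\<close>, as a linear function of the
  direction. The Levi-Civita connection is the case of the identity, the pullback connection is the
  general case, and each of them only uses the value of the direction field at the point.\<close>
definition cov :: "'f::euclidean_space metric_field \<Rightarrow> ('e::euclidean_space \<Rightarrow> 'f)
    \<Rightarrow> ('e \<Rightarrow> 'f) \<Rightarrow> 'e \<Rightarrow> 'e \<Rightarrow> 'f" where
  "cov h p s z X = D s z X + christoffel h (p z) (D p z X) (s z)"

lemma pullback_connection_cov: "pullback_connection h p X s z = cov h p s z (X z)"
  by (simp add: pullback_connection_def cov_def)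

lemma levi_civita_cov: "levi_civita h X s z = cov h (\<lambda>x. x) s z (X z)"
  by (simp add: levi_civita_def cov_def)

lemma cov_cong_open:
  assumes "open T" "z \<in> T" "\<And>w. w \<in> T \<Longrightarrow> s w = s' w"
  shows "cov h p s z X = cov h p s' z X"
  using D_cong_open[OF assms] assms(2,3) by (simp add: cov_def)

locale map_to_riemannian_domain = riemannian_domain S g
  for S :: "'e::euclidean_space set" and g +
  fixes T :: "'z::euclidean_space set" and p :: "'z \<Rightarrow> 'e"
  assumes open_T: "open T" and smooth_p: "smooth_on T p" and p_in: "z \<in> T \<Longrightarrow> p z \<in> S"
begin

lemma diffT: "smooth_on T s \<Longrightarrow> z \<in> T \<Longrightarrow> s differentiable (at z)"
  by (rule smooth_on_differentiable)

lemma smooth_christoffel_along: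
  assumes "smooth_on T u" "smooth_on T v"
  shows "smooth_on T (\<lambda>z. christoffel g (p z) (u z) (v z))"
  by (rule smooth_on_bilinear_field[OF open_T bilinear_christoffel[OF p_in]
        smooth_on_compose[OF open_T open_S smooth_christoffel smooth_p p_in] assms])

lemma smooth_g_along:
  assumes "smooth_on T u" "smooth_on T v"
  shows "smooth_on T (\<lambda>z. g (p z) (u z) (v z))"
  by (rule smooth_on_bilinear_field[OF open_T bilinear_g[OF p_in]
        smooth_on_compose[OF open_T open_S smooth_g smooth_p p_in] assms])

lemma smooth_cov:
  assumes "smooth_on T s" "smooth_on T X"
  shows "smooth_on T (\<lambda>z. cov g p s z (X z))"
  unfolding cov_def
  by (intro smooth_intros smooth_on_D_field smooth_christoffel_along open_T assms smooth_p)

lemma linear_cov: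
  assumes "z \<in> T" "smooth_on T s"
  shows "linear (cov g p s z)"
proof -
  note D = linear_D[OF diffT[OF assms(2,1)]] linear_D[OF diffT[OF smooth_p assms(1)]]
  show ?thesis
    by (rule linearI) (simp_all add: cov_def linear_add[OF D(1)] linear_add[OF D(2)]
      linear_scale[OF D(1)] linear_scale[OF D(2)] christoffel_bilinear_simps[OF p_in[OF assms(1)]]
      scaleR_add_right)
qed

lemma cov_zero: "z \<in> T \<Longrightarrow> cov g p (\<lambda>z. 0) z X = 0"
  by (simp add: cov_def christoffel_bilinear_simps[OF p_in])

lemma cov_add:
  assumes "z \<in> T" "smooth_on T s" "smooth_on T t"
  shows "cov g p (\<lambda>z. s z + t z) z X = cov g p s z X + cov g p t z X"
  using assms by (simp add: cov_def D_add diffT christoffel_bilinear_simps[OF p_in])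

lemma cov_scaleR:
  assumes "z \<in> T" "smooth_on T r" "smooth_on T s"
  shows "cov g p (\<lambda>z. r z *\<^sub>R s z) z X = D r z X *\<^sub>R s z + r z *\<^sub>R cov g p s z X"
  using assms by (simp add: cov_def D_scaleR diffT christoffel_bilinear_simps[OF p_in] algebra_simps)

lemma cov_scale_const:
  assumes "z \<in> T" "smooth_on T s"
  shows "cov g p (\<lambda>z. c *\<^sub>R s z) z X = c *\<^sub>R cov g p s z X"
  using cov_scaleR[OF assms(1) smooth_on_const assms(2), of c X] by simp

lemma D_g_cov:
  assumes "z \<in> T" "smooth_on T u" "smooth_on T v"
  shows "D (\<lambda>z. g (p z) (u z) (v z)) z X =
    g (p z) (cov g p u z X) (v z) + g (p z) (u z) (cov g p v z X)"
proof -
  note p = p_in[OF assms(1)]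
  show ?thesis
    by (subst D_bilinear_field[where B = g and S = S and p = p and u = u and v = v])
      (use assms smooth_p in \<open>auto simp: open_S p bilinear_g smooth_g diffT cov_def
        D_g_christoffel[OF p] g_bilinear_simps[OF p]\<close>)
qed

lemma D_christoffel_along:
  assumes "z \<in> T" "smooth_on T u" "smooth_on T v"
  shows "D (\<lambda>z. christoffel g (p z) (u z) (v z)) z X =
    D (\<lambda>x. christoffel g x (u z) (v z)) (p z) (D p z X)
    + christoffel g (p z) (D u z X) (v z) + christoffel g (p z) (u z) (D v z X)"
  using assms smooth_p
  by (intro D_bilinear_field[where B = "christoffel g" and S = S and p = p and u = u and v = v]
      open_S p_in bilinear_christoffel smooth_christoffel diffT) auto

lemma cov_compose:
  assumes "z \<in> T" "smooth_on S F"
  shows "cov g p (\<lambda>z. F (p z)) z X = cov g (\<lambda>x. x) F (p z) (D p z X)"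
  using assms smooth_on_differentiable[OF assms(2) p_in[OF assms(1)]]
  by (simp add: cov_def D_compose diffT[OF smooth_p])

text \<open>The Levi-Civita connection has no torsion: second derivatives and Christoffel symbols are
  both symmetric.\<close>
lemma cov_D_sym:
  assumes "z \<in> T"
  shows "cov g p (\<lambda>z. D p z Y) z X = cov g p (\<lambda>z. D p z X) z Y"
  using symmetric_second_derivative[OF open_T assms smooth_p, of X Y]
    christoffel_sym[OF p_in[OF assms], of "D p z X" "D p z Y"]
  by (simp add: cov_def)

end

context riemannian_domain
begin

sublocale self: map_to_riemannian_domain S g S "\<lambda>x. x"
  by unfold_locales (auto intro: open_S smooth_intros)

text \<open>The second covariant derivative \<open>\<nabla>\<^sup>2\<^bsub>u,v\<^esub> F\<close> of a vector field; the subtracted term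
  is due to extending \<open>v\<close> with constant coordinates.\<close>
definition hess :: "('e \<Rightarrow> 'e) \<Rightarrow> 'e \<Rightarrow> 'e \<Rightarrow> 'e \<Rightarrow> 'e" where
  "hess F x u v = cov g (\<lambda>x. x) (\<lambda>y. cov g (\<lambda>x. x) F y v) x u
     - cov g (\<lambda>x. x) F x (christoffel g x u v)"

lemma bilinear_hess:
  assumes x: "x \<in> S" and F: "smooth_on S F"
  shows "bilinear (hess F x)"
proof -
  note lin = self.linear_cov[OF _ F]
  have sm: "smooth_on S (\<lambda>y. cov g (\<lambda>x. x) F y v)" for v
    using self.smooth_cov[OF F smooth_on_const] .
  have 1: "linear (cov g (\<lambda>x. x) (\<lambda>y. cov g (\<lambda>x. x) F y v) x)" for v
    by (rule self.linear_cov[OF x sm])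
  have 2: "cov g (\<lambda>x. x) (\<lambda>y. cov g (\<lambda>x. x) F y (v + w)) x u =
      cov g (\<lambda>x. x) (\<lambda>y. cov g (\<lambda>x. x) F y v) x u + cov g (\<lambda>x. x) (\<lambda>y. cov g (\<lambda>x. x) F y w) x u" for u v w
    by (subst self.cov_add[OF x sm sm, symmetric], rule cov_cong_open[OF open_S x])
      (rule linear_add[OF lin])
  have 3: "cov g (\<lambda>x. x) (\<lambda>y. cov g (\<lambda>x. x) F y (r *\<^sub>R v)) x u =
      r *\<^sub>R cov g (\<lambda>x. x) (\<lambda>y. cov g (\<lambda>x. x) F y v) x u" for u v r
    by (subst self.cov_scale_const[OF x sm, symmetric], rule cov_cong_open[OF open_S x])
      (rule linear_scale[OF lin])
  show ?thesis
    unfolding bilinear_def hess_def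
    by (intro conjI allI linearI)
      (simp_all add: 2 3 linear_add[OF 1] linear_scale[OF 1] linear_add[OF lin[OF x]]
        linear_scale[OF lin[OF x]] christoffel_bilinear_simps[OF x] algebra_simps)
qed

end

context map_to_riemannian_domain
begin

text \<open>The second covariant derivative of \<open>F \<circ> p\<close> is the pullback of that of \<open>F\<close>, provided the
  correction term \<open>Y\<close> has the same image as the covariant derivative of the pushed field. For the
  identity, and for the projection of the tangent bundle to a flat base, this holds with
  \<open>Y = \<nabla>\<^bsub>X\<^esub> X\<close>. It also shows that the expression only
  depends on \<open>X z\<close>.\<close>
lemma cov_cov_compose:
  assumes z: "z \<in> T" and F: "smooth_on S F" and X: "smooth_on T X"
    and Y: "D p z Y = cov g p (\<lambda>z. D p z (X z)) z (X z)"
  shows "cov g p (\<lambda>z. cov g p (\<lambda>z. F (p z)) z (X z)) z (X z) - cov g p (\<lambda>z. F (p z)) z Y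
    = hess F (p z) (D p z (X z)) (D p z (X z))"
proof -
  note x = p_in[OF z]
  let ?L = "cov g (\<lambda>x. x) F" and ?u = "\<lambda>z. D p z (X z)"
  have u: "smooth_on T ?u" by (rule smooth_on_D_field[OF open_T smooth_p X])
  have "cov g p (\<lambda>z. cov g p (\<lambda>z. F (p z)) z (X z)) z (X z) = cov g p (\<lambda>z. ?L (p z) (?u z)) z (X z)"
    by (rule cov_cong_open[OF open_T z]) (rule cov_compose[OF _ F])
  also have "\<dots> = D (\<lambda>z. ?L (p z) (?u z)) z (X z) + christoffel g (p z) (?u z) (?L (p z) (?u z))"
    by (simp add: cov_def[of g p])
  also have "D (\<lambda>z. ?L (p z) (?u z)) z (X z) =
      D (\<lambda>x. ?L x (?u z)) (p z) (?u z) + ?L (p z) (D ?u z (X z))"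
    using self.linear_cov[OF _ F] self.smooth_cov[OF F smooth_on_const] diffT[OF smooth_p z] diffT[OF u z]
    by (intro D_linear_field[where L = ?L and S = S and p = p and u = ?u] open_S x)
  finally have 1: "cov g p (\<lambda>z. cov g p (\<lambda>z. F (p z)) z (X z)) z (X z) =
    cov g (\<lambda>x. x) (\<lambda>x. ?L x (?u z)) (p z) (?u z) + ?L (p z) (D ?u z (X z))"
    by (simp add: cov_def[of g "\<lambda>x. x" "\<lambda>x. ?L x (?u z)"])
  have "cov g p (\<lambda>z. F (p z)) z Y = ?L (p z) (cov g p ?u z (X z))"
    by (simp add: cov_compose[OF z F] Y)
  also have "\<dots> = ?L (p z) (D ?u z (X z)) + ?L (p z) (christoffel g (p z) (?u z) (?u z))"
    by (simp add: cov_def[of g p] linear_add[OF self.linear_cov[OF x F]])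
  finally show ?thesis using 1 by (simp add: hess_def)
qed

end

context riemannian_domain
begin

lemma frame_at_orthonormal:
  assumes "x \<in> S" shows "orthonormal_wrt (g x) (\<lambda>i. frame_at g x i x)"
  using frame_at[OF assms] assms unfolding orthonormal_frame_def orthonormal_wrt_def by metis

lemma riemannian_subset: "open U \<Longrightarrow> U \<subseteq> S \<Longrightarrow> riemannian_domain U g"
  by unfold_locales (auto intro: bilinear_g g_sym g_pos smooth_on_subset[OF smooth_g])

lemma trace_nabla2_eq:
  assumes x: "x \<in> S" and F: "smooth_on S F" and e: "orthonormal_wrt (g x) e"
  shows "trace_nabla2 g F x = (\<Sum>i<DIM('e). hess F x (e i) (e i))"
proof -
  let ?E = "frame_at g x"
  obtain U where U: "x \<in> U" "orthonormal_frame g U ?E" by (rule frame_at[OF x])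
  define V where "V = U \<inter> S"
  have V: "open V" "x \<in> V" "V \<subseteq> S" using U x open_S by (auto simp: V_def orthonormal_frame_def)
  have smE: "smooth_on V (?E i)" if "i < DIM('e)" for i
    using U that by (auto simp: V_def orthonormal_frame_def intro: smooth_on_subset)
  interpret V: map_to_riemannian_domain S g V "\<lambda>x. x"
    using V by unfold_locales (auto intro: smooth_intros)
  have "trace_nabla2 g F x = (\<Sum>i<DIM('e). hess F x (?E i x) (?E i x))"
    unfolding trace_nabla2_def Let_def
  proof (intro sum.cong refl)
    fix i assume "i \<in> {..<DIM('e)}"
    then have E: "smooth_on V (?E i)" using smE by simp
    show "levi_civita g (?E i) (levi_civita g (?E i) F) x - levi_civita g (levi_civita g (?E i) (?E i)) F x
      = hess F x (?E i x) (?E i x)"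
      using V.cov_cov_compose[OF V(2) F E, of "levi_civita g (?E i) (?E i) x"]
      by (simp add: levi_civita_cov[abs_def])
  qed
  also have "\<dots> = (\<Sum>i<DIM('e). hess F x (e i) (e i))"
    by (rule trace_orthonormal[OF bilinear_g[OF x] g_sym[OF x] bilinear_hess[OF x F]
        frame_at_orthonormal[OF x] e])
  finally show ?thesis .
qed

end

locale flat_domain = riemannian_domain +
  assumes flat: "x \<in> S \<Longrightarrow> curvature g x X Y Z = 0"
begin

text \<open>The vanishing of the curvature, spelled out for fields with constant coordinates.\<close>
lemma flat_christoffel:
  assumes x: "x \<in> S"
  shows "D (\<lambda>x. christoffel g x Y Z) x X + christoffel g x X (christoffel g x Y Z) =
    D (\<lambda>x. christoffel g x X Z) x Y + christoffel g x Y (christoffel g x X Z)"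
  using flat[OF x, of X Y Z] christoffel_bilinear_simps(9)[OF x]
  by (simp add: curvature_def curvature_field_def levi_civita_def[abs_def] lie_bracket_def)

end

locale map_to_flat_domain = map_to_riemannian_domain S g T p + flat_domain S g
  for S :: "'e::euclidean_space set" and g and T :: "'z::euclidean_space set" and p
begin

text \<open>The pullback of a flat connection is flat; coordinate fields have no bracket.\<close>
lemma cov_commute:
  assumes z: "z \<in> T" and s: "smooth_on T s"
  shows "cov g p (\<lambda>z. cov g p s z Y) z X = cov g p (\<lambda>z. cov g p s z X) z Y"
proof -
  note x = p_in[OF z]
  have *: "cov g p (\<lambda>z. cov g p s z Y) z X =
    D (\<lambda>z. D s z Y) z X + (D (\<lambda>x. christoffel g x (D p z Y) (s z)) (p z) (D p z X)
      + christoffel g (p z) (D p z X) (christoffel g (p z) (D p z Y) (s z)))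
    + christoffel g (p z) (D (\<lambda>z. D p z Y) z X) (s z)
    + (christoffel g (p z) (D p z Y) (D s z X) + christoffel g (p z) (D p z X) (D s z Y))" for X Y
  proof -
    have sm: "smooth_on T (\<lambda>z. D s z Y)" "smooth_on T (\<lambda>z. D p z Y)"
      "smooth_on T (\<lambda>z. christoffel g (p z) (D p z Y) (s z))"
      by (intro smooth_christoffel_along smooth_intros s smooth_p)+
    show ?thesis
      unfolding cov_def
      by (simp add: D_add[OF diffT[OF sm(1) z] diffT[OF sm(3) z]] D_christoffel_along[OF z sm(2) s]
          christoffel_bilinear_simps[OF x] add_ac)
  qed
  show ?thesis
    unfolding *[of Y X] *[of X Y] flat_christoffel[OF x, of "D p z Y" "s z" "D p z X"]
      symmetric_second_derivative[OF open_T z s, of X Y]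
      symmetric_second_derivative[OF open_T z smooth_p, of X Y]
    by (simp add: add_ac)
qed

end

locale isometry_of_domains = map_to_riemannian_domain S g S' \<psi> + src: riemannian_domain S' g'
  for S g S' g' and \<psi> :: "'e::euclidean_space \<Rightarrow> 'e" +
  assumes isometry: "x \<in> S' \<Longrightarrow> g' x X Y = g (\<psi> x) (D \<psi> x X) (D \<psi> x Y)"
begin

lemma D_inj: "x \<in> S' \<Longrightarrow> inj (D \<psi> x)"
proof -
  assume x: "x \<in> S'"
  note lin = linear_D[OF diffT[OF smooth_p x]]
  show ?thesis
    unfolding linear_injective_0[OF lin]
  proof (intro allI impI, rule ccontr)
    fix v assume v: "D \<psi> x v = 0" "v \<noteq> 0"
    then have "g' x v v = 0" by (simp add: isometry[OF x] g_bilinear_simps[OF p_in[OF x]])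
    with src.g_pos[OF x v(2)] show False by simp
  qed
qed

text \<open>The transformation rule of Christoffel symbols: the second fundamental form of an isometry
  vanishes. The left side, pulled back by the invertible \<open>D \<psi> x\<close>, is symmetric since there is no
  torsion, and it is compatible with \<open>g'\<close> since \<open>\<psi>\<close> preserves the metrics.\<close>
lemma cov_D:
  assumes x: "x \<in> S'"
  shows "cov g \<psi> (\<lambda>y. D \<psi> y v) x u = D \<psi> x (christoffel g' x u v)"
proof -
  note lin = linear_D[OF diffT[OF smooth_p x]]
  have "surj (D \<psi> x)" using linear_injective_imp_surjective[OF lin D_inj[OF x]] by simp
  then have inv: "D \<psi> x (inv (D \<psi> x) w) = w" for w by (rule surj_f_inv_f)
  define C where "C u v = inv (D \<psi> x) (cov g \<psi> (\<lambda>y. D \<psi> y v) x u)" for u v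
  have C: "D \<psi> x (C u v) = cov g \<psi> (\<lambda>y. D \<psi> y v) x u" for u v by (simp add: C_def inv)
  have "christoffel g' x u v = C u v"
  proof (rule christoffel_eqI[where C = C])
    show "bilinear (g' x)" "g' x X Y = g' x Y X" for X Y
      by (rule src.bilinear_g src.g_sym, fact x)+
    show "X \<noteq> 0 \<Longrightarrow> 0 < g' x X X" for X by (rule src.g_pos[OF x])
    show "C X Y = C Y X" for X Y
      unfolding C_def by (subst cov_D_sym[OF x]) (rule refl)
    fix X Y Z
    have sm: "smooth_on S' (\<lambda>y. D \<psi> y X)" for X by (intro smooth_intros smooth_p)
    have "D (\<lambda>z. g' z X Y) x Z = D (\<lambda>z. g (\<psi> z) (D \<psi> z X) (D \<psi> z Y)) x Z"
      by (subst D_cong_open[OF open_T x]) (auto simp: isometry)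
    also have "\<dots> = g' x (C Z X) Y + g' x X (C Z Y)"
      by (simp add: D_g_cov[OF x sm sm] isometry[OF x] C)
    finally show "D (\<lambda>z. g' z X Y) x Z = g' x (C Z X) Y + g' x X (C Z Y)" .
  qed
  then show ?thesis by (simp add: C)
qed

lemma cov_push:
  assumes T: "open T" "smooth_on T q" "\<And>z. z \<in> T \<Longrightarrow> q z \<in> S'" and z: "z \<in> T" and s: "smooth_on T s"
  shows "cov g (\<lambda>z. \<psi> (q z)) (\<lambda>z. D \<psi> (q z) (s z)) z X = D \<psi> (q z) (cov g' q s z X)"
proof -
  note x = T(3)[OF z]
  note dq = smooth_on_differentiable[OF T(2) z] and ds = smooth_on_differentiable[OF s z]
  note lin = linear_D[OF diffT[OF smooth_p]]
  have 1: "D (\<lambda>z. D \<psi> (q z) (s z)) z X = D (\<lambda>x. D \<psi> x (s z)) (q z) (D q z X) + D \<psi> (q z) (D s z X)"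
    by (rule D_linear_field[OF open_T x lin smooth_on_D[OF smooth_p] dq ds])
  have 2: "D (\<lambda>z. \<psi> (q z)) z X = D \<psi> (q z) (D q z X)"
    by (rule D_compose[OF dq diffT[OF smooth_p x]])
  show ?thesis
    using cov_D[OF x, of "s z" "D q z X"]
    by (simp add: cov_def 1 2 linear_add[OF lin[OF x]])
qed

end

section \<open>The Mus-Sasaki metric of a flat domain\<close>

text \<open>In this locale \<open>S\<close> is the image of a chart, and \<open>h\<close> the Mus-Sasaki metric on its tangent
  bundle.\<close>
locale mus_sasaki_domain = flat_domain +
  fixes f :: "'a \<Rightarrow> real" and h :: "('a \<times> 'a) metric_field"
  assumes smooth_f: "smooth_on S f" and f_pos: "x \<in> S \<Longrightarrow> f x > 0"
    and h_eq: "fst z \<in> S \<Longrightarrow> h z \<xi> \<eta> = g (fst z) (fst \<xi>) (fst \<eta>) + f (fst z) *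
      g (fst z) (snd \<xi> + christoffel g (fst z) (fst \<xi>) (snd z))
        (snd \<eta> + christoffel g (fst z) (fst \<eta>) (snd z))"
begin

text \<open>The connection map: the vertical part of a tangent vector of the tangent bundle.\<close>
definition K :: "'a \<times> 'a \<Rightarrow> 'a \<times> 'a \<Rightarrow> 'a" where
  "K z \<xi> = snd \<xi> + christoffel g (fst z) (fst \<xi>) (snd z)"

abbreviation F :: "'a \<Rightarrow> 'a" where
  "F \<equiv> grad g f"

text \<open>The logarithmic derivative of \<open>sqrt f\<close>, which is the warping function.\<close>
definition \<alpha> :: "'a \<Rightarrow> 'a \<Rightarrow> real" where
  "\<alpha> x u = D f x u * inverse (2 * f x)"

abbreviation TS :: "('a \<times> 'a) set" where
  "TS \<equiv> S \<times> UNIV"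

lemma open_TS: "open TS"
  by (intro open_Times open_S open_UNIV)

sublocale fst: map_to_flat_domain S g TS fst
  by unfold_locales (auto intro: open_TS smooth_on_fst_map)

lemma linear_K: "fst z \<in> S \<Longrightarrow> linear (K z)"
  by (rule linearI) (simp_all add: K_def christoffel_bilinear_simps scaleR_add_right)

lemmas K_add = linear_add[OF linear_K] and K_diff = linear_diff[OF linear_K]
  and K_scale = linear_scale[OF linear_K] and K_sum = linear_sum[OF linear_K]
  and K_zero = linear_0[OF linear_K] and K_neg = linear_neg[OF linear_K]

lemma K_vertical_part: "K z (a, k - christoffel g (fst z) a (snd z)) = k"
  by (simp add: K_def)

lemma components_eqI: "fst \<xi> = fst \<eta> \<Longrightarrow> K z \<xi> = K z \<eta> \<Longrightarrow> \<xi> = \<eta>"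
  by (auto simp: K_def prod_eq_iff)

lemma h_K: "fst z \<in> S \<Longrightarrow> h z \<xi> \<eta> = g (fst z) (fst \<xi>) (fst \<eta>) + f (fst z) * g (fst z) (K z \<xi>) (K z \<eta>)"
  by (simp add: h_eq K_def)

lemma smooth_K: "smooth_on TS u \<Longrightarrow> smooth_on TS (\<lambda>z. K z (u z))"
  unfolding K_def
  by (intro smooth_intros fst.smooth_christoffel_along open_TS smooth_on_snd_map)

lemma smooth_F: "smooth_on S F"
  by (rule smooth_grad[OF smooth_f])

lemma g_F: "x \<in> S \<Longrightarrow> g x (F x) u = D f x u"
  by (intro g_grad smooth_on_differentiable[OF smooth_f])

lemma g_F_right: "x \<in> S \<Longrightarrow> g x u (F x) = D f x u"
  using g_sym g_F by metis

lemma D_f: "x \<in> S \<Longrightarrow> D f x u = 2 * f x * \<alpha> x u"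
  using f_pos[of x] by (simp add: \<alpha>_def)

lemma linear_\<alpha>: "x \<in> S \<Longrightarrow> linear (\<alpha> x)"
  using linear_D[OF smooth_on_differentiable[OF smooth_f]]
  by (auto intro!: linearI simp: \<alpha>_def linear_add linear_scale algebra_simps)

lemmas \<alpha>_add = linear_add[OF linear_\<alpha>]
  and \<alpha>_scale = linear_scale[OF linear_\<alpha>]

lemma smooth_\<alpha>: "smooth_on S u \<Longrightarrow> smooth_on S (\<lambda>x. \<alpha> x (u x))"
  unfolding \<alpha>_def using f_pos
  by (intro smooth_intros smooth_on_D_field smooth_on_inverse smooth_f open_S) auto

text \<open>The form \<open>\<alpha>\<close> is exact, hence closed.\<close>
lemma D_\<alpha>_sym:
  assumes x: "x \<in> S"
  shows "D (\<lambda>x. \<alpha> x u) x v = D (\<lambda>x. \<alpha> x v) x u"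
proof -
  have f0: "f x \<noteq> 0" using f_pos[OF x] by simp
  have "D (\<lambda>x. \<alpha> x u) x v = D (\<lambda>x. D f x u) x v * inverse (2 * f x)
      - D f x u * D f x v * (2 * (inverse (2 * f x) * inverse (2 * f x)))" for u v
  proof -
    have "((\<lambda>x. 2 * f x) has_derivative (\<lambda>v. 2 * D f x v)) (at x)"
      by (intro has_derivative_mult_right smooth_on_has_derivative[OF smooth_f x])
    from Deriv.has_derivative_inverse[OF _ this]
    have "((\<lambda>x. inverse (2 * f x)) has_derivative
        (\<lambda>v. - (inverse (2 * f x) * (2 * D f x v) * inverse (2 * f x)))) (at x)"
      using f0 by simp
    from has_derivative_mult[OF smooth_on_has_derivative[OF smooth_on_D[OF smooth_f] x] this]
    show ?thesis unfolding \<alpha>_def by (subst D_eqI) (assumption, simp add: algebra_simps)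
  qed
  then show ?thesis using symmetric_second_derivative[OF open_S x smooth_f, of u v] by simp
qed

lemma linear_D_\<alpha>:
  assumes x: "x \<in> S" shows "linear (\<lambda>u. D (\<lambda>x. \<alpha> x u) x w)"
proof -
  have "bilinear (\<lambda>u (r::real). D (\<lambda>x. r * \<alpha> x u) x w)"
    using linear_\<alpha>
    by (intro bilinear_D_field[OF open_S x] smooth_intros smooth_\<alpha> open_S)
      (auto simp: bilinear_def linear_add linear_scale algebra_simps intro!: linearI)
  then have "linear (\<lambda>u. D (\<lambda>x. 1 * \<alpha> x u) x w)" unfolding bilinear_def by blast
  then show ?thesis by simp
qed

text \<open>The difference of the two sides is the curvature of the base, applied to the point \<open>snd z\<close> of
  the fibre. Without flatness the formula for the Christoffel symbols of \<open>h\<close> would contain this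
  curvature.\<close>
lemma cov_K_sym:
  assumes z: "z \<in> TS"
  shows "cov g fst (\<lambda>w. K w \<eta>) z \<xi> = cov g fst (\<lambda>w. K w \<xi>) z \<eta>"
proof -
  have x: "fst z \<in> S" using z by auto
  have sm: "smooth_on TS (\<lambda>w. christoffel g (fst w) (fst \<eta>) (snd w))" for \<eta>
    by (intro fst.smooth_christoffel_along smooth_intros open_TS smooth_on_snd_map)
  have "cov g fst (\<lambda>w. K w \<eta>) z \<xi> =
    (D (\<lambda>x. christoffel g x (fst \<eta>) (snd z)) (fst z) (fst \<xi>)
     + christoffel g (fst z) (fst \<xi>) (christoffel g (fst z) (fst \<eta>) (snd z)))
    + (christoffel g (fst z) (fst \<eta>) (snd \<xi>) + christoffel g (fst z) (fst \<xi>) (snd \<eta>))" for \<xi> \<eta>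
    unfolding cov_def K_def
    by (simp add: D_add smooth_on_differentiable[OF sm z] D_fst D_snd christoffel_bilinear_simps[OF x]
        fst.D_christoffel_along[OF z smooth_on_const smooth_on_snd_map[OF open_TS]])
  then show ?thesis
    using flat_christoffel[OF x, of "fst \<eta>" "snd z" "fst \<xi>"] by (simp add: add_ac)
qed

sublocale h: riemannian_domain TS h
proof
  show "open TS" by (rule open_TS)
  fix z assume z: "z \<in> TS"
  then have x: "fst z \<in> S" by auto
  show "bilinear (h z)"
    unfolding bilinear_def
    by (intro conjI allI linearI)
      (simp_all add: h_K[OF x] g_bilinear_simps[OF x] K_add[OF x] K_scale[OF x] algebra_simps)
  show "h z X Y = h z Y X" for X Y
    by (simp add: h_K[OF x] g_sym[OF x, of "fst X"] g_sym[OF x, of "K z X"])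
  show "0 < h z X X" if "X \<noteq> 0" for X
  proof (cases "fst X = 0")
    case True
    then have "K z X \<noteq> 0"
      using that by (auto simp: K_def christoffel_bilinear_simps[OF x] prod_eq_iff)
    then show ?thesis using True g_pos[OF x] f_pos[OF x] by (simp add: h_K[OF x] g_bilinear_simps[OF x])
  next
    case False
    have "g (fst z) (K z X) (K z X) \<ge> 0"
      using g_pos[OF x, of "K z X"] g_bilinear_simps[OF x] by (cases "K z X = 0") auto
    then show ?thesis using g_pos[OF x False] f_pos[OF x] by (simp add: h_K[OF x] add_pos_nonneg)
  qed
next
  fix X Y
  have "smooth_on TS (\<lambda>z. g (fst z) (fst X) (fst Y) + f (fst z) * g (fst z) (K z X) (K z Y))"
    by (intro smooth_intros fst.smooth_g_along smooth_K open_TS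
        smooth_on_compose[OF open_TS open_S smooth_f] smooth_on_fst_map) auto
  then show "smooth_on TS (\<lambda>z. h z X Y)"
    by (subst smooth_on_cong[OF open_TS]) (auto simp: h_K)
qed

text \<open>The Christoffel symbols of \<open>h\<close>. Here \<open>a\<close> and \<open>k\<close> are the horizontal and the vertical part, as
  for a warped product: two vertical vectors produce a multiple of \<open>F\<close>, a horizontal and a vertical
  one produce a vertical vector with factor \<open>\<alpha>\<close>. The second component of the pair undoes \<open>K\<close>.\<close>
definition h_product :: "'a \<times> 'a \<Rightarrow> 'a \<times> 'a \<Rightarrow> 'a \<times> 'a \<Rightarrow> 'a \<times> 'a" where
  "h_product z \<xi> \<eta> = (let x = fst z;
      a = christoffel g x (fst \<xi>) (fst \<eta>) - (g x (K z \<xi>) (K z \<eta>) / 2) *\<^sub>R F x;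
      k = cov g fst (\<lambda>w. K w \<eta>) z \<xi> + \<alpha> x (fst \<xi>) *\<^sub>R K z \<eta> + \<alpha> x (fst \<eta>) *\<^sub>R K z \<xi>
    in (a, k - christoffel g x a (snd z)))"

lemma fst_h_product: "fst (h_product z \<xi> \<eta>) =
    christoffel g (fst z) (fst \<xi>) (fst \<eta>) - (g (fst z) (K z \<xi>) (K z \<eta>) / 2) *\<^sub>R F (fst z)"
  and K_h_product: "K z (h_product z \<xi> \<eta>) = cov g fst (\<lambda>w. K w \<eta>) z \<xi>
    + \<alpha> (fst z) (fst \<xi>) *\<^sub>R K z \<eta> + \<alpha> (fst z) (fst \<eta>) *\<^sub>R K z \<xi>"
  by (simp_all add: h_product_def Let_def K_def)

lemma christoffel_h:
  assumes z: "z \<in> TS"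
  shows "christoffel h z \<xi> \<eta> = h_product z \<xi> \<eta>"
proof (rule christoffel_eqI[where C = "h_product z"])
  have x: "fst z \<in> S" using z by auto
  show "bilinear (h z)" "h z X Y = h z Y X" for X Y
    by (rule h.bilinear_g h.g_sym, fact z)+
  show "X \<noteq> 0 \<Longrightarrow> 0 < h z X X" for X by (rule h.g_pos[OF z])
  show "h_product z X Y = h_product z Y X" for X Y
    by (rule components_eqI[of _ _ z])
      (simp_all add: fst_h_product K_h_product cov_K_sym[OF z, of X Y] christoffel_sym[OF x, of "fst X"]
        g_sym[OF x, of "K z X"])
  fix X Y Z
  let ?G = "\<lambda>w. g (fst w) (fst X) (fst Y)" and ?H = "\<lambda>w. g (fst w) (K w X) (K w Y)"
  have sK: "smooth_on TS (\<lambda>w. K w X)" for X by (intro smooth_K smooth_intros)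
  have cc: "cov g fst (\<lambda>_. u) z Z = christoffel g (fst z) (fst Z) u" for u
    by (simp add: cov_def D_fst)
  have "D (\<lambda>z. h z X Y) z Z = D (\<lambda>w. ?G w + f (fst w) *\<^sub>R ?H w) z Z"
    by (subst D_cong_open[OF open_TS z]) (auto simp: h_K)
  also have "\<dots> = D ?G z Z + (D (\<lambda>w. f (fst w)) z Z * ?H z + f (fst z) * D ?H z Z)"
  proof -
    have sm: "smooth_on TS ?G" "smooth_on TS (\<lambda>w. f (fst w))" "smooth_on TS ?H"
      by (intro fst.smooth_g_along smooth_intros sK smooth_on_compose[OF open_TS open_S smooth_f]
          smooth_on_fst_map open_TS; auto)+
    note d = sm[THEN smooth_on_differentiable, OF z]
    show ?thesis
      by (subst D_add[OF d(1) differentiable_scaleR[OF d(2,3)]])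
        (simp add: D_scaleR[OF d(2,3), unfolded real_scaleR_def])
  qed
  also have "D (\<lambda>w. f (fst w)) z Z = 2 * f (fst z) * \<alpha> (fst z) (fst Z)"
    by (simp add: D_compose smooth_on_differentiable[OF smooth_on_fst_map[OF open_TS] z]
        smooth_on_differentiable[OF smooth_f x] D_fst D_f[OF x])
  also have "D ?G z Z + (2 * f (fst z) * \<alpha> (fst z) (fst Z) * ?H z + f (fst z) * D ?H z Z)
      = h z (h_product z Z X) Y + h z X (h_product z Z Y)"
    by (simp add: fst.D_g_cov[OF z smooth_on_const smooth_on_const] fst.D_g_cov[OF z sK sK] cc
        h_K[OF x] fst_h_product K_h_product g_bilinear_simps[OF x] g_F[OF x] g_F_right[OF x] D_f[OF x]
        g_sym[OF x, of "K z Y" "K z X"] g_sym[OF x, of "K z Z" "K z X"] algebra_simps)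
  finally show "D (\<lambda>z. h z X Y) z Z = h z (h_product z Z X) Y + h z X (h_product z Z Y)" .
qed

end

text \<open>Covariant derivatives of \<open>h\<close> along a map into the tangent bundle; \<open>p\<close> is its projection to
  the base.\<close>
locale map_to_bundle = mus_sasaki_domain S g f h
  for S :: "'e::euclidean_space set" and g f h +
  fixes T :: "'z::euclidean_space set" and \<phi> :: "'z \<Rightarrow> 'e \<times> 'e"
  assumes open_T': "open T" and smooth_\<phi>: "smooth_on T \<phi>" and \<phi>_in: "z \<in> T \<Longrightarrow> \<phi> z \<in> TS"
begin

abbreviation p :: "'z \<Rightarrow> 'e" where "p \<equiv> \<lambda>z. fst (\<phi> z)"

sublocale p: map_to_flat_domain S g T p
  using \<phi>_in by unfold_locales (auto simp: mem_Times_iff intro: open_T' smooth_intros smooth_\<phi>)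

sublocale \<phi>: map_to_riemannian_domain TS h T \<phi>
  by unfold_locales (auto intro: open_T' smooth_\<phi> dest: \<phi>_in)

lemma p_S: "z \<in> T \<Longrightarrow> fst (\<phi> z) \<in> S"
  by (rule p.p_in)

lemma D_p: "z \<in> T \<Longrightarrow> D p z X = fst (D \<phi> z X)"
  by (rule D_bounded_linear[OF bounded_linear_fst \<phi>.diffT[OF smooth_\<phi>]])

lemma smooth_K_along: "smooth_on T V \<Longrightarrow> smooth_on T (\<lambda>z. K (\<phi> z) (V z))"
  unfolding K_def
  by (intro smooth_intros p.smooth_christoffel_along open_T' smooth_\<phi>)

lemma smooth_\<alpha>_along: "smooth_on T u \<Longrightarrow> smooth_on T (\<lambda>z. \<alpha> (p z) (u z))"
  unfolding \<alpha>_def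
proof (intro smooth_intros smooth_on_inverse open_T')
  assume u: "smooth_on T u"
  show "smooth_on T (\<lambda>z. D f (p z) (u z))"
    by (rule smooth_on_linear_field[OF open_T' open_S linear_D[OF smooth_on_differentiable[OF smooth_f]]
          smooth_on_D[OF smooth_f] p.smooth_p p.p_in u])
  show "smooth_on T (\<lambda>z. f (p z))"
    by (rule smooth_on_compose[OF open_T' open_S smooth_f p.smooth_p p.p_in])
qed (use f_pos p_S in auto)

text \<open>The two lemmas below express the connection of \<open>h\<close> by that of the base. All later computations
  use these components only.\<close>
lemma fst_cov_h:
  assumes z: "z \<in> T" and V: "smooth_on T V"
  shows "fst (cov h \<phi> V z X) = cov g p (\<lambda>z. fst (V z)) z X
    - (g (p z) (K (\<phi> z) (D \<phi> z X)) (K (\<phi> z) (V z)) / 2) *\<^sub>R F (p z)"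
  using D_bounded_linear[OF bounded_linear_fst \<phi>.diffT[OF V z], of X]
  by (simp add: cov_def christoffel_h[OF \<phi>_in[OF z]] fst_h_product D_p[OF z])

text \<open>Differentiating \<open>K\<close> itself gives the term \<open>cov g fst (\<lambda>w. K w \<eta>)\<close> of \<open>h_product\<close>, so that it
  combines with the derivative of \<open>V\<close> to a derivative of the vertical part of \<open>V\<close>.\<close>
lemma K_cov_h:
  assumes z: "z \<in> T" and V: "smooth_on T V"
  shows "K (\<phi> z) (cov h \<phi> V z X) = cov g p (\<lambda>z. K (\<phi> z) (V z)) z X
    + \<alpha> (p z) (D p z X) *\<^sub>R K (\<phi> z) (V z) + \<alpha> (p z) (fst (V z)) *\<^sub>R K (\<phi> z) (D \<phi> z X)"
proof -
  note x = p_S[OF z]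
  have "D (\<lambda>z. K (\<phi> z) (V z)) z X = D (\<lambda>w. K w (V z)) (\<phi> z) (D \<phi> z X) + K (\<phi> z) (D V z X)"
    by (rule D_linear_field[where L = K and S = TS])
      (auto intro: open_TS \<phi>_in z linear_K smooth_K smooth_intros \<phi>.diffT V smooth_\<phi>)
  then show ?thesis
    by (simp add: cov_def christoffel_h[OF \<phi>_in[OF z]] K_add[OF x] K_h_product D_p[OF z] D_fst)
qed

end

context mus_sasaki_domain
begin

text \<open>Only the direction of the tension field is of interest for \<open>X\<close>, and this is horizontal.
  Second derivatives on the base cancel by flatness, and derivatives of \<open>\<alpha>\<close> by \<open>D_\<alpha>_sym\<close>. The
  vertical part is linear in the horizontal part of \<open>Z\<close> and in the vertical part of \<open>Y\<close>,
  so it has trace zero.\<close>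
lemma curvature_h:
  assumes z: "z \<in> TS" and hor: "K z X = 0"
  shows "fst (curvature h z X Y Z) = - (g (fst z) (K z Y) (K z Z) / 2) *\<^sub>R
      (cov g (\<lambda>x. x) F (fst z) (fst X) - \<alpha> (fst z) (fst X) *\<^sub>R F (fst z))" (is ?fst)
    and "K z (curvature h z X Y Z) = (D (\<lambda>x. \<alpha> x (fst Z)) (fst z) (fst X)
      + \<alpha> (fst z) (fst X) * \<alpha> (fst z) (fst Z)
      - \<alpha> (fst z) (christoffel g (fst z) (fst X) (fst Z))) *\<^sub>R K z Y" (is ?K)
proof -
  interpret id: map_to_bundle S g f h TS "\<lambda>w. w"
    by unfold_locales (auto intro: open_TS smooth_intros)
  have x: "fst z \<in> S" using z by auto
  let ?x = "fst z" and ?N = "cov g fst" and ?nF = "cov g (\<lambda>x. x) F (fst z)"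
  \<comment> \<open>\<open>V A B\<close> is the derivative in the constant direction \<open>A\<close> of the constant field \<open>B\<close>.\<close>
  define V where "V A B w = cov h (\<lambda>w. w) (\<lambda>_. B) w A" for A B w
  have smV: "smooth_on TS (V A B)" for A B
    unfolding V_def by (rule h.self.smooth_cov; intro smooth_intros)
  have smK: "smooth_on TS (\<lambda>w. K w A)" for A
    by (intro smooth_K smooth_intros)
  have smKK: "smooth_on TS (\<lambda>w. g (fst w) (K w A) (K w B))" for A B
    by (intro fst.smooth_g_along smK)
  have smF: "smooth_on TS (\<lambda>w. F (fst w))"
    by (rule smooth_on_compose[OF open_TS open_S smooth_F smooth_on_fst_map[OF open_TS]]) auto
  have sm\<alpha>: "smooth_on TS (\<lambda>w. \<alpha> (fst w) u)" for u
    by (rule id.smooth_\<alpha>_along) (intro smooth_intros)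
  have smN: "smooth_on TS (\<lambda>w. ?N s w A)" if "smooth_on TS s" for s A
    by (intro fst.smooth_cov that smooth_intros)
  have fstV: "fst (V A B w) = ?N (\<lambda>_. fst B) w A + g (fst w) (K w A) (K w B) *\<^sub>R ((- 1 / 2) *\<^sub>R F (fst w))"
    if "w \<in> TS" for A B w
    using id.fst_cov_h[OF that smooth_on_const, of B A] by (simp add: V_def)
  have KV: "K w (V A B w) = ?N (\<lambda>w. K w B) w A + (\<alpha> (fst w) (fst A) *\<^sub>R K w B + \<alpha> (fst w) (fst B) *\<^sub>R K w A)"
    if "w \<in> TS" for A B w
    using id.K_cov_h[OF that smooth_on_const, of B A] by (simp add: V_def D_fst)
  have fstVV: "fst (cov h (\<lambda>w. w) (V A B) z A') =
      ?N (\<lambda>w. fst (V A B w)) z A' - (g ?x (K z A') (K z (V A B z)) / 2) *\<^sub>R F ?x" for A B A'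
    using id.fst_cov_h[OF z smV, of A B A'] by simp
  have KVV: "K z (cov h (\<lambda>w. w) (V A B) z A') = ?N (\<lambda>w. K w (V A B w)) z A'
      + \<alpha> ?x (fst A') *\<^sub>R K z (V A B z) + \<alpha> ?x (fst (V A B z)) *\<^sub>R K z A'" for A B A'
    using id.K_cov_h[OF z smV, of A B A'] by (simp add: D_fst)
  have NfstV: "?N (\<lambda>w. fst (V A B w)) z A' = ?N (\<lambda>w. ?N (\<lambda>_. fst B) w A) z A'
      + ((g ?x (?N (\<lambda>w. K w A) z A') (K z B) + g ?x (K z A) (?N (\<lambda>w. K w B) z A')) *\<^sub>R ((- 1 / 2) *\<^sub>R F ?x)
      + g ?x (K z A) (K z B) *\<^sub>R ((- 1 / 2) *\<^sub>R ?nF (fst A')))" for A B A'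
  proof -
    have s1: "smooth_on TS (\<lambda>w. ?N (\<lambda>_. fst B) w A)" by (intro smN smooth_intros)
    have s2: "smooth_on TS (\<lambda>w. (- 1 / 2) *\<^sub>R F (fst w))" by (intro smooth_intros open_TS smF)
    have "?N (\<lambda>w. fst (V A B w)) z A' =
        ?N (\<lambda>w. ?N (\<lambda>_. fst B) w A + g (fst w) (K w A) (K w B) *\<^sub>R ((- 1 / 2) *\<^sub>R F (fst w))) z A'"
      by (rule cov_cong_open[OF open_TS z fstV])
    also have "\<dots> = ?N (\<lambda>w. ?N (\<lambda>_. fst B) w A) z A'
        + (D (\<lambda>w. g (fst w) (K w A) (K w B)) z A' *\<^sub>R ((- 1 / 2) *\<^sub>R F ?x)
          + g ?x (K z A) (K z B) *\<^sub>R ((- 1 / 2) *\<^sub>R ?N (\<lambda>w. F (fst w)) z A'))"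
      by (subst fst.cov_add[OF z s1 smooth_on_scaleR[OF open_TS smKK s2]])
        (simp only: fst.cov_scaleR[OF z smKK s2] fst.cov_scale_const[OF z smF])
    finally show ?thesis
      by (simp only: fst.D_g_cov[OF z smK smK] fst.cov_compose[OF z smooth_F] D_fst)
  qed
  have NKV: "?N (\<lambda>w. K w (V A B w)) z A' = ?N (\<lambda>w. ?N (\<lambda>w. K w B) w A) z A'
      + ((D (\<lambda>x. \<alpha> x (fst A)) ?x (fst A') *\<^sub>R K z B + \<alpha> ?x (fst A) *\<^sub>R ?N (\<lambda>w. K w B) z A')
       + (D (\<lambda>x. \<alpha> x (fst B)) ?x (fst A') *\<^sub>R K z A + \<alpha> ?x (fst B) *\<^sub>R ?N (\<lambda>w. K w A) z A'))" for A B A'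
  proof -
    have D\<alpha>: "D (\<lambda>w. \<alpha> (fst w) u) z A' = D (\<lambda>x. \<alpha> x u) ?x (fst A')" for u
      by (subst D_compose[OF smooth_on_differentiable[OF smooth_on_fst_map[OF open_TS] z]
            smooth_on_differentiable[OF smooth_\<alpha>[OF smooth_on_const] x]]) (simp add: D_fst)
    have "?N (\<lambda>w. K w (V A B w)) z A' = ?N (\<lambda>w. ?N (\<lambda>w. K w B) w A
        + (\<alpha> (fst w) (fst A) *\<^sub>R K w B + \<alpha> (fst w) (fst B) *\<^sub>R K w A)) z A'"
      by (rule cov_cong_open[OF open_TS z KV])
    also have "\<dots> = ?N (\<lambda>w. ?N (\<lambda>w. K w B) w A) z A'
      + ((D (\<lambda>w. \<alpha> (fst w) (fst A)) z A' *\<^sub>R K z B + \<alpha> ?x (fst A) *\<^sub>R ?N (\<lambda>w. K w B) z A')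
       + (D (\<lambda>w. \<alpha> (fst w) (fst B)) z A' *\<^sub>R K z A + \<alpha> ?x (fst B) *\<^sub>R ?N (\<lambda>w. K w A) z A'))"
      by (subst fst.cov_add[OF z smN[OF smK]], intro smooth_intros open_TS sm\<alpha> smK,
          subst fst.cov_add[OF z], (intro smooth_intros open_TS sm\<alpha> smK)+)
        (simp only: fst.cov_scaleR[OF z sm\<alpha> smK])
    finally show ?thesis by (simp only: D\<alpha>)
  qed
  have R: "curvature h z X Y Z = cov h (\<lambda>w. w) (V Y Z) z X - cov h (\<lambda>w. w) (V X Z) z Y"
  proof -
    have "lie_bracket (\<lambda>_. X) (\<lambda>_. Y) z = 0"
      by (simp add: lie_bracket_def)
    then show ?thesis
      using linear_0[OF h.self.linear_cov[OF z smooth_on_const, of Z]]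
      by (simp add: curvature_def curvature_field_def levi_civita_cov[abs_def] V_def[abs_def])
  qed
  note comm = fst.cov_commute[OF z smooth_on_const, of "fst Z" Y X] fst.cov_commute[OF z smK, of Z Y X]
    cov_K_sym[OF z, of Y X] D_\<alpha>_sym[OF x, of "fst Y" "fst X"]
  show ?fst
    by (simp add: R fstVV NfstV KV[OF z] hor g_bilinear_simps[OF x] comm)
      (simp add: algebra_simps add_divide_distrib)
  have "?N (\<lambda>_. fst Z) z X = christoffel g ?x (fst X) (fst Z)"
    by (simp add: cov_def D_fst)
  then show ?K
    by (simp add: R KVV NKV fstV[OF z] KV[OF z] hor g_bilinear_simps[OF x] K_diff[OF x] comm)
      (simp add: algebra_simps)
qed

lemma smooth_\<alpha>_F: "smooth_on S (\<lambda>x. \<alpha> x (c *\<^sub>R F x))"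
  by (intro smooth_\<alpha> smooth_intros open_S smooth_F)

text \<open>The Hessian of \<open>f\<close>, which is \<open>g (\<nabla>\<^bsub>u\<^esub> F) v\<close>, is symmetric.\<close>
lemma grad_norm_square:
  assumes x: "x \<in> S"
  shows "grad g (\<lambda>z. (norm_of g z (F z))\<^sup>2) x = 2 *\<^sub>R cov g (\<lambda>x. x) F x (F x)"
proof (rule g_eqI[OF x])
  fix Z
  let ?n = "cov g (\<lambda>x. x) F x"
  have sm: "smooth_on S (\<lambda>z. g z (F z) (F z))" by (intro smooth_g_fields smooth_F)
  have eq: "(norm_of g z (F z))\<^sup>2 = g z (F z) (F z)" if "z \<in> S" for z
  proof -
    have "g z (F z) (F z) \<ge> 0"
      using g_pos[OF that, of "F z"] g_bilinear_simps[OF that] by (cases "F z = 0") auto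
    then show ?thesis by (simp add: norm_of_def)
  qed
  have d: "(\<lambda>z. (norm_of g z (F z))\<^sup>2) differentiable (at x)"
    using differentiable_cong_open[where F = "\<lambda>z. (norm_of g z (F z))\<^sup>2", OF open_S x eq]
      smooth_on_differentiable[OF sm x] by blast
  have symm: "g x (?n u) v = g x (?n v) u" for u v
  proof -
    have "D (\<lambda>z. g z (F z) v) x u = g x (?n u) v + g x (F x) (christoffel g x u v)" for u v
      using self.D_g_cov[OF x smooth_F smooth_on_const, of v u] by (simp add: cov_def)
    moreover have "D (\<lambda>z. g z (F z) v) x u = D (\<lambda>z. D f z v) x u" for u v
      by (subst D_cong_open[OF open_S x]) (auto simp: g_F)
    ultimately have *: "D (\<lambda>z. D f z v) x u = g x (?n u) v + g x (F x) (christoffel g x u v)" for u v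
      by simp
    show ?thesis
      using *[of u v] *[of v u] symmetric_second_derivative[OF open_S x smooth_f, of u v]
        christoffel_sym[OF x, of u v] by simp
  qed
  have "g x (grad g (\<lambda>z. (norm_of g z (F z))\<^sup>2) x) Z = D (\<lambda>z. (norm_of g z (F z))\<^sup>2) x Z"
    by (rule g_grad[OF x d])
  also have "\<dots> = D (\<lambda>z. g z (F z) (F z)) x Z"
    by (subst D_cong_open[where F = "\<lambda>z. (norm_of g z (F z))\<^sup>2", OF open_S x eq]) auto
  also have "\<dots> = g x (?n Z) (F x) + g x (F x) (?n Z)"
    by (rule self.D_g_cov[OF x smooth_F smooth_F])
  also have "\<dots> = 2 * g x (?n (F x)) Z"
    using symm[of Z "F x"] g_sym[OF x, of "F x" "?n Z"] by simp
  finally show "g x (grad g (\<lambda>z. (norm_of g z (F z))\<^sup>2) x) Z = g x (2 *\<^sub>R ?n (F x)) Z"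
    by (simp add: g_bilinear_simps[OF x])
qed

end

section \<open>Tension and bitension of the identity in a pair of charts\<close>

text \<open>The identity of the tangent bundle, from a chart of the source, with the Sasaki metric \<open>h'\<close>, to
  a chart of the target, with the Mus-Sasaki metric \<open>h\<close>; \<open>\<psi>\<close> is the transition map of the base.
  The Sasaki metric is the Mus-Sasaki metric of the constant function 1.\<close>
locale sasaki_to_mus_sasaki = mus_sasaki_domain S g f h
    + src: mus_sasaki_domain S' g' "\<lambda>_. 1" h'
    + iso: isometry_of_domains S g S' g' \<psi>
  for S :: "'e::euclidean_space set" and g f h and S' :: "'e set" and g' h' and \<psi> :: "'e \<Rightarrow> 'e" +
  fixes \<phi> :: "'e \<times> 'e \<Rightarrow> 'e \<times> 'e"
  assumes \<phi>_eq: "fst z \<in> S' \<Longrightarrow> \<phi> z = (\<psi> (fst z), D \<psi> (fst z) (snd z))"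
begin

lemma smooth_D\<psi>_along:
  assumes "open T" "T \<subseteq> src.TS" "smooth_on T u"
  shows "smooth_on T (\<lambda>z. D \<psi> (fst z) (u z))"
  using assms by (intro smooth_on_linear_field[OF assms(1) src.open_S
      linear_D[OF smooth_on_differentiable[OF iso.smooth_p]] smooth_on_D[OF iso.smooth_p]]
      smooth_on_fst_map) auto

sublocale map_to_bundle S g f h src.TS \<phi>
proof
  show "open src.TS" by (rule src.open_TS)
  show "\<phi> z \<in> TS" if "z \<in> src.TS" for z
    using that iso.p_in by (auto simp: \<phi>_eq)
  have "smooth_on src.TS (\<lambda>z. (\<psi> (fst z), D \<psi> (fst z) (snd z)))"
    using src.open_TS
    by (intro smooth_intros smooth_D\<psi>_along smooth_on_snd_map smooth_on_fst_map
        smooth_on_compose[OF src.open_TS src.open_S iso.smooth_p]) auto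
  then show "smooth_on src.TS \<phi>"
    by (subst smooth_on_cong[OF src.open_TS]) (auto simp: \<phi>_eq)
qed

lemma linear_D\<psi>: "x \<in> S' \<Longrightarrow> linear (D \<psi> x)"
  by (rule linear_D[OF smooth_on_differentiable[OF iso.smooth_p]])

lemma D_p_eq:
  assumes z: "z \<in> src.TS"
  shows "D p z X = D \<psi> (fst z) (fst X)"
proof -
  have x: "fst z \<in> S'" using z by auto
  have "D p z X = D (\<lambda>z. \<psi> (fst z)) z X"
    by (subst D_cong_open[OF src.open_TS z]) (auto simp: \<phi>_eq)
  also have "\<dots> = D \<psi> (fst z) (fst X)"
    by (subst D_compose) (simp_all add: D_fst iso.diffT[OF iso.smooth_p x]
        smooth_on_differentiable[OF smooth_on_fst_map[OF src.open_TS] z])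
  finally show ?thesis .
qed

text \<open>The derivative of \<open>\<phi>\<close> maps vertical parts by \<open>D \<psi>\<close>: the second derivative of \<open>\<psi>\<close> that occurs
  in \<open>D \<phi>\<close> is absorbed by the transformation rule \<open>cov_D\<close>.\<close>
lemma K_D_\<phi>:
  assumes z: "z \<in> src.TS"
  shows "K (\<phi> z) (D \<phi> z X) = D \<psi> (fst z) (src.K z X)"
proof -
  have x: "fst z \<in> S'" using z by auto
  have "snd (D \<phi> z X) = D (\<lambda>z. snd (\<phi> z)) z X"
    by (rule D_bounded_linear[OF bounded_linear_snd \<phi>.diffT[OF smooth_\<phi> z], symmetric])
  also have "\<dots> = D (\<lambda>z. D \<psi> (fst z) (snd z)) z X"
    by (subst D_cong_open[OF src.open_TS z]) (auto simp: \<phi>_eq)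
  also have "\<dots> = D (\<lambda>x. D \<psi> x (snd z)) (fst z) (D fst z X) + D \<psi> (fst z) (D snd z X)"
    by (rule D_linear_field[where L = "D \<psi>" and S = S'])
      (auto intro!: smooth_on_differentiable[OF _ z] smooth_on_fst_map smooth_on_snd_map src.open_TS
        src.open_S linear_D\<psi> smooth_on_D[OF iso.smooth_p] x)
  finally have "K (\<phi> z) (D \<phi> z X) =
      cov g \<psi> (\<lambda>x. D \<psi> x (snd z)) (fst z) (fst X) + D \<psi> (fst z) (snd X)"
    by (simp add: K_def D_fst D_snd cov_def \<phi>_eq[OF x] D_p[OF z, symmetric] D_p_eq[OF z] add_ac)
  also have "\<dots> = D \<psi> (fst z) (src.K z X)"
    by (simp add: iso.cov_D[OF x] src.K_def linear_add[OF linear_D\<psi>[OF x]] add_ac)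
  finally show ?thesis .
qed

lemma orthonormal_push:
  assumes z: "z \<in> src.TS" and E: "orthonormal_wrt (h' z) E"
  shows "orthonormal_wrt (\<lambda>\<xi> \<eta>. g (p z) (fst \<xi>) (fst \<eta>) + g (p z) (snd \<xi>) (snd \<eta>))
    (\<lambda>i. (D p z (E i), K (\<phi> z) (D \<phi> z (E i))))"
proof -
  have x: "fst z \<in> S'" using z by auto
  have "p z = \<psi> (fst z)" by (simp add: \<phi>_eq[OF x])
  then have "h' z \<xi> \<eta> = g (p z) (D p z \<xi>) (D p z \<eta>) + g (p z) (K (\<phi> z) (D \<phi> z \<xi>)) (K (\<phi> z) (D \<phi> z \<eta>))"
    for \<xi> \<eta> by (simp add: src.h_K[OF x] D_p_eq[OF z] K_D_\<phi>[OF z] iso.isometry[OF x])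
  then show ?thesis using E by (simp add: orthonormal_wrt_def)
qed

lemma src_\<alpha>: "src.\<alpha> x u = 0"
  by (simp add: src.\<alpha>_def)

lemma src_F: "x \<in> S' \<Longrightarrow> grad g' (\<lambda>_. 1) x = 0"
  by (rule src.g_eqI) (auto simp: src.g_F src.g_bilinear_simps)

text \<open>For the constant function 1 both \<open>\<alpha>\<close> and the gradient vanish, and the two components decouple.\<close>
lemma levi_civita_src:
  assumes T: "open T" "T \<subseteq> src.TS" and z: "z \<in> T" and X: "smooth_on T X"
  shows "fst (levi_civita h' X X z) = cov g' fst (\<lambda>z. fst (X z)) z (X z)"
    and "src.K z (levi_civita h' X X z) = cov g' fst (\<lambda>z. src.K z (X z)) z (X z)"
proof -
  interpret T: map_to_bundle S' g' "\<lambda>_. 1" h' T "\<lambda>z. z"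
    using T by unfold_locales (auto intro: smooth_intros)
  have x: "fst z \<in> S'" using z T by auto
  show "fst (levi_civita h' X X z) = cov g' fst (\<lambda>z. fst (X z)) z (X z)"
    using T.fst_cov_h[OF z X, of "X z"] by (simp add: levi_civita_cov src_F[OF x])
  show "src.K z (levi_civita h' X X z) = cov g' fst (\<lambda>z. src.K z (X z)) z (X z)"
    using T.K_cov_h[OF z X, of "X z"] by (simp add: levi_civita_cov src_\<alpha>)
qed

lemma cov_push_fst:
  assumes T: "open T" "T \<subseteq> src.TS" and z: "z \<in> T" and s: "smooth_on T s"
  shows "cov g p (\<lambda>z. D \<psi> (fst z) (s z)) z X = D \<psi> (fst z) (cov g' fst s z X)"
proof -
  have "D p z = D (\<lambda>z. \<psi> (fst z)) z" "p z = \<psi> (fst z)"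
    using T z by (auto simp: \<phi>_eq intro!: D_cong_open[OF T(1) z])
  then have "cov g p (\<lambda>z. D \<psi> (fst z) (s z)) z X = cov g (\<lambda>z. \<psi> (fst z)) (\<lambda>z. D \<psi> (fst z) (s z)) z X"
    by (simp add: cov_def)
  also have "\<dots> = D \<psi> (fst z) (cov g' fst s z X)"
    using T by (intro iso.cov_push[OF T(1) smooth_on_fst_map[OF T(1)] _ z s]) auto
  finally show ?thesis .
qed

text \<open>Since \<open>D \<psi>\<close> commutes with covariant derivatives, the correction terms \<open>\<nabla>\<^bsub>X\<^esub> X\<close> of the
  source have the components of the corresponding derivatives in the target, without the terms
  that come from \<open>f\<close>.\<close>
lemma push_levi_civita:
  assumes T: "open T" "T \<subseteq> src.TS" and z: "z \<in> T" and X: "smooth_on T X"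
  shows "D p z (levi_civita h' X X z) = cov g p (\<lambda>z. D p z (X z)) z (X z)"
    and "K (\<phi> z) (D \<phi> z (levi_civita h' X X z)) = cov g p (\<lambda>z. K (\<phi> z) (D \<phi> z (X z))) z (X z)"
proof -
  have z': "z \<in> src.TS" using T z by auto
  interpret T: map_to_bundle S' g' "\<lambda>_. 1" h' T "\<lambda>z. z"
    using T by unfold_locales (auto intro: smooth_intros)
  have sm: "smooth_on T (\<lambda>z. fst (X z))" "smooth_on T (\<lambda>z. src.K z (X z))"
    by (intro smooth_intros T.smooth_K_along T X)+
  have "cov g p (\<lambda>z. D p z (X z)) z (X z) = cov g p (\<lambda>z. D \<psi> (fst z) (fst (X z))) z (X z)"
    using T by (intro cov_cong_open[OF T(1) z] D_p_eq) auto
  also have "\<dots> = D p z (levi_civita h' X X z)"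
    by (simp add: cov_push_fst[OF T z sm(1)] D_p_eq[OF z'] levi_civita_src[OF T z X])
  finally show "D p z (levi_civita h' X X z) = cov g p (\<lambda>z. D p z (X z)) z (X z)" by simp
  have "cov g p (\<lambda>z. K (\<phi> z) (D \<phi> z (X z))) z (X z) = cov g p (\<lambda>z. D \<psi> (fst z) (src.K z (X z))) z (X z)"
    using T by (intro cov_cong_open[OF T(1) z] K_D_\<phi>) auto
  also have "\<dots> = K (\<phi> z) (D \<phi> z (levi_civita h' X X z))"
    by (simp add: cov_push_fst[OF T z sm(2)] K_D_\<phi>[OF z'] levi_civita_src[OF T z X])
  finally show "K (\<phi> z) (D \<phi> z (levi_civita h' X X z)) = cov g p (\<lambda>z. K (\<phi> z) (D \<phi> z (X z))) z (X z)"
    by simp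
qed

text \<open>The pushed frame is orthonormal for \<open>g \<oplus> g\<close> in the components \<open>fst\<close>, \<open>K\<close>, so horizontal and
  vertical parts each contribute a full trace over the base, and mixed terms contribute nothing.\<close>
lemma trace_pushed_frame:
  fixes E :: "nat \<Rightarrow> 'e \<times> 'e" and Q :: "'e \<Rightarrow> 'e \<Rightarrow> 'v::real_vector"
  assumes z: "z \<in> src.TS" and E: "orthonormal_wrt (h' z) E"
  shows "(\<Sum>i<DIM('e \<times> 'e). g (p z) (K (\<phi> z) (D \<phi> z (E i))) (K (\<phi> z) (D \<phi> z (E i)))) = real DIM('e)"
    and "bilinear Q \<Longrightarrow> (\<Sum>i<DIM('e \<times> 'e). Q (D p z (E i)) (D p z (E i))) =
      (\<Sum>i<DIM('e). Q (frame_at g (p z) i (p z)) (frame_at g (p z) i (p z)))"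
    and "bilinear Q \<Longrightarrow> (\<Sum>i<DIM('e \<times> 'e). Q (D p z (E i)) (K (\<phi> z) (D \<phi> z (E i)))) = 0"
proof -
  note x = p_S[OF z]
  note e = frame_at_orthonormal[OF x] and ab = orthonormal_push[OF z E]
  note tr = trace_product_components[OF bilinear_g[OF x] g_sym[OF x] _ e ab, unfolded fst_conv snd_conv]
  show "(\<Sum>i<DIM('e \<times> 'e). g (p z) (K (\<phi> z) (D \<phi> z (E i))) (K (\<phi> z) (D \<phi> z (E i)))) = real DIM('e)"
    using tr(2)[OF bilinear_g[OF x]] e by (simp add: orthonormal_wrt_def)
  show "bilinear Q \<Longrightarrow> (\<Sum>i<DIM('e \<times> 'e). Q (D p z (E i)) (D p z (E i))) =
      (\<Sum>i<DIM('e). Q (frame_at g (p z) i (p z)) (frame_at g (p z) i (p z)))"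
    by (rule tr(1))
  show "bilinear Q \<Longrightarrow> (\<Sum>i<DIM('e \<times> 'e). Q (D p z (E i)) (K (\<phi> z) (D \<phi> z (E i)))) = 0"
    by (rule tr(3))
qed

lemma smooth_frame_nbhd:
  assumes z: "z \<in> src.TS"
  obtains T where "open T" "T \<subseteq> src.TS" "z \<in> T"
    "\<And>i. i < DIM('e \<times> 'e) \<Longrightarrow> smooth_on T (frame_at h' z i)"
proof -
  obtain U where U: "z \<in> U" "orthonormal_frame h' U (frame_at h' z)"
    by (rule src.h.frame_at[OF z])
  show ?thesis
  proof (rule that)
    show "open (U \<inter> src.TS)" using U src.open_TS by (auto simp: orthonormal_frame_def)
    show "smooth_on (U \<inter> src.TS) (frame_at h' z i)" if "i < DIM('e \<times> 'e)" for i
      using U that smooth_on_subset unfolding orthonormal_frame_def by blast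
  qed (use U z in auto)
qed

lemma map_to_bundle_subset: "open T \<Longrightarrow> T \<subseteq> src.TS \<Longrightarrow> map_to_bundle S g f h T \<phi>"
  by unfold_locales (auto intro: smooth_on_subset[OF smooth_\<phi>] \<phi>_in)

text \<open>The base derivatives of the pushed field cancel against the correction term; what is left is
  the tensor by which the connection of \<open>h\<close> differs from that of the base.\<close>
lemma tension_summand:
  assumes T: "open T" "T \<subseteq> src.TS" and z: "z \<in> T" and X: "smooth_on T X"
  defines "s \<equiv> pullback_connection h \<phi> X (\<lambda>z. D \<phi> z (X z)) z - D \<phi> z (levi_civita h' X X z)"
    and "a \<equiv> D p z (X z)" and "b \<equiv> K (\<phi> z) (D \<phi> z (X z))"
  shows "fst s = g (p z) b b *\<^sub>R ((- 1 / 2) *\<^sub>R F (p z))" and "K (\<phi> z) s = (2 * \<alpha> (p z) a) *\<^sub>R b"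
proof -
  interpret T: map_to_bundle S g f h T \<phi> by (rule map_to_bundle_subset[OF T])
  have z': "z \<in> src.TS" using T z by auto
  have V: "smooth_on T (\<lambda>z. D \<phi> z (X z))"
    by (rule smooth_on_D_field[OF T(1) T.smooth_\<phi> X])
  have "cov g p (\<lambda>z. fst (D \<phi> z (X z))) z (X z) = cov g p (\<lambda>z. D p z (X z)) z (X z)"
    by (rule cov_cong_open[OF T(1) z]) (simp add: T.D_p)
  then show "fst s = g (p z) b b *\<^sub>R ((- 1 / 2) *\<^sub>R F (p z))"
    by (simp add: s_def b_def pullback_connection_cov T.fst_cov_h[OF z V] push_levi_civita[OF T z X]
        D_p[OF z', symmetric])
  show "K (\<phi> z) s = (2 * \<alpha> (p z) a) *\<^sub>R b"
    by (simp add: s_def a_def b_def pullback_connection_cov K_diff[OF p_S[OF z']] T.K_cov_h[OF z V]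
        push_levi_civita[OF T z X] D_p[OF z'] scaleR_add_left[symmetric])
qed

lemma tension_components:
  assumes z: "z \<in> src.TS"
  shows "fst (tension h' h \<phi> z) = (- real DIM('e) / 2) *\<^sub>R F (p z)"
    and "K (\<phi> z) (tension h' h \<phi> z) = 0"
proof -
  note x = p_S[OF z] and on = src.h.frame_at_orthonormal[OF z]
  obtain T where T: "open T" "T \<subseteq> src.TS" "z \<in> T"
    and E: "\<And>i. i < DIM('e \<times> 'e) \<Longrightarrow> smooth_on T (frame_at h' z i)"
    using smooth_frame_nbhd[OF z] by blast
  note s = tension_summand[OF T E]
  have "fst (tension h' h \<phi> z) = (\<Sum>i<DIM('e \<times> 'e). g (p z) (K (\<phi> z) (D \<phi> z (frame_at h' z i z)))
      (K (\<phi> z) (D \<phi> z (frame_at h' z i z)))) *\<^sub>R ((- 1 / 2) *\<^sub>R F (p z))"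
    unfolding tension_def Let_def fst_sum scaleR_sum_left
    by (intro sum.cong refl s(1)) simp
  also have "\<dots> = (- real DIM('e) / 2) *\<^sub>R F (p z)"
    unfolding trace_pushed_frame(1)[OF z on] by simp
  finally show "fst (tension h' h \<phi> z) = (- real DIM('e) / 2) *\<^sub>R F (p z)" .
  have "K (\<phi> z) (tension h' h \<phi> z) = (\<Sum>i<DIM('e \<times> 'e). (2 * \<alpha> (p z) (D p z (frame_at h' z i z)))
      *\<^sub>R K (\<phi> z) (D \<phi> z (frame_at h' z i z)))"
    unfolding tension_def Let_def K_sum[OF x]
    by (intro sum.cong refl s(2)) simp
  also have "\<dots> = 0"
    by (rule trace_pushed_frame(3)[OF z on, of "\<lambda>u v. (2 * \<alpha> (p z) u) *\<^sub>R v"], unfold bilinear_def,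
        intro conjI allI linearI) (simp_all add: \<alpha>_add[OF x] \<alpha>_scale[OF x] algebra_simps)
  finally show "K (\<phi> z) (tension h' h \<phi> z) = 0" .
qed

text \<open>The tension field chooses a new frame at every point; only its formula in components shows that
  it is smooth.\<close>
lemma smooth_tension: "smooth_on src.TS (tension h' h \<phi>)"
proof (subst smooth_on_cong[OF src.open_TS])
  let ?c = "- real DIM('e) / 2"
  have F: "smooth_on src.TS (\<lambda>z. F (p z))"
    by (rule smooth_on_compose[OF src.open_TS open_S smooth_F p.smooth_p p.p_in])
  show "smooth_on src.TS (\<lambda>z. (?c *\<^sub>R F (p z), 0 - christoffel g (p z) (?c *\<^sub>R F (p z)) (snd (\<phi> z))))"
    by (intro smooth_intros p.smooth_christoffel_along src.open_TS F smooth_\<phi>)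
  show "tension h' h \<phi> z = (?c *\<^sub>R F (p z), 0 - christoffel g (p z) (?c *\<^sub>R F (p z)) (snd (\<phi> z)))"
    if "z \<in> src.TS" for z
    by (rule components_eqI[of _ _ "\<phi> z"])
      (simp_all only: fst_conv K_vertical_part tension_components[OF that])
qed

text \<open>The tension field is \<open>c F\<close> in horizontal direction, and \<open>t\<close> is the derivative of \<open>log (sqrt f)\<close>
  along it. Its first derivative has the vertical part \<open>t b\<close>, and deriving this a second time leads
  back to the term with \<open>F\<close> in the horizontal part.\<close>
lemma rough_laplacian_summand:
  fixes X :: "'e \<times> 'e \<Rightarrow> 'e \<times> 'e"
  assumes T: "open T" "T \<subseteq> src.TS" and z: "z \<in> T" and X: "smooth_on T X"
  defines "c \<equiv> - real DIM('e) / 2"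
  defines "s \<equiv> pullback_connection h \<phi> X (pullback_connection h \<phi> X (tension h' h \<phi>)) z
      - pullback_connection h \<phi> (levi_civita h' X X) (tension h' h \<phi>) z"
    and "a \<equiv> D p z (X z)" and "b \<equiv> K (\<phi> z) (D \<phi> z (X z))"
    and "t \<equiv> \<alpha> (p z) (c *\<^sub>R F (p z))"
  shows "fst s = c *\<^sub>R hess F (p z) a a - (t / 2 * g (p z) b b) *\<^sub>R F (p z)"
    and "K (\<phi> z) s = (D (\<lambda>x. \<alpha> x (c *\<^sub>R F x)) (p z) a + \<alpha> (p z) a * t
      + \<alpha> (p z) (c *\<^sub>R cov g (\<lambda>x. x) F (p z) a)) *\<^sub>R b"
proof -
  interpret T: map_to_bundle S g f h T \<phi> by (rule map_to_bundle_subset[OF T])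
  have z': "z \<in> src.TS" using T z by auto
  note x = p_S[OF z']
  let ?\<tau> = "tension h' h \<phi>" and ?Y = "levi_civita h' X X z" and ?T = "\<lambda>z. c *\<^sub>R F (p z)"
    and ?b = "\<lambda>z. K (\<phi> z) (D \<phi> z (X z))"
  let ?P = "\<lambda>w. cov h \<phi> ?\<tau> w (X w)"
  have \<tau>: "fst (?\<tau> w) = ?T w" "K (\<phi> w) (?\<tau> w) = 0" if "w \<in> T" for w
    using tension_components[of w] that T by (auto simp: c_def)
  have sm\<tau>: "smooth_on T ?\<tau>" by (rule smooth_on_subset[OF smooth_tension T(2)])
  have smP: "smooth_on T ?P" by (rule T.\<phi>.smooth_cov[OF sm\<tau> X])
  have smcF: "smooth_on S (\<lambda>x. c *\<^sub>R F x)" by (intro smooth_intros open_S smooth_F)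
  have smT: "smooth_on T ?T"
    by (rule smooth_on_compose[OF T(1) open_S smcF T.p.smooth_p T.p.p_in])
  have smb: "smooth_on T ?b"
    by (rule T.smooth_K_along[OF smooth_on_D_field[OF T(1) T.smooth_\<phi> X]])
  have sm\<alpha>: "smooth_on T (\<lambda>w. \<alpha> (p w) (?T w))" by (rule T.smooth_\<alpha>_along[OF smT])
  have cov\<tau>: "cov g p (\<lambda>w. fst (?\<tau> w)) w Z = cov g p ?T w Z"
    "cov g p (\<lambda>w. K (\<phi> w) (?\<tau> w)) w Z = 0" if "w \<in> T" for w Z
    using cov_cong_open[OF T(1) that, of "\<lambda>w. fst (?\<tau> w)" ?T]
      cov_cong_open[OF T(1) that, of "\<lambda>w. K (\<phi> w) (?\<tau> w)" "\<lambda>_. 0"]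
    by (simp_all add: \<tau> T.p.cov_zero[OF that])
  have covh: "fst (cov h \<phi> ?\<tau> w Z) = cov g p ?T w Z"
    "K (\<phi> w) (cov h \<phi> ?\<tau> w Z) = \<alpha> (p w) (?T w) *\<^sub>R K (\<phi> w) (D \<phi> w Z)" if "w \<in> T" for w Z
    using T.fst_cov_h[OF that sm\<tau>, of Z] T.K_cov_h[OF that sm\<tau>, of Z] \<tau>[OF that] cov\<tau>[OF that]
    by (simp_all add: g_bilinear_simps[OF T.p_S[OF that]])
  have s: "s = cov h \<phi> ?P z (X z) - cov h \<phi> ?\<tau> z ?Y"
    by (simp add: s_def pullback_connection_cov[abs_def])
  have 1: "cov g p (\<lambda>w. fst (?P w)) z (X z) = cov g p (\<lambda>w. cov g p ?T w (X w)) z (X z)"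
    by (rule cov_cong_open[OF T(1) z covh(1)])
  have hess: "cov g p (\<lambda>w. cov g p ?T w (X w)) z (X z) - cov g p ?T z ?Y = c *\<^sub>R hess F (p z) a a"
  proof -
    have smFp: "smooth_on T (\<lambda>z. F (p z))"
      by (rule smooth_on_compose[OF T(1) open_S smooth_F T.p.smooth_p T.p.p_in])
    have smD: "smooth_on T (\<lambda>w. cov g p (\<lambda>z. F (p z)) w (X w))"
      by (rule T.p.smooth_cov[OF smFp X])
    have "cov g p (\<lambda>w. cov g p ?T w (X w)) z (X z)
        = cov g p (\<lambda>w. c *\<^sub>R cov g p (\<lambda>z. F (p z)) w (X w)) z (X z)"
      by (rule cov_cong_open[OF T(1) z]) (rule T.p.cov_scale_const[OF _ smFp])
    then show ?thesis
      using T.p.cov_cov_compose[OF z smooth_F X push_levi_civita(1)[OF T z X]]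
      by (simp add: T.p.cov_scale_const[OF z smD] T.p.cov_scale_const[OF z smFp] a_def
          scaleR_diff_right[symmetric])
  qed
  show "fst s = c *\<^sub>R hess F (p z) a a - (t / 2 * g (p z) b b) *\<^sub>R F (p z)"
    using hess
    by (simp add: s T.fst_cov_h[OF z smP] covh[OF z] 1 t_def b_def g_bilinear_simps[OF x] algebra_simps)
  have 2: "cov g p (\<lambda>w. K (\<phi> w) (?P w)) z (X z) =
      D (\<lambda>x. \<alpha> x (c *\<^sub>R F x)) (p z) a *\<^sub>R b + t *\<^sub>R cov g p ?b z (X z)"
  proof -
    have "cov g p (\<lambda>w. K (\<phi> w) (?P w)) z (X z) = cov g p (\<lambda>w. \<alpha> (p w) (?T w) *\<^sub>R ?b w) z (X z)"
      by (rule cov_cong_open[OF T(1) z covh(2)])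
    also have "\<dots> = D (\<lambda>w. \<alpha> (p w) (?T w)) z (X z) *\<^sub>R b + t *\<^sub>R cov g p ?b z (X z)"
      by (simp add: T.p.cov_scaleR[OF z sm\<alpha> smb] b_def t_def)
    also have "D (\<lambda>w. \<alpha> (p w) (?T w)) z (X z) = D (\<lambda>x. \<alpha> x (c *\<^sub>R F x)) (p z) a"
      unfolding a_def
      by (rule D_compose[OF T.p.diffT[OF T.p.smooth_p z] smooth_on_differentiable[OF smooth_\<alpha>_F x]])
    finally show ?thesis .
  qed
  have 3: "cov g p ?T z (X z) = c *\<^sub>R cov g (\<lambda>x. x) F (p z) a"
    by (simp add: T.p.cov_compose[OF z smcF] self.cov_scale_const[OF x smooth_F] a_def)
  show "K (\<phi> z) s = (D (\<lambda>x. \<alpha> x (c *\<^sub>R F x)) (p z) a + \<alpha> (p z) a * t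
      + \<alpha> (p z) (c *\<^sub>R cov g (\<lambda>x. x) F (p z) a)) *\<^sub>R b"
    by (simp add: s K_diff[OF x] T.K_cov_h[OF z smP] covh[OF z] 2 3 push_levi_civita(2)[OF T z X]
        t_def a_def b_def D_p[OF z'] algebra_simps)
qed

text \<open>The terms with \<open>\<alpha> T F\<close> from the curvature and from the second derivatives cancel.\<close>
lemma bitension_components:
  assumes z: "z \<in> src.TS"
  defines "m \<equiv> real DIM('e)"
  shows "fst (bitension h' h \<phi> z) = (m / 2) *\<^sub>R (trace_nabla2 g F (p z)
      - (m / 2) *\<^sub>R cov g (\<lambda>x. x) F (p z) (F (p z)))"
    and "K (\<phi> z) (bitension h' h \<phi> z) = 0"
proof -
  note x = p_S[OF z] and on = src.h.frame_at_orthonormal[OF z]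
  let ?E = "frame_at h' z" and ?\<tau> = "tension h' h \<phi>"
  let ?a = "\<lambda>i. D p z (?E i z)" and ?b = "\<lambda>i. K (\<phi> z) (D \<phi> z (?E i z))" and ?n = "DIM('e \<times> 'e)"
    and ?nF = "cov g (\<lambda>x. x) F (p z)" and ?F = "F (p z)"
  define c where "c = - m / 2"
  define T where "T = c *\<^sub>R ?F"
  obtain U where U: "open U" "U \<subseteq> src.TS" "z \<in> U"
    and E: "\<And>i. i < ?n \<Longrightarrow> smooth_on U (?E i)"
    using smooth_frame_nbhd[OF z] by blast
  note L = rough_laplacian_summand[OF U E, folded m_def, folded c_def, folded T_def]
  have \<tau>: "fst (?\<tau> z) = T" "K (\<phi> z) (?\<tau> z) = 0"
    using tension_components[OF z] by (simp_all add: T_def c_def m_def)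
  note R = curvature_h[OF \<phi>_in[OF z] \<tau>(2), unfolded \<tau>(1)]
  note tr = trace_pushed_frame[OF z on]
  have "fst (\<Sum>i<?n. curvature h (\<phi> z) (?\<tau> z) (D \<phi> z (?E i z)) (D \<phi> z (?E i z))) =
      (\<Sum>i<?n. g (p z) (?b i) (?b i)) *\<^sub>R ((- 1 / 2) *\<^sub>R (?nF T - \<alpha> (p z) T *\<^sub>R ?F))"
    unfolding fst_sum R(1) scaleR_sum_left by (intro sum.cong refl) simp
  then have fstR: "fst (\<Sum>i<?n. curvature h (\<phi> z) (?\<tau> z) (D \<phi> z (?E i z)) (D \<phi> z (?E i z))) =
      m *\<^sub>R ((- 1 / 2) *\<^sub>R (?nF T - \<alpha> (p z) T *\<^sub>R ?F))"
    unfolding tr(1) m_def .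
  have KR: "K (\<phi> z) (\<Sum>i<?n. curvature h (\<phi> z) (?\<tau> z) (D \<phi> z (?E i z)) (D \<phi> z (?E i z))) = 0"
  proof -
    have "bilinear (\<lambda>u v. (D (\<lambda>x. \<alpha> x u) (p z) T + \<alpha> (p z) T * \<alpha> (p z) u
        - \<alpha> (p z) (christoffel g (p z) T u)) *\<^sub>R v)"
      unfolding bilinear_def
      by (intro conjI allI linearI) (simp_all add: \<alpha>_add[OF x] \<alpha>_scale[OF x] linear_add[OF linear_D_\<alpha>[OF x]]
          linear_scale[OF linear_D_\<alpha>[OF x]] christoffel_bilinear_simps[OF x] algebra_simps)
    from tr(3)[OF this] show ?thesis
      unfolding K_sum[OF x] R(2) D_p[OF z, symmetric] .
  qed
  let ?s = "\<lambda>i. pullback_connection h \<phi> (?E i) (pullback_connection h \<phi> (?E i) ?\<tau>) z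
      - pullback_connection h \<phi> (levi_civita h' (?E i) (?E i)) ?\<tau> z"
  have "fst (\<Sum>i<?n. ?s i) =
      c *\<^sub>R (\<Sum>i<?n. hess F (p z) (?a i) (?a i)) - (\<Sum>i<?n. g (p z) (?b i) (?b i)) *\<^sub>R ((\<alpha> (p z) T / 2) *\<^sub>R ?F)"
    unfolding fst_sum scaleR_sum_left scaleR_sum_right sum_subtractf[symmetric]
    using L(1) by (intro sum.cong refl) (simp add: mult.commute)
  also have "(\<Sum>i<?n. hess F (p z) (?a i) (?a i)) = trace_nabla2 g F (p z)"
    unfolding tr(2)[OF bilinear_hess[OF x smooth_F]]
    by (rule trace_nabla2_eq[OF x smooth_F frame_at_orthonormal[OF x], symmetric])
  finally have fstL: "fst (\<Sum>i<?n. ?s i) = c *\<^sub>R trace_nabla2 g F (p z) - m *\<^sub>R ((\<alpha> (p z) T / 2) *\<^sub>R ?F)"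
    unfolding tr(1) m_def .
  have KL: "K (\<phi> z) (\<Sum>i<?n. ?s i) = 0"
  proof -
    note lin = linear_D[OF smooth_on_differentiable[OF smooth_\<alpha>_F x], of c] self.linear_cov[OF x smooth_F]
    have "bilinear (\<lambda>u v. (D (\<lambda>x. \<alpha> x (c *\<^sub>R F x)) (p z) u + \<alpha> (p z) u * \<alpha> (p z) T
      + \<alpha> (p z) (c *\<^sub>R ?nF u)) *\<^sub>R v)"
      unfolding bilinear_def
      by (intro conjI allI linearI) (simp_all add: \<alpha>_add[OF x] \<alpha>_scale[OF x] linear_add[OF lin(1)]
        linear_scale[OF lin(1)] linear_add[OF lin(2)] linear_scale[OF lin(2)] algebra_simps)
    from tr(3)[OF this] show ?thesis
      unfolding K_sum[OF x] using L(2) by simp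
  qed
  have nFT: "?nF T = c *\<^sub>R ?nF ?F"
    by (simp add: T_def linear_scale[OF self.linear_cov[OF x smooth_F]])
  have bi: "bitension h' h \<phi> z = - (\<Sum>i<?n. curvature h (\<phi> z) (?\<tau> z) (D \<phi> z (?E i z)) (D \<phi> z (?E i z)))
      - (\<Sum>i<?n. ?s i)"
    by (simp add: bitension_def Let_def)
  show "fst (bitension h' h \<phi> z) = (m / 2) *\<^sub>R (trace_nabla2 g F (p z)
      - (m / 2) *\<^sub>R cov g (\<lambda>x. x) F (p z) (F (p z)))"
    unfolding bi fst_diff fst_uminus fstR fstL nFT by (simp add: c_def algebra_simps)
  show "K (\<phi> z) (bitension h' h \<phi> z) = 0"
    unfolding bi K_diff[OF x] K_neg[OF x] KR KL by simp
qed

end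

section \<open>Charts of the tangent bundle\<close>

lemma smooth_manifoldD:
  assumes "smooth_manifold M" "c \<in> charts M"
  shows "inj_on (coord M c) (chart_dom M c)"
    and "d \<in> charts M \<Longrightarrow> open (coord M c ` (chart_dom M c \<inter> chart_dom M d))"
    and "d \<in> charts M \<Longrightarrow> smooth_on (coord M c ` (chart_dom M c \<inter> chart_dom M d)) (transition M c d)"
  using assms unfolding smooth_manifold_def by auto

lemma chart_inv_coord:
  assumes "smooth_manifold M" "c \<in> charts M" "p \<in> chart_dom M c"
  shows "chart_inv M c (coord M c p) = p"
  unfolding chart_inv_def by (rule inv_into_f_f[OF smooth_manifoldD(1)[OF assms(1,2)] assms(3)])

lemma transition_coord:
  assumes "smooth_manifold M" "c \<in> charts M" "p \<in> chart_dom M c"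
  shows "transition M c d (coord M c p) = coord M d p"
  using chart_inv_coord[OF assms] by (simp add: transition_def)

text \<open>The chain rule. It makes the components of a vector in one chart determine a consistent family
  of components in all charts.\<close>
lemma D_transition_cocycle:
  assumes M: "smooth_manifold M" and c: "c \<in> charts M" "p \<in> chart_dom M c"
    and d: "d \<in> charts M" "p \<in> chart_dom M d" and e: "e \<in> charts M" "p \<in> chart_dom M e"
  shows "D (transition M c e) (coord M c p) y =
    D (transition M d e) (coord M d p) (D (transition M c d) (coord M c p) y)"
proof -
  let ?A = "coord M c ` (chart_dom M c \<inter> chart_dom M d)"
  have op: "open ?A" by (rule smooth_manifoldD(2)[OF M c(1) d(1)])
  have x: "coord M c p \<in> ?A" using c d by auto
  have eq: "transition M c e w = transition M d e (transition M c d w)" if "w \<in> ?A" for w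
    using that transition_coord[OF M] c d by auto
  have "transition M c d differentiable (at (coord M c p))"
    using smooth_on_differentiable[OF smooth_manifoldD(3)[OF M c(1) d(1)]] c d by auto
  moreover have "transition M d e differentiable (at (transition M c d (coord M c p)))"
    using smooth_on_differentiable[OF smooth_manifoldD(3)[OF M d(1) e(1)]] d e transition_coord[OF M c] by auto
  ultimately show ?thesis
    using D_cong_open[OF op x eq] by (simp add: D_compose transition_coord[OF M c])
qed

lemma D_transition_self:
  assumes M: "smooth_manifold M" and c: "c \<in> charts M" "p \<in> chart_dom M c"
  shows "D (transition M c c) (coord M c p) y = y"
proof -
  have "open (coord M c ` chart_dom M c)" using smooth_manifoldD(2)[OF M c(1) c(1)] by simp
  then have "D (transition M c c) (coord M c p) = D (\<lambda>x. x) (coord M c p)"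
    by (rule D_cong_open) (use c(2) in \<open>auto simp: transition_coord[OF M c(1)]\<close>)
  then show ?thesis by simp
qed

lemma tangent_vector_exists:
  assumes M: "smooth_manifold M" and c: "c \<in> charts M" "p \<in> chart_dom M c"
  shows "\<exists>v\<in>tangent_space M p. v c = y"
proof -
  define v where "v d = (if d \<in> charts M \<and> p \<in> chart_dom M d
    then D (transition M c d) (coord M c p) y else 0)" for d
  have "v \<in> tangent_space M p"
    unfolding tangent_space_def
  proof (intro CollectI conjI ballI impI allI)
    fix d e assume d: "d \<in> charts M" "p \<in> chart_dom M d" and e: "e \<in> charts M" "p \<in> chart_dom M e"
    show "v e = D (transition M d e) (coord M d p) (v d)"
      using D_transition_cocycle[OF M c d e, of y] d e by (simp only: v_def simp_thms if_True)
  qed (auto simp: v_def)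
  moreover have "v c = y" using c D_transition_self[OF M c] by (simp add: v_def)
  ultimately show ?thesis by blast
qed

lemma chart_inv_tangent_bundle:
  assumes M: "smooth_manifold M" and c: "c \<in> charts M" and p: "p \<in> chart_dom M c"
    and v: "v \<in> tangent_space M p"
  shows "chart_inv (tangent_bundle M) c (coord M c p, v c) = (p, v)"
proof -
  have "inj_on (coord (tangent_bundle M) c) (chart_dom (tangent_bundle M) c)"
  proof (rule inj_onI, clarify)
    fix p v p' v'
    assume "(p, v) \<in> chart_dom (tangent_bundle M) c" "(p', v') \<in> chart_dom (tangent_bundle M) c"
      and "coord (tangent_bundle M) c (p, v) = coord (tangent_bundle M) c (p', v')"
    then have *: "p \<in> chart_dom M c" "p' \<in> chart_dom M c" "v \<in> tangent_space M p"
      "v' \<in> tangent_space M p'" "coord M c p = coord M c p'" "v c = v' c"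
      by (auto simp: tangent_bundle_def)
    then have p: "p' = p" using smooth_manifoldD(1)[OF M c] by (auto simp: inj_on_def)
    have "v d = v' d" for d
    proof (cases "d \<in> charts M \<and> p \<in> chart_dom M d")
      case True
      then have "v d = D (transition M c d) (coord M c p) (v c)"
        "v' d = D (transition M c d) (coord M c p) (v' c)"
        using *(1,3,4) c unfolding p tangent_space_def by blast+
      then show ?thesis using *(6) by simp
    next
      case False
      then have "v d = 0" "v' d = 0" using *(3,4) unfolding p tangent_space_def by blast+
      then show ?thesis by simp
    qed
    then show "p = p' \<and> v = v'" using p by auto
  qed
  moreover have "(p, v) \<in> chart_dom (tangent_bundle M) c" "coord (tangent_bundle M) c (p, v) = (coord M c p, v c)"
    using p v by (auto simp: tangent_bundle_def)
  ultimately show ?thesis unfolding chart_inv_def by (metis inv_into_f_f)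
qed

text \<open>Every coordinate vector \<open>y\<close> belongs to a tangent vector, so the domain is a full product; in
  particular it is open.\<close>
lemma local_dom_tangent_bundle:
  fixes M :: "('a, 'i, 'e::euclidean_space) manifold"
  assumes M: "smooth_manifold M" and c: "c \<in> charts M"
  shows "local_dom (tangent_bundle M) (tangent_bundle M) id c d =
    coord M c ` (chart_dom M c \<inter> chart_dom M d) \<times> UNIV"
proof (intro equalityI subsetI)
  fix z :: "'e \<times> 'e" assume "z \<in> coord M c ` (chart_dom M c \<inter> chart_dom M d) \<times> UNIV"
  then obtain p y where p: "p \<in> chart_dom M c" "p \<in> chart_dom M d" and z: "z = (coord M c p, y)" by auto
  obtain v where v: "v \<in> tangent_space M p" "v c = y" using tangent_vector_exists[OF M c p(1)] by blast
  show "z \<in> local_dom (tangent_bundle M) (tangent_bundle M) id c d"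
    unfolding local_dom_def
    by (rule image_eqI[of _ _ "(p, v)"]) (use p v z in \<open>auto simp: tangent_bundle_def\<close>)
next
  fix z assume "z \<in> local_dom (tangent_bundle M) (tangent_bundle M) id c d"
  then obtain p v where "p \<in> chart_dom M c" "p \<in> chart_dom M d" "z = (coord M c p, v c)"
    unfolding local_dom_def tangent_bundle_def by force
  then show "z \<in> coord M c ` (chart_dom M c \<inter> chart_dom M d) \<times> UNIV" by blast
qed

lemma local_expr_tangent_bundle:
  assumes M: "smooth_manifold M" and c: "c \<in> charts M" and d: "d \<in> charts M"
    and z: "fst z \<in> coord M c ` (chart_dom M c \<inter> chart_dom M d)"
  shows "local_expr (tangent_bundle M) (tangent_bundle M) id c d z =
    (transition M c d (fst z), D (transition M c d) (fst z) (snd z))"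
proof -
  obtain p where p: "p \<in> chart_dom M c" "p \<in> chart_dom M d" "fst z = coord M c p" using z by auto
  obtain v where v: "v \<in> tangent_space M p" "v c = snd z" using tangent_vector_exists[OF M c p(1)] by blast
  have "z = (coord M c p, v c)" using p v by (simp add: prod_eq_iff)
  then have "chart_inv (tangent_bundle M) c z = (p, v)"
    by (simp only: chart_inv_tangent_bundle[OF M c p(1) v(1)])
  then have "local_expr (tangent_bundle M) (tangent_bundle M) id c d z = coord (tangent_bundle M) d (p, v)"
    by (simp add: local_expr_def)
  also have "\<dots> = (coord M d p, v d)" by (simp add: tangent_bundle_def)
  also have "v d = D (transition M c d) (fst z) (snd z)"
  proof -
    have "v d = D (transition M c d) (coord M c p) (v c)"
      using v(1) p(1,2) c d unfolding tangent_space_def by blast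
    then show ?thesis by (simp only: v(2) p(3))
  qed
  finally show ?thesis by (simp only: p(3) transition_coord[OF M c p(1)])
qed

lemma riemannian_domain_chart:
  assumes M: "smooth_manifold M" and g: "riemannian_metric M g" and c: "c \<in> charts M"
  shows "riemannian_domain (chart_image M c) (g c)"
proof
  show "open (chart_image M c)"
    using smooth_manifoldD(2)[OF M c c] by (simp add: chart_image_def)
qed (use g c in \<open>auto simp: riemannian_metric_def\<close>)

lemma mus_sasaki_domain_chart:
  assumes M: "smooth_manifold M" and g: "riemannian_metric M g" "flat M g" and c: "c \<in> charts M"
    and f: "smooth_on (chart_image M c) (f \<circ> chart_inv M c)" "\<And>p. p \<in> points M \<Longrightarrow> f p > 0"
  shows "mus_sasaki_domain (chart_image M c) (g c) (f \<circ> chart_inv M c) (mus_sasaki M g f c)"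
proof (intro mus_sasaki_domain.intro flat_domain.intro)
  show "riemannian_domain (chart_image M c) (g c)" by (rule riemannian_domain_chart[OF M g(1) c])
  show "flat_domain_axioms (chart_image M c) (g c)"
    using g(2) c by unfold_locales (auto simp: flat_def)
  show "mus_sasaki_domain_axioms (chart_image M c) (g c) (f \<circ> chart_inv M c) (mus_sasaki M g f c)"
  proof
    show "0 < (f \<circ> chart_inv M c) x" if x: "x \<in> chart_image M c" for x
    proof -
      obtain p where p: "p \<in> chart_dom M c" "x = coord M c p" using x by (auto simp: chart_image_def)
      then have "chart_inv M c x \<in> points M" using chart_inv_coord[OF M c p(1)] c by (auto simp: points_def)
      then show ?thesis using f(2) by simp
    qed
    show "mus_sasaki M g f c z \<xi> \<eta> = g c (fst z) (fst \<xi>) (fst \<eta>) + (f \<circ> chart_inv M c) (fst z) *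
      g c (fst z) (snd \<xi> + christoffel (g c) (fst z) (fst \<xi>) (snd z))
        (snd \<eta> + christoffel (g c) (fst z) (fst \<eta>) (snd z))"
      if "fst z \<in> chart_image M c" for z \<xi> \<eta>
      using mus_sasaki_eq[OF M g(1) c that, of f "snd z" \<xi> \<eta>] by simp
  qed (rule f(1))
qed

text \<open>The source chart is restricted to its overlap with the target chart.\<close>
lemma sasaki_to_mus_sasaki_charts:
  fixes M :: "('a, 'i, 'e::euclidean_space) manifold"
  assumes M: "smooth_manifold M" and g: "riemannian_metric M g" "flat M g"
    and f: "smooth_function M f" "\<And>p. p \<in> points M \<Longrightarrow> f p > 0"
    and c: "c \<in> charts M" and d: "d \<in> charts M"
  shows "sasaki_to_mus_sasaki (chart_image M d) (g d) (f \<circ> chart_inv M d) (mus_sasaki M g f d)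
    (coord M c ` (chart_dom M c \<inter> chart_dom M d)) (g c) (sasaki M g c) (transition M c d)
    (local_expr (tangent_bundle M) (tangent_bundle M) id c d)"
proof -
  let ?S' = "coord M c ` (chart_dom M c \<inter> chart_dom M d)"
  interpret tgt: mus_sasaki_domain "chart_image M d" "g d" "f \<circ> chart_inv M d" "mus_sasaki M g f d"
    using mus_sasaki_domain_chart[OF M g d _ f(2)] f(1) d by (auto simp: smooth_function_def)
  interpret src: mus_sasaki_domain "chart_image M c" "g c" "(\<lambda>_. 1) \<circ> chart_inv M c" "mus_sasaki M g (\<lambda>_. 1) c"
    by (rule mus_sasaki_domain_chart[OF M g c]) (auto simp: o_def intro: smooth_on_const)
  have sub: "?S' \<subseteq> chart_image M c" by (auto simp: chart_image_def)
  have op: "open ?S'" by (rule smooth_manifoldD(2)[OF M c d])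
  interpret src': riemannian_domain ?S' "g c" by (rule src.riemannian_subset[OF op sub])
  show ?thesis
  proof unfold_locales
    fix x assume "x \<in> ?S'"
    then have x: "x \<in> chart_image M c" using sub by auto
    show "curvature (g c) x X Y Z = 0" for X Y Z by (rule src.flat[OF x])
    obtain p where p: "p \<in> chart_dom M c" "p \<in> chart_dom M d" "x = coord M c p"
      using \<open>x \<in> ?S'\<close> by auto
    then show "transition M c d x \<in> chart_image M d"
      using transition_coord[OF M c p(1)] by (auto simp: chart_image_def)
    show "g c x X Y = g d (transition M c d x) (D (transition M c d) x X) (D (transition M c d) x Y)" for X Y
    proof -
      have "g c (coord M c p) X Y = g d (coord M d p) (D (transition M c d) (coord M c p) X)
          (D (transition M c d) (coord M c p) Y)"
        using g(1) c d p(1,2) unfolding riemannian_metric_def by blast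
      then show ?thesis by (simp only: p(3) transition_coord[OF M c p(1)])
    qed
  next
    fix z \<xi> \<eta> :: "'e \<times> 'e" assume "fst z \<in> ?S'"
    then have "fst z \<in> chart_image M c" using sub by auto
    from src.h_eq[OF this, of \<xi> \<eta>]
    show "sasaki M g c z \<xi> \<eta> = g c (fst z) (fst \<xi>) (fst \<eta>) + 1 *
      g c (fst z) (snd \<xi> + christoffel (g c) (fst z) (fst \<xi>) (snd z))
        (snd \<eta> + christoffel (g c) (fst z) (fst \<eta>) (snd z))"
      by (simp add: sasaki_def)
  qed (auto intro: smooth_on_const smooth_manifoldD(3)[OF M c d] op
      local_expr_tangent_bundle[OF M c d])
qed

text \<open>The neighbourhood of a point is the preimage of a ball in a chart.\<close>
lemma locally_constant_if_D_zero:
  assumes M: "smooth_manifold M" and f: "smooth_function M f"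
    and D0: "\<And>c x. c \<in> charts M \<Longrightarrow> x \<in> chart_image M c \<Longrightarrow> D (f \<circ> chart_inv M c) x = (\<lambda>_. 0)"
  shows "locally_constant M f"
  unfolding locally_constant_def
proof
  fix p assume "p \<in> points M"
  then obtain c where c: "c \<in> charts M" "p \<in> chart_dom M c" by (auto simp: points_def)
  have "open (chart_image M c)"
    using smooth_manifoldD(2)[OF M c(1) c(1)] by (simp add: chart_image_def)
  then obtain r where r: "r > 0" "ball (coord M c p) r \<subseteq> chart_image M c"
    using c(2) by (metis chart_image_def imageI openE)
  let ?B = "ball (coord M c p) r" and ?f = "f \<circ> chart_inv M c"
  define U where "U = {q \<in> chart_dom M c. coord M c q \<in> ?B}"
  have const: "f q = f p" if "q \<in> U" for q
  proof -
    have "(?f has_derivative (\<lambda>_. 0)) (at x within ?B)" if "x \<in> ?B" for x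
    proof -
      have x: "x \<in> chart_image M c" using that r by blast
      have "smooth_on (chart_image M c) ?f" using f c by (simp add: smooth_function_def)
      from smooth_on_has_derivative[OF this x] show ?thesis
        unfolding D0[OF c(1) x] by (rule has_derivative_at_withinI)
    qed
    from has_derivative_zero_constant[OF convex_ball this]
    obtain k where k: "\<And>x. x \<in> ?B \<Longrightarrow> ?f x = k" by blast
    have "coord M c p \<in> ?B" "coord M c q \<in> ?B" using that r by (auto simp: U_def)
    from this[THEN k] show ?thesis
      using that chart_inv_coord[OF M c(1)] c(2) by (simp add: U_def)
  qed
  have "open {x \<in> chart_image M d. chart_inv M d x \<in> U}" if d: "d \<in> charts M" for d
  proof -
    let ?A = "coord M d ` (chart_dom M d \<inter> chart_dom M c)"
    have "{x \<in> chart_image M d. chart_inv M d x \<in> U} = ?A \<inter> transition M d c -` ?B"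
      using chart_inv_coord[OF M d] transition_coord[OF M d] by (auto simp: U_def chart_image_def)
    also have "open \<dots>"
      by (rule continuous_open_preimage[OF smooth_on_continuous[OF smooth_manifoldD(3)[OF M d c(1)]]
            smooth_manifoldD(2)[OF M d c(1)] open_ball])
    finally show ?thesis .
  qed
  then have "openin (manifold_topology M) U"
    using c(1) by (auto simp: openin_manifold_topology U_def points_def)
  moreover have "p \<in> U" using c r by (simp add: U_def)
  ultimately show "\<exists>U. openin (manifold_topology M) U \<and> p \<in> U \<and> (\<forall>q\<in>U. f q = f p)"
    using const by blast
qed

theorem theorem4p14:
  fixes M :: "('a, 'i, 'e::euclidean_space) manifold" and g :: "('i, 'e) metric"
    and f :: "'a \<Rightarrow> real" and m :: nat
  assumes "smooth_manifold M" and "DIM('e) = m"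
    and "riemannian_metric M g" and "flat M g"
    and "smooth_function M f" and "\<And>p. p \<in> points M \<Longrightarrow> f p > 0"
    and "\<not> locally_constant M f"
  shows "proper_biharmonic (tangent_bundle M) (sasaki M g) (tangent_bundle M) (mus_sasaki M g f) id
    \<longleftrightarrow> (\<forall>c\<in>charts M. \<forall>x\<in>chart_image M c.
          (real m / 4) *\<^sub>R
             grad (g c) (\<lambda>z. (norm_of (g c) z (grad (g c) (f \<circ> chart_inv M c) z))\<^sup>2) x
          = trace_nabla2 (g c) (grad (g c) (f \<circ> chart_inv M c)) x)"
proof -
  note M = assms(1) and g = assms(3,4) and f = assms(5,6)
  let ?TM = "tangent_bundle M" and ?\<phi> = "\<lambda>c d. local_expr (tangent_bundle M) (tangent_bundle M) id c d"
    and ?S' = "\<lambda>c d. coord M c ` (chart_dom M c \<inter> chart_dom M d)" and ?f = "\<lambda>c. f \<circ> chart_inv M c"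
  let ?eq = "\<lambda>c x. (real m / 4) *\<^sub>R grad (g c) (\<lambda>z. (norm_of (g c) z (grad (g c) (?f c) z))\<^sup>2) x
    = trace_nabla2 (g c) (grad (g c) (?f c)) x"
  have m: "real m > 0" using DIM_positive[where 'a = 'e] assms(2) by simp
  have charts_TM [simp]: "charts ?TM = charts M" by (simp add: tangent_bundle_def)
  have loc: "local_dom ?TM ?TM id c d = ?S' c d \<times> UNIV" if "c \<in> charts M" for c d
    by (rule local_dom_tangent_bundle[OF M that])
  \<comment> \<open>At the source point \<open>z\<close> both equations only involve the target chart at the image of \<open>fst z\<close>.\<close>
  have bi: "bitension (sasaki M g c) (mus_sasaki M g f d) (?\<phi> c d) z = 0 \<longleftrightarrow> ?eq d (transition M c d (fst z))"
    and har: "tension (sasaki M g c) (mus_sasaki M g f d) (?\<phi> c d) z = 0 \<Longrightarrow>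
      D (?f d) (transition M c d (fst z)) = (\<lambda>_. 0)"
    if c: "c \<in> charts M" and d: "d \<in> charts M" and z: "z \<in> ?S' c d \<times> UNIV" for c d z
  proof -
    interpret sasaki_to_mus_sasaki "chart_image M d" "g d" "?f d" "mus_sasaki M g f d"
      "?S' c d" "g c" "sasaki M g c" "transition M c d" "?\<phi> c d"
      by (rule sasaki_to_mus_sasaki_charts[OF M g f c d])
    have p: "p z = transition M c d (fst z)" using z by (auto simp: \<phi>_eq)
    note x = p_S[OF z]
    have zero: "\<xi> = 0" if "fst \<xi> = 0" "K (?\<phi> c d z) \<xi> = 0" for \<xi>
      using that by (intro components_eqI[of _ _ "?\<phi> c d z"]) (simp_all add: K_zero[OF x])
    note B = bitension_components[OF z, unfolded assms(2)]
    have "bitension (sasaki M g c) (mus_sasaki M g f d) (?\<phi> c d) z = 0 \<longleftrightarrow>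
        fst (bitension (sasaki M g c) (mus_sasaki M g f d) (?\<phi> c d) z) = 0"
      using zero[OF _ B(2)] by auto
    also have "\<dots> \<longleftrightarrow> (real m / 2) *\<^sub>R cov (g d) (\<lambda>x. x) F (p z) (F (p z)) = trace_nabla2 (g d) F (p z)"
      unfolding B(1) using m by auto
    also have "\<dots> \<longleftrightarrow> ?eq d (p z)"
      unfolding grad_norm_square[OF x] by simp
    finally show "bitension (sasaki M g c) (mus_sasaki M g f d) (?\<phi> c d) z = 0 \<longleftrightarrow>
        ?eq d (transition M c d (fst z))"
      unfolding p .
    assume "tension (sasaki M g c) (mus_sasaki M g f d) (?\<phi> c d) z = 0"
    then have "F (p z) = 0" using tension_components(1)[OF z, unfolded assms(2)] m by simp
    then show "D (?f d) (transition M c d (fst z)) = (\<lambda>_. 0)"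
      using g_F[OF x] g_bilinear_simps[OF x] p by (auto simp: fun_eq_iff)
  qed
  \<comment> \<open>The zero section and the pairs of equal charts reach all points of the base.\<close>
  have self: "(x, 0) \<in> ?S' c c \<times> UNIV" "transition M c c x = x"
    if "c \<in> charts M" "x \<in> chart_image M c" for c x
    using that transition_coord[OF M that(1)] by (auto simp: chart_image_def)
  have "\<not> harmonic ?TM (sasaki M g) ?TM (mus_sasaki M g f) id"
  proof
    assume harm: "harmonic ?TM (sasaki M g) ?TM (mus_sasaki M g f) id"
    have "D (?f c) x = (\<lambda>_. 0)" if "c \<in> charts M" "x \<in> chart_image M c" for c x
      using har[OF that(1,1) self(1)[OF that]] harm self[OF that] that(1)
      by (simp add: harmonic_def loc[OF that(1)])
    then show False using locally_constant_if_D_zero[OF M f(1)] assms(7) by blast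
  qed
  moreover have "biharmonic ?TM (sasaki M g) ?TM (mus_sasaki M g f) id \<longleftrightarrow>
      (\<forall>c\<in>charts M. \<forall>x\<in>chart_image M c. ?eq c x)"
  proof
    assume bih: "biharmonic ?TM (sasaki M g) ?TM (mus_sasaki M g f) id"
    show "\<forall>c\<in>charts M. \<forall>x\<in>chart_image M c. ?eq c x"
    proof (intro ballI)
      fix c x assume cx: "c \<in> charts M" "x \<in> chart_image M c"
      then have "bitension (sasaki M g c) (mus_sasaki M g f c) (?\<phi> c c) (x, 0) = 0"
        using bih self(1)[OF cx] unfolding biharmonic_def charts_TM by (metis loc[OF cx(1)])
      then show "?eq c x" unfolding bi[OF cx(1,1) self(1)[OF cx]] using self(2)[OF cx] by simp
    qed
  next
    assume eq: "\<forall>c\<in>charts M. \<forall>x\<in>chart_image M c. ?eq c x"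
    show "biharmonic ?TM (sasaki M g) ?TM (mus_sasaki M g f) id"
      unfolding biharmonic_def charts_TM
    proof (intro ballI)
      fix c d z assume c: "c \<in> charts M" and d: "d \<in> charts M" and "z \<in> local_dom ?TM ?TM id c d"
      then have z: "z \<in> ?S' c d \<times> UNIV" using loc[OF c] by simp
      then have "transition M c d (fst z) \<in> chart_image M d"
        using transition_coord[OF M c] by (auto simp: chart_image_def)
      then show "bitension (sasaki M g c) (mus_sasaki M g f d) (?\<phi> c d) z = 0"
        unfolding bi[OF c d z] using eq d by blast
    qed
  qed
  ultimately show ?thesis by (simp add: proper_biharmonic_def)
qed

end
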